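(* Let $n\ge 3$. The linearization $L$ at the ball ($\rho\equiv 1$) of the intersection body shape map $T$ acts on the space $\mathcal{H}_d$ of degree-$d$ spherical harmonics as multiplication by $(n-1)\mu_d$, where $\mu_d$ is the Funk multiplier. Explicitly, $(n-1)\mu_d=0$ for odd $d$, and for even $d=2m$, $$(n-1)\mu_{2m}=(-1)^m\,\frac{(n-1)\,(2m)!\,\Gamma\big(\tfrac{n-2}{2}+m\big)\Gamma(n-2)}{m!\,\Gamma\big(\tfrac{n-2}{2}\big)\,\Gamma(n-2+2m)}.$$ In particular $(n-1)\mu_0=n-1$, $(n-1)\mu_2=-1$ and $(n-1)\mu_4=3/(n+1)$. Consequently the linearization $L^2=L\circ L$ of $T\circ T$ (the shape map of $\mathcal{I}^2$) at the ball acts on $\mathcal{H}_d$ as multiplication by $\sigma_d=\big((n-1)\mu_d\big)^2$, with $\sigma_0=(n-1)^2>1$, $\sigma_2=1$, and $0\le\sigma_d<1$ for all $d\ge 4$. The sequence $(\sigma_d)$, restricted to even $d\ge 4$, is strictly decreasing, so the maximum of $\sigma_d$ over $d\ge4$ is attained at $d=4$, and $$\mathrm{gap}(n):=1-\max_{d\ge4}\sigma_d=1-\frac{9}{(n+1)^2}=\frac{(n-2)(n+4)}{(n+1)^2}.$$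
   Context: $S^{n-1}$ is the unit sphere of $\mathbb{R}^n$, and $\mathcal{H}_d$ is the space of spherical harmonics of degree $d$ on $S^{n-1}$. The spherical Radon (Funk) transform is $(\mathcal{R}f)(u)=\frac{1}{|S^{n-1}\cap u^\perp|}\int_{S^{n-1}\cap u^\perp}f(v)\,dv$, i.e. the average of $f$ over the great subsphere orthogonal to $u$, so $\mathcal{R}\mathbf 1=\mathbf 1$; it extends to a bounded self-adjoint operator on $L^2(S^{n-1})$. It acts on $\mathcal{H}_d$ as multiplication by the Funk multiplier $\mu_d=C_d^{\lambda}(0)/C_d^{\lambda}(1)$ with $\lambda=\frac{n-2}{2}$, where $C_d^\lambda$ is the Gegenbauer polynomial (normalised ratio; only the ratio matters). The intersection body operator $\mathcal{I}$ sends a star body $K$ with continuous positive radial function $\rho_K$ to the star body with radial function $\rho_{\mathcal{I}K}(u)=\mathrm{vol}_{n-1}(K\cap u^\perp)$; up to a dimensional constant factor, it acts on radial functions by the shape map $T(\rho):=\mathcal{R}(\rho^{\,n-1})$. One has $T(1)=1$. $L$ denotes the linearization of $T$ at $\rho\equiv1$, i.e. the linear part in $\psi$ of $T(1+\psi)$ (derivative of $T$ at the constant function $1$), regarded as a bounded operator on $L^2(S^{n-1})$. Bodies are considered modulo dilation, so that the mode $\mathcal{H}_0$ (the dilation direction) is removed when one passes to the projective quotient; $\mathcal{H}_2$ is the space of ellipsoidal directions. *)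

theory Defs
  imports "HOL-Analysis.Analysis"
begin

section \<open>The unit sphere\<close>

typedef (overloaded) 'a usphere = "sphere (0 :: 'a :: euclidean_space) 1"
  morphisms point Usphere
  by (rule exI[of _ "SOME b. b \<in> Basis"]) (simp add: norm_Basis some_in_eq)

setup_lifting type_definition_usphere

instantiation usphere :: (euclidean_space) metric_space
begin

lift_definition dist_usphere :: "'a usphere \<Rightarrow> 'a usphere \<Rightarrow> real" is dist .

definition uniformity_usphere :: "('a usphere \<times> 'a usphere) filter"
  where "uniformity_usphere = (INF e\<in>{0 <..}. principal {(x, y). dist x y < e})"

definition open_usphere :: "'a usphere set \<Rightarrow> bool"
  where "open_usphere U \<longleftrightarrow> (\<forall>x\<in>U. \<forall>\<^sub>F (x', y) in uniformity. x' = x \<longrightarrow> y \<in> U)"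

instance
proof
  fix x y z :: "'a usphere"
  show "dist x y = 0 \<longleftrightarrow> x = y" by transfer simp
  show "dist x y \<le> dist x z + dist y z" by transfer (rule dist_triangle2)
qed (simp_all add: uniformity_usphere_def open_usphere_def)

end

lemma norm_point [simp]: "norm (point v) = 1"
  using point[of v] by simp

lemma point_Usphere_sgn: "x \<noteq> 0 \<Longrightarrow> point (Usphere (sgn x)) = sgn x"
  by (rule Usphere_inverse) (simp add: norm_sgn)


section \<open>Surface measures\<close>

text \<open>
  The surface measure of a Borel set \<open>A\<close> of the unit sphere of an \<open>m\<close>-dimensional space is
  \<open>m\<close> times the volume of the cone over \<open>A\<close>.
\<close>

definition sphere_measure :: "'a :: euclidean_space usphere measure" where
  "sphere_measure =
     scale_measure (of_nat DIM('a))
       (distr (restrict_space lborel (cball 0 1 - {0})) borel (\<lambda>x. Usphere (sgn x)))"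

definition great_subsphere :: "'a :: euclidean_space usphere \<Rightarrow> 'a usphere set" where
  "great_subsphere u = {v. point v \<bullet> point u = 0}"

definition proj_perp :: "'a :: euclidean_space usphere \<Rightarrow> 'a \<Rightarrow> 'a" where
  "proj_perp u x = x - (x \<bullet> point u) *\<^sub>R point u"

text \<open>
  The same cone construction inside the hyperplane orthogonal to \<open>u\<close>, which has dimension
  \<open>DIM('a) - 1\<close>.  The hyperplane volume of a set \<open>B\<close> is the ambient volume of the cylinder of
  height one over \<open>B\<close> in the direction \<open>u\<close>, so the measure of \<open>A\<close> is \<open>DIM('a) - 1\<close>
  times the volume of the cylinder over the cone over \<open>A \<inter> great_subsphere u\<close>.
\<close>

definition subsphere_measure :: "'a :: euclidean_space usphere \<Rightarrow> 'a usphere measure" where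
  "subsphere_measure u =
     scale_measure (of_nat (DIM('a) - 1))
       (distr
         (restrict_space lborel
           {x. 0 \<le> x \<bullet> point u \<and> x \<bullet> point u \<le> 1 \<and> 0 < norm (proj_perp u x) \<and> norm (proj_perp u x) \<le> 1})
         borel (\<lambda>x. Usphere (sgn (proj_perp u x))))"

definition funk :: "('a :: euclidean_space usphere \<Rightarrow> real) \<Rightarrow> 'a usphere \<Rightarrow> real" where
  "funk f u =
     (LINT v:great_subsphere u|subsphere_measure u. f v)
       / measure (subsphere_measure u) (great_subsphere u)"


section \<open>The inner product space of square-integrable functions on the sphere\<close>

lemma continuous_on_sgn_sphere: "continuous_on (- {0 :: 'a :: euclidean_space}) (\<lambda>x. Usphere (sgn x))"
proof -
  have "dist (Usphere (sgn x)) (Usphere (sgn y)) = dist (sgn x) (sgn y)" if "x \<noteq> 0" "y \<noteq> 0" for x y :: 'a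
    using that by (simp add: dist_usphere.rep_eq point_Usphere_sgn)
  moreover have "continuous_on (- {0 :: 'a}) sgn"
    by (auto simp: sgn_div_norm intro!: continuous_intros)
  ultimately show ?thesis
    unfolding continuous_on_iff by simp
qed

lemma measurable_Usphere_sgn [measurable]:
  "(\<lambda>x. Usphere (sgn x)) \<in> restrict_space lborel (cball 0 1 - {0 :: 'a :: euclidean_space}) \<rightarrow>\<^sub>M borel"
proof -
  have "(\<lambda>x :: 'a. Usphere (sgn x)) \<in> borel_measurable (restrict_space borel (cball 0 1 - {0}))"
    by (rule borel_measurable_continuous_on_restrict, rule continuous_on_subset[OF continuous_on_sgn_sphere]) auto
  then show ?thesis
    by (simp cong: measurable_cong_sets add: sets_restrict_space)
qed

lemma space_sphere_measure [simp]: "space sphere_measure = UNIV"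
  and sets_sphere_measure [measurable_cong, simp]: "sets sphere_measure = sets borel"
  by (simp_all add: sphere_measure_def space_scale_measure)

lemma finite_sphere_measure: "finite_measure (sphere_measure :: 'a :: euclidean_space usphere measure)"
proof
  have "emeasure (lborel :: 'a measure) (cball 0 1 - {0}) \<le> emeasure lborel (cball 0 1 :: 'a set)"
    by (rule emeasure_mono) auto
  then have "emeasure (lborel :: 'a measure) (cball 0 1 - {0}) < \<infinity>"
    using emeasure_compact_finite[OF compact_cball, of "0 :: 'a" 1] by (auto simp: emeasure_lborel_cball_finite)
  then show "emeasure (sphere_measure :: 'a usphere measure) (space sphere_measure) \<noteq> \<infinity>"
    by (auto simp: sphere_measure_def space_scale_measure emeasure_distr emeasure_restrict_space
        space_restrict_space ennreal_mult_eq_top_iff)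
qed

definition square_integrable :: "('a :: euclidean_space usphere \<Rightarrow> real) \<Rightarrow> bool" where
  "square_integrable f \<longleftrightarrow>
     f \<in> borel_measurable sphere_measure \<and> integrable sphere_measure (\<lambda>x. (f x)\<^sup>2)"

definition L2_rel :: "('a :: euclidean_space usphere \<Rightarrow> real) \<Rightarrow> ('a usphere \<Rightarrow> real) \<Rightarrow> bool" where
  "L2_rel f g \<longleftrightarrow>
     square_integrable f \<and> square_integrable g \<and> (AE x in sphere_measure. f x = g x)"

lemma square_integrable_mult:
  assumes "square_integrable f" "square_integrable g"
  shows "integrable sphere_measure (\<lambda>x. f x * g x)"
proof (rule Bochner_Integration.integrable_bound)
  show "integrable sphere_measure (\<lambda>x. (f x)\<^sup>2 + (g x)\<^sup>2)"
    using assms by (auto simp: square_integrable_def)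
  show "(\<lambda>x. f x * g x) \<in> borel_measurable sphere_measure"
    using assms by (auto simp: square_integrable_def)
  have "\<bar>a * b\<bar> \<le> a\<^sup>2 + b\<^sup>2" for a b :: real
  proof -
    have "2 * \<bar>a\<bar> * \<bar>b\<bar> \<le> \<bar>a\<bar>\<^sup>2 + \<bar>b\<bar>\<^sup>2" by (rule sum_squares_bound)
    moreover have "0 \<le> \<bar>a\<bar> * \<bar>b\<bar>" by simp
    ultimately have "\<bar>a\<bar> * \<bar>b\<bar> \<le> \<bar>a\<bar>\<^sup>2 + \<bar>b\<bar>\<^sup>2" by linarith
    then show ?thesis by (simp add: abs_mult)
  qed
  then show "AE x in sphere_measure. norm (f x * g x) \<le> norm ((f x)\<^sup>2 + (g x)\<^sup>2)"
    by (intro AE_I2) (simp add: abs_of_nonneg[OF add_nonneg_nonneg])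
qed

lemma square_integrable_add:
  assumes "square_integrable f" "square_integrable g"
  shows "square_integrable (\<lambda>x. f x + g x)"
proof -
  have "(\<lambda>x. (f x + g x)\<^sup>2) = (\<lambda>x. (f x)\<^sup>2 + (g x)\<^sup>2 + 2 * (f x * g x))"
    by (auto simp: power2_sum)
  then show ?thesis
    using assms square_integrable_mult[OF assms]
    by (auto simp: square_integrable_def intro!: borel_measurable_add)
qed

lemma square_integrable_scale:
  "square_integrable f \<Longrightarrow> square_integrable (\<lambda>x. c * f x)"
  by (auto simp: square_integrable_def power_mult_distrib)

lemma square_integrable_zero: "square_integrable (\<lambda>x. 0)"
  by (simp add: square_integrable_def)

lemma AE_L2_trans:
  fixes f g h :: "'a :: euclidean_space usphere \<Rightarrow> real"
  assumes "AE x in sphere_measure. f x = g x" "AE x in sphere_measure. g x = h x"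
  shows "AE x in sphere_measure. f x = h x"
  using assms by eventually_elim simp

quotient_type (overloaded) 'a sphere_L2 = "'a :: euclidean_space usphere \<Rightarrow> real" / partial: L2_rel
proof (rule part_equivpI)
  show "\<exists>x. L2_rel x x"
    by (rule exI[of _ "\<lambda>_. 0"]) (simp add: L2_rel_def square_integrable_zero)
  show "symp L2_rel" by (simp add: symp_def L2_rel_def eq_commute)
  show "transp L2_rel"
    unfolding transp_def L2_rel_def by (blast intro: AE_L2_trans)
qed

instantiation sphere_L2 :: (euclidean_space) real_vector
begin

lift_definition zero_sphere_L2 :: "'a sphere_L2" is "\<lambda>x. 0"
  by (simp add: L2_rel_def square_integrable_zero)

lift_definition plus_sphere_L2 :: "'a sphere_L2 \<Rightarrow> 'a sphere_L2 \<Rightarrow> 'a sphere_L2"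
  is "\<lambda>f g x. f x + g x"
  unfolding L2_rel_def
proof (intro conjI; elim conjE)
  fix f f' g g' :: "'a usphere \<Rightarrow> real"
  assume "AE x in sphere_measure. f x = f' x" "AE x in sphere_measure. g x = g' x"
  then show "AE x in sphere_measure. f x + g x = f' x + g' x"
    by eventually_elim simp
qed (simp_all add: square_integrable_add)

lift_definition uminus_sphere_L2 :: "'a sphere_L2 \<Rightarrow> 'a sphere_L2" is "\<lambda>f x. - f x"
  unfolding L2_rel_def
proof (intro conjI; elim conjE)
  fix f f' :: "'a usphere \<Rightarrow> real"
  assume "AE x in sphere_measure. f x = f' x"
  then show "AE x in sphere_measure. - f x = - f' x"
    by eventually_elim simp
qed (use square_integrable_scale[of _ "-1"] in simp_all)

lift_definition scaleR_sphere_L2 :: "real \<Rightarrow> 'a sphere_L2 \<Rightarrow> 'a sphere_L2"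
  is "\<lambda>c f x. c * f x"
  unfolding L2_rel_def
proof (intro conjI; elim conjE)
  fix c and f f' :: "'a usphere \<Rightarrow> real"
  assume "AE x in sphere_measure. f x = f' x"
  then show "AE x in sphere_measure. c * f x = c * f' x"
    by eventually_elim simp
qed (simp_all add: square_integrable_scale)

definition minus_sphere_L2 :: "'a sphere_L2 \<Rightarrow> 'a sphere_L2 \<Rightarrow> 'a sphere_L2"
  where "f - g = f + - (g :: 'a sphere_L2)"

instance
proof
  fix f g h :: "'a sphere_L2" and a b :: real
  show "f + g + h = f + (g + h)"
    by transfer (auto simp: L2_rel_def square_integrable_add add.assoc)
  show "f + g = g + f"
    by transfer (auto simp: L2_rel_def square_integrable_add add.commute)
  show "0 + f = f"
    by transfer (auto simp: L2_rel_def)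
  show "- f + f = 0"
    by transfer (auto simp: L2_rel_def square_integrable_zero)
  show "f - g = f + - g"
    by (rule minus_sphere_L2_def)
  show "a *\<^sub>R (f + g) = a *\<^sub>R f + a *\<^sub>R g"
    by transfer (auto simp: L2_rel_def square_integrable_add square_integrable_scale distrib_left)
  show "(a + b) *\<^sub>R f = a *\<^sub>R f + b *\<^sub>R f"
    by transfer (auto simp: L2_rel_def square_integrable_add square_integrable_scale distrib_right)
  show "a *\<^sub>R b *\<^sub>R f = (a * b) *\<^sub>R f"
    by transfer (auto simp: L2_rel_def square_integrable_scale mult.assoc)
  show "1 *\<^sub>R f = f"
    by transfer (auto simp: L2_rel_def)
qed

end

instantiation sphere_L2 :: (euclidean_space) real_inner
begin

lift_definition inner_sphere_L2 :: "'a sphere_L2 \<Rightarrow> 'a sphere_L2 \<Rightarrow> real"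
  is "\<lambda>f g. LINT x|sphere_measure. f x * g x"
proof -
  fix f f' g g' :: "'a usphere \<Rightarrow> real"
  assume *: "L2_rel f f'" "L2_rel g g'"
  then have "AE x in sphere_measure. f x = f' x" "AE x in sphere_measure. g x = g' x"
    by (simp_all add: L2_rel_def)
  then have "AE x in sphere_measure. f x * g x = f' x * g' x"
    by eventually_elim simp
  with * show "(LINT x|sphere_measure. f x * g x) = (LINT x|sphere_measure. f' x * g' x)"
    unfolding L2_rel_def square_integrable_def
    by (intro integral_cong_AE borel_measurable_times) simp_all
qed

definition norm_sphere_L2 :: "'a sphere_L2 \<Rightarrow> real"
  where "norm f = sqrt (inner f (f :: 'a sphere_L2))"

definition sgn_sphere_L2 :: "'a sphere_L2 \<Rightarrow> 'a sphere_L2"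
  where "sgn f = f /\<^sub>R norm (f :: 'a sphere_L2)"

definition dist_sphere_L2 :: "'a sphere_L2 \<Rightarrow> 'a sphere_L2 \<Rightarrow> real"
  where "dist f g = norm (f - g :: 'a sphere_L2)"

definition uniformity_sphere_L2 :: "('a sphere_L2 \<times> 'a sphere_L2) filter"
  where "uniformity_sphere_L2 = (INF e\<in>{0 <..}. principal {(x, y). dist x y < e})"

definition open_sphere_L2 :: "'a sphere_L2 set \<Rightarrow> bool"
  where "open_sphere_L2 U \<longleftrightarrow> (\<forall>x\<in>U. \<forall>\<^sub>F (x', y) in uniformity. x' = x \<longrightarrow> y \<in> U)"

instance
proof
  fix f g h :: "'a sphere_L2" and a :: real
  show "inner f g = inner g f"
    by transfer (simp add: mult.commute)
  show "inner (f + g) h = inner f h + inner g h"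
    by transfer (auto simp: L2_rel_def distrib_right square_integrable_mult)
  show "inner (a *\<^sub>R f) g = a * inner f g"
    by transfer (auto simp: mult.assoc)
  show "0 \<le> inner f f"
    by transfer auto
  show "inner f f = 0 \<longleftrightarrow> f = 0"
  proof transfer
    fix f :: "'a usphere \<Rightarrow> real"
    assume "L2_rel f f"
    then have f: "square_integrable f" by (simp add: L2_rel_def)
    have "(LINT x|sphere_measure. f x * f x) = 0 \<longleftrightarrow> (AE x in sphere_measure. f x * f x = 0)"
      by (rule integral_nonneg_eq_0_iff_AE[OF square_integrable_mult[OF f f]]) auto
    then show "(LINT x|sphere_measure. f x * f x) = 0 \<longleftrightarrow> L2_rel f (\<lambda>x. 0)"
      using f by (simp add: L2_rel_def square_integrable_zero)
  qed
qed (rule norm_sphere_L2_def sgn_sphere_L2_def dist_sphere_L2_def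
       uniformity_sphere_L2_def open_sphere_L2_def)+

end

lemma L2_rel_bcontfun: "L2_rel (apply_bcontfun f) (apply_bcontfun f)"
proof -
  obtain B where B: "\<And>x. \<bar>apply_bcontfun f x\<bar> \<le> B"
    using bounded_apply_bcontfun[of f] by (auto simp: bounded_iff)
  have meas: "apply_bcontfun f \<in> borel_measurable sphere_measure"
    using borel_measurable_continuous_onI[OF continuous_on_apply_bcontfun[of UNIV f]] by simp
  interpret finite_measure "sphere_measure :: 'a usphere measure"
    by (rule finite_sphere_measure)
  have "integrable sphere_measure (\<lambda>x. (apply_bcontfun f x)\<^sup>2)"
  proof (rule integrable_const_bound[of _ "B\<^sup>2"])
    show "AE x in sphere_measure. norm ((apply_bcontfun f x)\<^sup>2) \<le> B\<^sup>2"
    proof (rule AE_I2)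
      fix x
      have "\<bar>apply_bcontfun f x\<bar>\<^sup>2 \<le> B\<^sup>2" by (rule power_mono[OF B]) simp
      then show "norm ((apply_bcontfun f x)\<^sup>2) \<le> B\<^sup>2" by simp
    qed
    show "(\<lambda>x. (apply_bcontfun f x)\<^sup>2) \<in> borel_measurable sphere_measure"
      using meas by (rule borel_measurable_power)
  qed
  with meas show ?thesis
    by (simp add: L2_rel_def square_integrable_def)
qed

definition to_L2 :: "('a :: euclidean_space usphere \<Rightarrow>\<^sub>C real) \<Rightarrow> 'a sphere_L2" where
  "to_L2 f = abs_sphere_L2 (apply_bcontfun f)"


section \<open>The shape map and its linearization at the ball\<close>

text \<open>
  Great-subsphere averages of a continuous function depend continuously on the pole, so
  \<open>Bcontfun\<close> is applied to a continuous function here.  On positive \<open>\<rho>\<close> this is the shape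
  map of the intersection body operator; the same formula makes sense for all continuous \<open>\<rho>\<close>.
\<close>

definition shape_map :: "('a :: euclidean_space usphere \<Rightarrow>\<^sub>C real) \<Rightarrow> ('a usphere \<Rightarrow>\<^sub>C real)" where
  "shape_map \<rho> = Bcontfun (funk (\<lambda>v. apply_bcontfun \<rho> v ^ (DIM('a) - 1)))"

text \<open>
  \<open>L\<close> is the Frechet derivative of \<open>S\<close> at the constant function one, taken in the supremum
  norm and regarded as a bounded operator on \<open>L\<^sup>2\<close>.
\<close>

definition is_linearization_at_ball ::
  "(('a :: euclidean_space usphere \<Rightarrow>\<^sub>C real) \<Rightarrow> ('a usphere \<Rightarrow>\<^sub>C real))
     \<Rightarrow> ('a sphere_L2 \<Rightarrow>\<^sub>L 'a sphere_L2) \<Rightarrow> bool" where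
  "is_linearization_at_ball S L \<longleftrightarrow>
     (\<exists>D. (S has_derivative D) (at (const_bcontfun 1)) \<and>
          (\<forall>\<psi>. blinfun_apply L (to_L2 \<psi>) = to_L2 (D \<psi>)))"


section \<open>Spherical harmonics\<close>

definition laplacian :: "('a :: euclidean_space \<Rightarrow> real) \<Rightarrow> 'a \<Rightarrow> real" where
  "laplacian p x = (\<Sum>b\<in>Basis. (deriv ^^ 2) (\<lambda>t. p (x + t *\<^sub>R b)) 0)"

definition spherical_harmonics :: "nat \<Rightarrow> ('a :: euclidean_space usphere \<Rightarrow>\<^sub>C real) set" where
  "spherical_harmonics d =
     {Y. \<exists>p. real_polynomial_function p \<and> (\<forall>c x. p (c *\<^sub>R x) = c ^ d * p x) \<and>
             (\<forall>x. laplacian p x = 0) \<and> (\<forall>v. apply_bcontfun Y v = p (point v))}"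


section \<open>Funk multipliers and the spectral gap\<close>

text \<open>\<open>gegenbauer l d\<close> is the Gegenbauer polynomial \<open>C\<^sub>d\<close> with parameter \<open>l\<close>.\<close>

fun gegenbauer :: "real \<Rightarrow> nat \<Rightarrow> real \<Rightarrow> real" where
  "gegenbauer l 0 x = 1"
| "gegenbauer l (Suc 0) x = 2 * l * x"
| "gegenbauer l (Suc (Suc d)) x =
     (2 * x * (real d + 1 + l) * gegenbauer l (Suc d) x - (real d + 2 * l) * gegenbauer l d x)
       / (real d + 2)"

definition funk_multiplier :: "nat \<Rightarrow> nat \<Rightarrow> real" where
  "funk_multiplier n d =
     gegenbauer ((real n - 2) / 2) d 0 / gegenbauer ((real n - 2) / 2) d 1"

definition sigma_mult :: "nat \<Rightarrow> nat \<Rightarrow> real" where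
  "sigma_mult n d = ((real n - 1) * funk_multiplier n d)\<^sup>2"

definition gap :: "nat \<Rightarrow> real" where
  "gap n = 1 - (GREATEST s. s \<in> sigma_mult n ` {4..})"

end

theory Submission
  imports Defs
begin

text \<open>
  Write \<open>R\<close> for the average over great subspheres and \<open>n\<close> for the dimension.  To first order
  \<open>(1 + \<psi>) ^ (n - 1)\<close> is \<open>1 + (n - 1) \<psi>\<close>, uniformly in the sup norm, and \<open>R\<close> is linear and contracts
  the sup norm; hence the shape map has derivative \<open>(n - 1) R\<close> at the ball, and since it maps the
  constant \<open>1\<close> to itself, its square has derivative \<open>((n - 1) R)\<^sup>2\<close> there.

  Everything said about \<open>R\<close> rests on its equivariance: an orthogonal map that moves the pole \<open>u\<close> to
  \<open>u'\<close> carries the average over one great subsphere to the average over the other.  Since \<open>u'\<close> close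
  to \<open>u\<close> can be reached by an orthogonal map close to the identity, \<open>R f\<close> is continuous for
  continuous \<open>f\<close> (\<open>continuous_on_funk\<close>).  The integral of \<open>R 1\<^sub>A\<close> over all poles is a rotation
  invariant measure of \<open>A\<close>; like the surface measure it gives the same mass to all balls of equal
  radius, and two finite measures with this property are proportional
  (\<open>uniformly_distributed_proportional\<close>).  So averaging over great subspheres preserves integrals
  up to a constant (\<open>nn_integral_funk\<close>), null sets included, and with \<open>(R f)\<^sup>2 \<le> R (f\<^sup>2)\<close> it follows that
  \<open>R\<close> acts on square-integrable functions as a contraction (\<open>bounded_linear_funk_L2\<close>).  Continuous
  functions are dense in \<open>L\<^sup>2\<close>, so this is the only bounded extension
  (\<open>blinfun_eqI_on_continuous\<close>).

  For the eigenvalues, let \<open>p\<close> be a harmonic polynomial, homogeneous of degree \<open>k\<close>, and let \<open>b\<close>, \<open>c\<close> be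
  orthonormal vectors orthogonal to the pole \<open>u\<close>.  Rotations of the plane of \<open>b\<close> and \<open>c\<close> fix \<open>u\<close>,
  so \<open>x\<^sub>b \<partial>\<^sub>c q - x\<^sub>c \<partial>\<^sub>b q\<close> has average \<open>0\<close> over the great subsphere for every polynomial \<open>q\<close>.
  Taking \<open>q = x\<^sub>b \<partial>\<^sub>c p\<close> and summing over an orthonormal basis of the hyperplane expresses the
  average of the Laplacian of \<open>p\<close> in that hyperplane, which is \<open>- \<partial>\<^sub>u\<^sup>2 p\<close> because \<open>p\<close> is
  harmonic, as \<open>k (k + n - 3)\<close> times the average of \<open>p\<close>
  (\<open>funk_second_derivative_along_pole\<close>).  Now \<open>\<partial>\<^sub>u\<^sup>2 p\<close> is harmonic of degree \<open>k - 2\<close> with value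
  \<open>k (k - 1) p(u)\<close> at \<open>u\<close>, so the multipliers satisfy \<open>\<mu>\<^sub>k = - (k - 1) / (k + n - 3) \<mu>\<^sub>k\<^sub>-\<^sub>2\<close>.
  The Gegenbauer recurrence gives the same relation for the normalised values at \<open>0\<close>
  (\<open>funk_multiplier_Suc_Suc\<close>), and all numerical claims are read off from it: the quotient has
  absolute value below \<open>1\<close> for \<open>n \<ge> 3\<close>, which makes the squares decrease.
\<close>


section \<open>Funk multipliers\<close>

text \<open>
  At \<open>1\<close> the three-term recurrence collapses to two terms: \<open>C\<^sub>d(1)\<close> is the binomial coefficient
  \<open>d + 2l - 1\<close> over \<open>d\<close>.
\<close>

lemma gegenbauer_at_1_Suc:
  "(real d + 1) * gegenbauer l (Suc d) 1 = (real d + 2 * l) * gegenbauer l d 1"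
proof (induction d)
  case 0
  then show ?case by simp
next
  case (Suc d)
  have "(real d + 2) * gegenbauer l (Suc (Suc d)) 1 =
      2 * (real d + 1 + l) * gegenbauer l (Suc d) 1 - (real d + 2 * l) * gegenbauer l d 1"
    by simp
  also have "\<dots> = 2 * (real d + 1 + l) * gegenbauer l (Suc d) 1 - (real d + 1) * gegenbauer l (Suc d) 1"
    using Suc.IH by simp
  finally show ?case by (simp add: algebra_simps del: gegenbauer.simps(3))
qed

lemma gegenbauer_at_1_pos:
  assumes "0 < l"
  shows "0 < gegenbauer l d 1"
proof (induction d)
  case (Suc d)
  have "0 < (real d + 1) * gegenbauer l (Suc d) 1"
    unfolding gegenbauer_at_1_Suc using assms Suc.IH by (simp add: add_nonneg_pos)
  then show ?case by (simp add: zero_less_mult_iff)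
qed simp

lemma funk_multiplier_0 [simp]: "funk_multiplier n 0 = 1"
  and funk_multiplier_1 [simp]: "funk_multiplier n (Suc 0) = 0"
  by (simp_all add: funk_multiplier_def)

text \<open>
  At \<open>0\<close> the recurrence links values two degrees apart, at \<open>1\<close> it has only two terms, so the
  quotient changes by a single rational factor.
\<close>

lemma funk_multiplier_Suc_Suc:
  assumes "n \<ge> 3"
  shows "funk_multiplier n (Suc (Suc d)) = - ((real d + 1) / (real d + real n - 1)) * funk_multiplier n d"
proof -
  define l where "l = (real n - 2) / 2"
  have l: "0 < l" and n: "real n = 2 * l + 2"
    using assms by (simp_all add: l_def field_simps)
  define A B where "A = gegenbauer l d 0" and "B = gegenbauer l d 1"
  have B: "0 < B" using gegenbauer_at_1_pos[OF l] by (simp add: B_def)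
  have one: "gegenbauer l (Suc d) 1 = (real d + 2 * l) * B / (real d + 1)"
    using gegenbauer_at_1_Suc[of d l] by (simp add: B_def field_simps)
  have "(real d + 2) * gegenbauer l (Suc (Suc d)) 1 = (real d + 1 + 2 * l) * gegenbauer l (Suc d) 1"
    using gegenbauer_at_1_Suc[of "Suc d" l] by (simp del: gegenbauer.simps add: algebra_simps)
  then have two: "gegenbauer l (Suc (Suc d)) 1 = (real d + 1 + 2 * l) * ((real d + 2 * l) * B / (real d + 1)) / (real d + 2)"
    unfolding one by (intro nonzero_eq_divide_eq[THEN iffD2]) (simp_all del: gegenbauer.simps add: mult.commute)
  have zero: "gegenbauer l (Suc (Suc d)) 0 = - ((real d + 2 * l) * A / (real d + 2))"
    by (simp add: A_def)
  have pos: "real d + 2 * l > 0" "real d + 1 + 2 * l > 0" "real d + 1 > 0" "real d + 2 > 0"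
    using l by auto
  have "(- ((a * A) / c)) / ((b * ((a * B) / e)) / c) = - (e / b) * (A / B)"
    if "a > 0" "b > 0" "c > 0" "e > 0" for a b c e :: real
    using that B by (simp add: field_simps)
  from this[OF pos(1,2,4,3)] show ?thesis
    unfolding funk_multiplier_def l_def[symmetric] two zero A_def[symmetric] B_def[symmetric]
    by (simp add: n add_ac)
qed

lemma funk_multiplier_odd: "n \<ge> 3 \<Longrightarrow> odd d \<Longrightarrow> funk_multiplier n d = 0"
proof (induction d rule: induct_nat_012)
  case (ge2 d)
  then show ?case by (simp add: funk_multiplier_Suc_Suc)
qed simp_all

lemma funk_multiplier_even_nonzero: "n \<ge> 3 \<Longrightarrow> even d \<Longrightarrow> funk_multiplier n d \<noteq> 0"
proof (induction d rule: induct_nat_012)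
  case (ge2 d)
  then have "real d + real n - 1 > 0" "real d + 1 > 0" by auto
  with ge2 show ?case by (simp add: funk_multiplier_Suc_Suc)
qed simp_all

lemma funk_multiplier_even_Gamma:
  assumes "n \<ge> 3"
  shows "funk_multiplier n (2 * m) =
    (-1) ^ m * ((fact (2 * m) * Gamma ((real n - 2) / 2 + real m) * Gamma (real n - 2)) /
      (fact m * Gamma ((real n - 2) / 2) * Gamma (real n - 2 + 2 * real m)))"
proof (induction m)
  case 0
  have "Gamma ((real n - 2) / 2) > 0" "Gamma (real n - 2) > 0"
    using assms by (auto intro!: Gamma_real_pos)
  then show ?case by simp
next
  case (Suc m)
  define l where "l = (real n - 2) / 2"
  have l: "0 < l" and n: "real n = 2 * l + 2"
    using assms by (simp_all add: l_def field_simps)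
  have G: "Gamma (x + 1) = x * Gamma x" if "x > 0" for x :: real
    using Gamma_plus1[of x] that nonpos_Ints_nonpos[of x] by linarith
  have 1: "Gamma (l + real (Suc m)) = (l + real m) * Gamma (l + real m)"
    using G[of "l + real m"] l by (simp add: add_ac)
  have "Gamma (2 * l + 2 * real (Suc m)) = Gamma ((2 * l + 2 * real m + 1) + 1)"
    by (simp add: algebra_simps)
  also have "\<dots> = (2 * l + 2 * real m + 1) * ((2 * l + 2 * real m) * Gamma (2 * l + 2 * real m))"
    using G[of "2 * l + 2 * real m"] G[of "2 * l + 2 * real m + 1"] l by simp
  finally have 2: "Gamma (2 * l + 2 * real (Suc m)) =
      (2 * l + 2 * real m + 1) * ((2 * (l + real m)) * Gamma (2 * l + 2 * real m))"
    by (simp add: algebra_simps)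
  have 3: "fact (2 * Suc m) = 2 * (real m + 1) * (2 * real m + 1) * fact (2 * m)"
    by (simp add: algebra_simps)
  have 4: "fact (Suc m) = (real m + 1) * fact m" by (simp add: algebra_simps)
  have e: "2 * Suc m = Suc (Suc (2 * m))" by simp
  have pos: "Gamma (2 * l + 2 * real m) > 0" "Gamma l > 0" "l + real m > 0" "2 * l + 2 * real m + 1 > 0"
    "(fact m :: real) > 0" "real m + 1 > 0"
    using l by (auto intro!: Gamma_real_pos)
  have "- ((2 * real m + 1) / q) * (s * ((F * A * D) / (f * g * H))) =
      (- 1 * s) * ((2 * t * (2 * real m + 1) * F * (p * A) * D) / (t * f * g * (q * ((2 * p) * H))))"
    if "q > 0" "t > 0" "p > 0" "H > 0" "f > 0" "g > 0" for q t p s H f g F A D :: real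
    using that by (simp add: divide_simps)
  from this[OF pos(4,6,3,1,5,2)]
  have main: "- ((2 * real m + 1) / (2 * l + 2 * real m + 1)) * (((- 1) ^ m) *
        ((fact (2 * m) * Gamma (l + real m) * Gamma (2 * l)) / (fact m * Gamma l * Gamma (2 * l + 2 * real m)))) =
      (- 1 * (- 1) ^ m) * ((2 * (real m + 1) * (2 * real m + 1) * fact (2 * m) * ((l + real m) * Gamma (l + real m)) * Gamma (2 * l))
        / ((real m + 1) * fact m * Gamma l * ((2 * l + 2 * real m + 1) * ((2 * (l + real m)) * Gamma (2 * l + 2 * real m)))))" .
  have n2: "real n - 2 = 2 * l" using n by simp
  have l2: "2 * l / 2 = l" by simp
  have q: "2 * real m + real n - 1 = 2 * l + 2 * real m + 1" "real (2 * m) = 2 * real m" using n by simp_all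
  have "funk_multiplier n (2 * Suc m) =
     - ((2 * real m + 1) / (2 * l + 2 * real m + 1)) * (((- 1) ^ m) *
        ((fact (2 * m) * Gamma (l + real m) * Gamma (2 * l)) / (fact m * Gamma l * Gamma (2 * l + 2 * real m))))"
    unfolding e funk_multiplier_Suc_Suc[OF assms] q(2) q(1) Suc.IH n2 l2 ..
  also note main
  finally show ?case
    unfolding n2 l2 1 2 3 4 by simp
qed

lemma sigma_mult_Suc_Suc:
  assumes "n \<ge> 3"
  shows "sigma_mult n (Suc (Suc d)) = ((real d + 1) / (real d + real n - 1))\<^sup>2 * sigma_mult n d"
  unfolding sigma_mult_def funk_multiplier_Suc_Suc[OF assms]
  by (simp add: power_mult_distrib power_divide)

lemma sigma_mult_decreasing_step:
  assumes "n \<ge> 3" "even d"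
  shows "sigma_mult n (Suc (Suc d)) < sigma_mult n d"
proof -
  have "sigma_mult n d > 0"
    using assms funk_multiplier_even_nonzero by (simp add: sigma_mult_def)
  moreover have "((real d + 1) / (real d + real n - 1))\<^sup>2 < 1"
    unfolding abs_square_less_1 using assms by (simp add: divide_less_eq)
  ultimately show ?thesis
    unfolding sigma_mult_Suc_Suc[OF assms(1)] by simp
qed

lemma sigma_mult_strict_antimono:
  assumes "n \<ge> 3"
  shows "strict_antimono_on {d. even d} (sigma_mult n)"
proof (rule monotone_onI)
  fix a b :: nat
  assume "a \<in> {d. even d}" "b \<in> {d. even d}" "a < b"
  then obtain i j where ij: "a = 2 * i" "b = 2 * j" "i < j" by (auto elim!: evenE)
  have "sigma_mult n (2 * j) < sigma_mult n (2 * i)"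
    using \<open>i < j\<close>
  proof (induction rule: less_Suc_induct)
    case (1 i)
    then show ?case using sigma_mult_decreasing_step[OF assms, of "2 * i"] by simp
  qed auto
  then show "sigma_mult n a > sigma_mult n b" using ij by simp
qed

lemma funk_multiplier_2:
  assumes "n \<ge> 3"
  shows "(real n - 1) * funk_multiplier n 2 = -1"
  using funk_multiplier_Suc_Suc[OF assms, of 0] assms
  by (simp add: numeral_2_eq_2 field_simps)

lemma funk_multiplier_4:
  assumes "n \<ge> 3"
  shows "(real n - 1) * funk_multiplier n 4 = 3 / (real n + 1)"
proof -
  have "funk_multiplier n 4 = - (3 / (real n + 1)) * funk_multiplier n 2"
    using funk_multiplier_Suc_Suc[OF assms, of 2] by (simp add: eval_nat_numeral add_ac)
  then have "(real n - 1) * funk_multiplier n 4 = - (3 / (real n + 1)) * ((real n - 1) * funk_multiplier n 2)"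
    by simp
  then show ?thesis unfolding funk_multiplier_2[OF assms] by simp
qed

lemma sigma_mult_4:
  "n \<ge> 3 \<Longrightarrow> sigma_mult n 4 = 9 / (real n + 1)\<^sup>2"
  by (simp add: sigma_mult_def funk_multiplier_4 power_divide)

lemma sigma_mult_le_4:
  assumes "n \<ge> 3" "d \<ge> 4"
  shows "sigma_mult n d \<le> sigma_mult n 4"
proof (cases "even d")
  case True
  then show ?thesis
    using monotone_onD[OF sigma_mult_strict_antimono[OF assms(1)], of 4 d] assms
    by (cases "d = 4") auto
next
  case False
  then show ?thesis
    using assms by (simp add: sigma_mult_def funk_multiplier_odd)
qed

lemma sigma_mult_4_less_1:
  assumes "n \<ge> 3"
  shows "sigma_mult n 4 < 1"
proof -
  have "3\<^sup>2 < (real n + 1)\<^sup>2" using assms by (intro power_strict_mono) auto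
  then show ?thesis using assms by (simp add: sigma_mult_4)
qed

lemma gap_eq:
  assumes "n \<ge> 3"
  shows "gap n = 1 - 9 / (real n + 1)\<^sup>2"
proof -
  have "(GREATEST s. s \<in> sigma_mult n ` {4..}) = sigma_mult n 4"
    by (rule Greatest_equality) (use sigma_mult_le_4[OF assms] in auto)
  then show ?thesis using sigma_mult_4[OF assms] by (simp add: gap_def)
qed

lemma gap_eq_product:
  assumes "n \<ge> 3"
  shows "gap n = (real n - 2) * (real n + 4) / (real n + 1)\<^sup>2"
proof -
  have "(real n + 1)\<^sup>2 \<noteq> 0" by (simp add: add_eq_0_iff)
  then have "gap n = ((real n + 1)\<^sup>2 - 9) / (real n + 1)\<^sup>2"
    by (simp add: gap_eq[OF assms] diff_divide_distrib)
  also have "(real n + 1)\<^sup>2 - 9 = (real n - 2) * (real n + 4)"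
    by (simp add: power2_eq_square algebra_simps)
  finally show ?thesis .
qed


section \<open>Orthogonal invariance of Lebesgue measure\<close>

lemma emeasure_lborel_open_nonzero:
  fixes S :: "'a :: euclidean_space set"
  assumes "open S" "x \<in> S"
  shows "emeasure lborel S \<noteq> 0"
proof -
  obtain e where e: "e > 0" "ball x e \<subseteq> S" using assms by (rule openE)
  have "emeasure lborel (ball x e) \<noteq> 0"
    using content_ball_pos[OF e(1), of x] by (auto simp: measure_def)
  moreover have "emeasure lborel (ball x e) \<le> emeasure lborel S"
    using e assms by (intro emeasure_mono) auto
  ultimately show ?thesis by auto
qed

lemma borel_measurable_orthogonal_transformation:
  fixes T :: "'a :: euclidean_space \<Rightarrow> 'a"
  assumes "orthogonal_transformation T"
  shows "T \<in> borel_measurable borel"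
  using orthogonal_transformation_linear[OF assms]
  by (intro borel_measurable_continuous_onI linear_continuous_on) (simp add: linear_conv_bounded_linear)

text \<open>
  The image \<open>N\<close> of Lebesgue measure under \<open>T\<close> is again translation invariant, because every shift is
  \<open>T\<close> of a shift.  Fubini shows that two translation invariant measures are proportional, and the
  unit ball, which \<open>T\<close> preserves, fixes the constant.
\<close>

lemma lborel_distr_orthogonal:
  fixes T :: "'a :: euclidean_space \<Rightarrow> 'a"
  assumes T: "orthogonal_transformation T"
  shows "distr lborel borel T = lborel"
proof -
  have [measurable]: "T \<in> borel_measurable borel"
    by (rule borel_measurable_orthogonal_transformation[OF T])
  define N where "N = distr lborel borel T"
  have sN [simp, measurable_cong]: "sets N = sets borel" and spN [simp]: "space N = UNIV" by (simp_all add: N_def)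
  have shift: "(\<integral>\<^sup>+x. f (x + y) \<partial>lborel) = (\<integral>\<^sup>+x. f x \<partial>(lborel :: 'a measure))"
    if [measurable]: "f \<in> borel_measurable borel" for f :: "'a \<Rightarrow> ennreal" and y
  proof -
    have "(\<integral>\<^sup>+x. f (x + y) \<partial>lborel) = (\<integral>\<^sup>+x. f x \<partial>(distr lborel borel (\<lambda>x. x + y)))"
      by (simp add: nn_integral_distr)
    also have "distr lborel borel (\<lambda>x. x + y) = lborel"
      using lborel_distr_plus[of y] by (subst add.commute)
    finally show ?thesis .
  qed
  have shift': "(\<integral>\<^sup>+x. f (y + x) \<partial>lborel) = (\<integral>\<^sup>+x. f x \<partial>(lborel :: 'a measure))"
    if "f \<in> borel_measurable borel" for f :: "'a \<Rightarrow> ennreal" and y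
    using shift[OF that, of y] by (simp add: add.commute)
  have N: "(\<integral>\<^sup>+x. f x \<partial>N) = (\<integral>\<^sup>+x. f (T x) \<partial>lborel)"
    if [measurable]: "f \<in> borel_measurable borel" for f :: "'a \<Rightarrow> ennreal"
    by (simp add: N_def nn_integral_distr)
  have shiftN: "(\<integral>\<^sup>+x. f (x + y) \<partial>N) = (\<integral>\<^sup>+x. f x \<partial>N)"
    if [measurable]: "f \<in> borel_measurable borel" for f :: "'a \<Rightarrow> ennreal" and y
  proof -
    obtain z where z: "y = T z"
      using orthogonal_transformation_surj[OF T] by (metis surj_def)
    have "(\<integral>\<^sup>+x. f (x + y) \<partial>N) = (\<integral>\<^sup>+x. f (T (x + z)) \<partial>lborel)"
      using orthogonal_transformation_linear[OF T] by (simp add: N z linear_add)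
    also have "\<dots> = (\<integral>\<^sup>+x. f x \<partial>N)"
      by (simp add: N shift[of "\<lambda>x. f (T x)"])
    finally show ?thesis .
  qed
  have ball: "emeasure N (ball 0 1) = emeasure lborel (ball 0 1 :: 'a set)"
  proof -
    have "T -` ball 0 1 = (ball 0 1 :: 'a set)"
      using orthogonal_transformation_norm[OF T] by auto
    then show ?thesis by (simp add: N_def emeasure_distr)
  qed
  interpret sigma_finite_measure N
  proof
    have cov: "(\<Union>k. ball 0 (real k)) = (UNIV :: 'a set)"
      by (auto simp: reals_Archimedean2)
    have "emeasure N (ball 0 (real k)) = emeasure lborel (ball 0 (real k) :: 'a set)" for k
    proof -
      have "T -` ball 0 (real k) = (ball 0 (real k) :: 'a set)"
        using orthogonal_transformation_norm[OF T] by auto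
      then show ?thesis by (simp add: N_def emeasure_distr)
    qed
    then show "\<exists>A. countable A \<and> A \<subseteq> sets N \<and> \<Union> A = space N \<and> (\<forall>a\<in>A. emeasure N a \<noteq> \<infinity>)"
      using cov emeasure_lborel_ball_finite[of "0 :: 'a"]
      by (intro exI[of _ "range (\<lambda>k. ball 0 (real k))"]) (auto simp: less_top)
  qed
  interpret pair_sigma_finite N "lborel :: 'a measure" ..
  \<comment> \<open>Shift \<open>y\<close> by \<open>x\<close> under \<open>lborel\<close>, then \<open>x\<close> by \<open>y\<close> under \<open>N\<close>: the two measures trade
    places between \<open>f\<close> and \<open>g\<close>, at the price of a reflection in the argument of \<open>g\<close>.\<close>
  have key: "(\<integral>\<^sup>+x. f x \<partial>N) * (\<integral>\<^sup>+y. g y \<partial>lborel) = (\<integral>\<^sup>+y. f y \<partial>lborel) * (\<integral>\<^sup>+x. g (- x) \<partial>N)"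
    if [measurable]: "f \<in> borel_measurable borel" "g \<in> borel_measurable borel" for f g :: "'a \<Rightarrow> ennreal"
  proof -
    have "(\<integral>\<^sup>+x. f x \<partial>N) * (\<integral>\<^sup>+y. g y \<partial>lborel) = (\<integral>\<^sup>+x. (\<integral>\<^sup>+y. f x * g y \<partial>lborel) \<partial>N)"
      by (simp add: nn_integral_cmult nn_integral_multc)
    also have "\<dots> = (\<integral>\<^sup>+x. (\<integral>\<^sup>+y. f x * g (y + (- x)) \<partial>lborel) \<partial>N)"
    proof (rule nn_integral_cong)
      fix x
      show "(\<integral>\<^sup>+y. f x * g y \<partial>lborel) = (\<integral>\<^sup>+y. f x * g (y + (- x)) \<partial>lborel)"
        by (rule shift[of "\<lambda>y. f x * g y", symmetric]) measurable
    qed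
    also have "\<dots> = (\<integral>\<^sup>+y. (\<integral>\<^sup>+x. f x * g (y + (- x)) \<partial>N) \<partial>lborel)"
      by (rule Fubini'[symmetric]) measurable
    also have "\<dots> = (\<integral>\<^sup>+y. (\<integral>\<^sup>+x. f (x + y) * g (- x) \<partial>N) \<partial>lborel)"
    proof (rule nn_integral_cong)
      fix y :: 'a
      show "(\<integral>\<^sup>+x. f x * g (y + (- x)) \<partial>N) = (\<integral>\<^sup>+x. f (x + y) * g (- x) \<partial>N)"
        using shiftN[of "\<lambda>x. f x * g (y + (- x))" y] by simp
    qed
    also have "\<dots> = (\<integral>\<^sup>+x. (\<integral>\<^sup>+y. f (x + y) * g (- x) \<partial>lborel) \<partial>N)"
      by (rule Fubini') measurable
    also have "\<dots> = (\<integral>\<^sup>+x. (\<integral>\<^sup>+y. f y \<partial>lborel) * g (- x) \<partial>N)"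
      by (simp add: nn_integral_multc shift')
    also have "\<dots> = (\<integral>\<^sup>+y. f y \<partial>lborel) * (\<integral>\<^sup>+x. g (- x) \<partial>N)"
      by (simp add: nn_integral_cmult)
    finally show ?thesis .
  qed
  show ?thesis
    unfolding N_def[symmetric]
  proof (rule measure_eqI)
    fix A assume "A \<in> sets N"
    then have A [measurable]: "A \<in> sets borel" by simp
    let ?b = "emeasure lborel (ball 0 1 :: 'a set)"
    have "(\<integral>\<^sup>+x. indicator (ball 0 1) (- x) \<partial>N) = (\<integral>\<^sup>+x. indicator (ball 0 1) x \<partial>N)"
      by (intro nn_integral_cong) (simp add: indicator_def)
    then have "emeasure N A * ?b = emeasure lborel A * ?b"
      using key[of "indicator A" "indicator (ball 0 1)"] ball by (simp add: borel_measurable_indicator)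
    moreover have "?b \<noteq> 0" "?b \<noteq> top"
      using emeasure_lborel_ball_finite[of "0 :: 'a" 1]
      using emeasure_lborel_open_nonzero[of "ball (0 :: 'a) 1" 0] by auto
    ultimately show "emeasure N A = emeasure lborel A"
      by (simp add: mult.commute[of _ ?b] ennreal_mult_cancel_left)
  qed simp
qed


lemma nn_integral_lborel_orthogonal:
  fixes T :: "'a :: euclidean_space \<Rightarrow> 'a"
  assumes "orthogonal_transformation T" "f \<in> borel_measurable borel"
  shows "(\<integral>\<^sup>+x. f (T x) \<partial>lborel) = (\<integral>\<^sup>+x. f x \<partial>lborel)"
proof -
  have "(\<integral>\<^sup>+x. f (T x) \<partial>lborel) = (\<integral>\<^sup>+x. f x \<partial>(distr lborel borel T))"
    using assms borel_measurable_orthogonal_transformation[OF assms(1)]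
    by (simp add: nn_integral_distr)
  then show ?thesis using lborel_distr_orthogonal[OF assms(1)] by simp
qed


section \<open>Rotations of the sphere and of its surface measures\<close>

lemma continuous_on_point: "continuous_on S point"
  by (auto simp: continuous_on_iff dist_usphere.rep_eq)

lemma borel_measurable_point [measurable]: "point \<in> borel_measurable borel"
  by (rule borel_measurable_continuous_onI[OF continuous_on_point])

definition direction :: "'a :: euclidean_space \<Rightarrow> 'a usphere" where
  "direction x = Usphere (sgn x)"

lemma borel_measurable_direction [measurable]: "direction \<in> borel_measurable borel"
  unfolding direction_def
  by (rule borel_measurable_continuous_countable_exceptions[of "{0}"])
     (use continuous_on_sgn_sphere in auto)

lemma direction_point [simp]: "direction (point v) = v"
  by (simp add: direction_def sgn_div_norm point_inverse)

lemma point_direction: "x \<noteq> 0 \<Longrightarrow> point (direction x) = sgn x"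
  by (simp add: direction_def point_Usphere_sgn)

text \<open>
  The map induced on the sphere.  It passes through \<open>direction\<close> so as to be defined for every \<open>T\<close>;
  only orthogonal \<open>T\<close> matter, for which normalizing does nothing (\<open>point_rot\<close>).
\<close>

definition rot :: "('a :: euclidean_space \<Rightarrow> 'a) \<Rightarrow> 'a usphere \<Rightarrow> 'a usphere" where
  "rot T v = direction (T (point v))"

lemma orthogonal_transformation_sgn:
  assumes "orthogonal_transformation T"
  shows "sgn (T x) = T (sgn x)"
  using assms by (simp add: sgn_div_norm orthogonal_transformation_norm orthogonal_transformation_scaleR)

lemma point_rot:
  assumes "orthogonal_transformation T"
  shows "point (rot T v) = T (point v)"
proof -
  have "norm (T (point v)) = 1" using assms by (simp add: orthogonal_transformation_norm)
  then show ?thesis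
    unfolding rot_def by (subst point_direction) (auto simp: sgn_div_norm)
qed

lemma rot_direction:
  assumes "orthogonal_transformation T" "x \<noteq> 0"
  shows "rot T (direction x) = direction (T x)"
proof -
  have "T x \<noteq> 0" using assms by (metis orthogonal_transformation_norm norm_eq_zero)
  then show ?thesis
    using assms unfolding point_inject[symmetric]
    by (simp add: point_rot point_direction orthogonal_transformation_sgn)
qed

lemma borel_measurable_rot:
  assumes "orthogonal_transformation T"
  shows "rot T \<in> borel_measurable borel"
proof -
  have [measurable]: "T \<in> borel_measurable borel"
    by (rule borel_measurable_orthogonal_transformation[OF assms])
  show ?thesis unfolding rot_def by measurable
qed

lemma nn_integral_sphere_measure:
  fixes f :: "'a :: euclidean_space usphere \<Rightarrow> ennreal"
  assumes [measurable]: "f \<in> borel_measurable borel"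
  shows "(\<integral>\<^sup>+v. f v \<partial>sphere_measure) =
    of_nat DIM('a) * (\<integral>\<^sup>+x. f (direction x) * indicator (cball 0 1 - {0}) x \<partial>lborel)"
proof -
  have "(\<integral>\<^sup>+v. f v \<partial>sphere_measure) = of_nat DIM('a) *
      (\<integral>\<^sup>+v. f v \<partial>(distr (restrict_space lborel (cball 0 1 - {0})) borel (\<lambda>x. Usphere (sgn x))))"
    unfolding sphere_measure_def by (rule nn_integral_scale_measure) simp
  also have "\<dots> = of_nat DIM('a) * (\<integral>\<^sup>+x. f (direction x) \<partial>(restrict_space lborel (cball 0 1 - {0})))"
    by (subst nn_integral_distr) (simp_all add: direction_def)
  also have "\<dots> = of_nat DIM('a) * (\<integral>\<^sup>+x. f (direction x) * indicator (cball 0 1 - {0}) x \<partial>lborel)"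
    by (subst nn_integral_restrict_space) simp_all
  finally show ?thesis .
qed

text \<open>
  The region of height one over the punctured unit ball of the hyperplane orthogonal to \<open>u\<close>; its
  image under \<open>direction \<circ> proj_perp u\<close> carries the measure of the great subsphere.
\<close>

definition cylinder :: "'a :: euclidean_space usphere \<Rightarrow> 'a set" where
  "cylinder u = {x. 0 \<le> x \<bullet> point u \<and> x \<bullet> point u \<le> 1 \<and>
     0 < norm (proj_perp u x) \<and> norm (proj_perp u x) \<le> 1}"

lemma borel_measurable_proj_perp [measurable]: "proj_perp u \<in> borel_measurable borel"
  unfolding proj_perp_def by measurable

lemma sets_cylinder [measurable]: "cylinder u \<in> sets borel"
  unfolding cylinder_def by measurable

lemma space_subsphere_measure [simp]: "space (subsphere_measure u) = UNIV"
  and sets_subsphere_measure [measurable_cong, simp]: "sets (subsphere_measure u) = sets borel"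
  by (simp_all add: subsphere_measure_def space_scale_measure)

lemma nn_integral_subsphere_measure:
  fixes f :: "'a :: euclidean_space usphere \<Rightarrow> ennreal"
  assumes [measurable]: "f \<in> borel_measurable borel"
  shows "(\<integral>\<^sup>+v. f v \<partial>subsphere_measure u) =
    of_nat (DIM('a) - 1) * (\<integral>\<^sup>+x. f (direction (proj_perp u x)) * indicator (cylinder u) x \<partial>lborel)"
proof -
  have "(\<integral>\<^sup>+v. f v \<partial>subsphere_measure u) = of_nat (DIM('a) - 1) *
      (\<integral>\<^sup>+v. f v \<partial>(distr (restrict_space lborel (cylinder u)) borel (\<lambda>x. direction (proj_perp u x))))"
    unfolding subsphere_measure_def direction_def cylinder_def by (rule nn_integral_scale_measure) simp
  also have "\<dots> = of_nat (DIM('a) - 1) * (\<integral>\<^sup>+x. f (direction (proj_perp u x)) \<partial>(restrict_space lborel (cylinder u)))"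
    by (subst nn_integral_distr) (simp_all add: measurable_restrict_space1)
  also have "\<dots> = of_nat (DIM('a) - 1) * (\<integral>\<^sup>+x. f (direction (proj_perp u x)) * indicator (cylinder u) x \<partial>lborel)"
    by (subst nn_integral_restrict_space) simp_all
  finally show ?thesis .
qed

lemma distr_eqI_nn_integral:
  assumes "g \<in> measurable M borel" "sets N = sets borel"
    and "\<And>A. A \<in> sets borel \<Longrightarrow> (\<integral>\<^sup>+x. indicator A (g x) \<partial>M) = (\<integral>\<^sup>+x. indicator A x \<partial>N)"
  shows "distr M borel g = N"
proof (rule measure_eqI)
  fix A assume "A \<in> sets (distr M borel g)"
  then have A: "A \<in> sets borel" by simp
  then have "(\<integral>\<^sup>+x. indicator A (g x) \<partial>M) = (\<integral>\<^sup>+x. indicator A x \<partial>(distr M borel g))"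
    using assms(1) by (subst nn_integral_distr) simp_all
  then have "(\<integral>\<^sup>+x. indicator A (g x) \<partial>M) = emeasure (distr M borel g) A"
    using A by simp
  then show "emeasure (distr M borel g) A = emeasure N A"
    using assms(3)[OF A] assms(2) A by simp
qed (simp add: assms)

lemma distr_sphere_measure_rot:
  fixes T :: "'a :: euclidean_space \<Rightarrow> 'a"
  assumes T: "orthogonal_transformation T"
  shows "distr sphere_measure borel (rot T) = sphere_measure"
proof (rule distr_eqI_nn_integral)
  have [measurable]: "rot T \<in> borel_measurable borel" by (rule borel_measurable_rot[OF T])
  have [measurable]: "cball (0 :: 'a) 1 \<in> sets borel" "{0 :: 'a} \<in> sets borel" by simp_all
  show "rot T \<in> measurable sphere_measure borel" by simp
  fix A :: "'a usphere set" assume [measurable]: "A \<in> sets borel"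
  have "(\<integral>\<^sup>+x. indicator A (rot T (direction x)) * indicator (cball 0 1 - {0}) x \<partial>lborel)
      = (\<integral>\<^sup>+x. indicator A (direction (T x)) * indicator (cball 0 1 - {0}) (T x) \<partial>lborel)"
  proof (rule nn_integral_cong)
    fix x
    have "T x \<in> cball 0 1 - {0} \<longleftrightarrow> x \<in> cball 0 1 - {0}"
      using orthogonal_transformation_norm[OF T, of x] norm_eq_zero[of x] norm_eq_zero[of "T x"] by auto
    then show "(indicator A (rot T (direction x)) * indicator (cball 0 1 - {0}) x :: ennreal) =
        indicator A (direction (T x)) * indicator (cball 0 1 - {0}) (T x)"
      using rot_direction[OF T, of x] by (auto simp: indicator_def)
  qed
  also have "\<dots> = (\<integral>\<^sup>+x. indicator A (direction x) * indicator (cball 0 1 - {0}) x \<partial>lborel)"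
    by (rule nn_integral_lborel_orthogonal[OF T]) measurable
  finally show "(\<integral>\<^sup>+x. indicator A (rot T x) \<partial>sphere_measure) = (\<integral>\<^sup>+x. indicator A x \<partial>sphere_measure)"
    by (subst (1 2) nn_integral_sphere_measure) simp_all
qed simp

lemma proj_perp_rot:
  assumes T: "orthogonal_transformation T"
  shows "proj_perp (rot T u) (T x) = T (proj_perp u x)"
  using T by (simp add: proj_perp_def point_rot orthogonal_transformation_def linear_diff linear_scale)

lemma mem_cylinder_rot:
  assumes T: "orthogonal_transformation T"
  shows "T x \<in> cylinder (rot T u) \<longleftrightarrow> x \<in> cylinder u"
  using T by (simp add: cylinder_def proj_perp_rot orthogonal_transformation_norm del: zero_less_norm_iff)
    (simp add: point_rot orthogonal_transformation_def)

text \<open>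
  The equivariance on which all that follows depends: an orthogonal map carries the cylinder over
  one hyperplane to the cylinder over the other and preserves Lebesgue measure.
\<close>

lemma distr_subsphere_measure_rot:
  fixes T :: "'a :: euclidean_space \<Rightarrow> 'a"
  assumes T: "orthogonal_transformation T"
  shows "distr (subsphere_measure u) borel (rot T) = subsphere_measure (rot T u)"
proof (rule distr_eqI_nn_integral)
  have [measurable]: "rot T \<in> borel_measurable borel" by (rule borel_measurable_rot[OF T])
  show "rot T \<in> measurable (subsphere_measure u) borel" by simp
  fix A :: "'a usphere set" assume [measurable]: "A \<in> sets borel"
  have "(\<integral>\<^sup>+x. indicator A (rot T (direction (proj_perp u x))) * indicator (cylinder u) x \<partial>lborel)
      = (\<integral>\<^sup>+x. indicator A (direction (proj_perp (rot T u) (T x))) * indicator (cylinder (rot T u)) (T x) \<partial>lborel)"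
  proof (rule nn_integral_cong)
    fix x
    have "x \<in> cylinder u \<Longrightarrow> proj_perp u x \<noteq> 0" by (auto simp: cylinder_def)
    then show "(indicator A (rot T (direction (proj_perp u x))) * indicator (cylinder u) x :: ennreal) =
        indicator A (direction (proj_perp (rot T u) (T x))) * indicator (cylinder (rot T u)) (T x)"
      using rot_direction[OF T, of "proj_perp u x"]
      by (auto simp: indicator_def mem_cylinder_rot[OF T] proj_perp_rot[OF T])
  qed
  also have "\<dots> = (\<integral>\<^sup>+x. indicator A (direction (proj_perp (rot T u) x)) * indicator (cylinder (rot T u)) x \<partial>lborel)"
    by (rule nn_integral_lborel_orthogonal[OF T]) measurable
  finally show "(\<integral>\<^sup>+x. indicator A (rot T x) \<partial>subsphere_measure u) = (\<integral>\<^sup>+x. indicator A x \<partial>subsphere_measure (rot T u))"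
    by (subst (1 2) nn_integral_subsphere_measure) simp_all
qed simp

text \<open>
  Householder reflections: they are enough to move any unit vector to any other, and products of
  two of them provide small rotations.  For \<open>w = 0\<close> the formula gives the identity.
\<close>

definition reflect :: "'a :: euclidean_space \<Rightarrow> 'a \<Rightarrow> 'a" where
  "reflect w x = x - (2 * (x \<bullet> w) / (w \<bullet> w)) *\<^sub>R w"

lemma orthogonal_transformation_reflect: "orthogonal_transformation (reflect w)"
proof (cases "w = 0")
  case True
  then show ?thesis by (simp add: reflect_def[abs_def])
next
  case False
  have "linear (reflect w)"
    by (rule linearI) (simp_all add: reflect_def inner_add_left algebra_simps add_divide_distrib)
  moreover have "reflect w x \<bullet> reflect w y = x \<bullet> y" for x y
    using False by (simp add: reflect_def inner_diff_left inner_diff_right inner_commute field_simps)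
  ultimately show ?thesis by (simp add: orthogonal_transformation_def)
qed

lemma reflect_swap:
  assumes "norm a = norm b"
  shows "reflect (a - b) a = b"
proof (cases "a = b")
  case False
  have "a \<bullet> a = b \<bullet> b" using assms by (simp add: norm_eq)
  then have "2 * (a \<bullet> (a - b)) = (a - b) \<bullet> (a - b)"
    by (simp add: inner_diff_left inner_diff_right inner_commute)
  moreover have "(a - b) \<bullet> (a - b) \<noteq> 0" using False by simp
  ultimately show ?thesis by (simp add: reflect_def)
qed (simp add: reflect_def)

lemma rot_reflect_swap: "rot (reflect (point u - point v)) u = v"
  unfolding point_inject[symmetric]
  by (simp add: point_rot orthogonal_transformation_reflect reflect_swap)

text \<open>
  A reflection carries each great subsphere measure to any other, so the normalization of the
  averages does not depend on the pole.
\<close>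

lemma emeasure_subsphere_measure_UNIV_eq:
  fixes u v :: "'a :: euclidean_space usphere"
  shows "emeasure (subsphere_measure u) UNIV = emeasure (subsphere_measure v) UNIV"
proof -
  let ?R = "rot (reflect (point u - point v))"
  have m: "?R \<in> borel_measurable borel"
    by (rule borel_measurable_rot[OF orthogonal_transformation_reflect])
  have "subsphere_measure v = distr (subsphere_measure u) borel ?R"
    using distr_subsphere_measure_rot[OF orthogonal_transformation_reflect, of u "point u - point v"]
    by (simp add: rot_reflect_swap)
  then show ?thesis using m by (simp add: emeasure_distr)
qed

lemma emeasure_subsphere_measure_UNIV_eq_cylinder:
  fixes u :: "'a :: euclidean_space usphere"
  shows "emeasure (subsphere_measure u) UNIV = of_nat (DIM('a) - 1) * emeasure lborel (cylinder u)"
  using nn_integral_subsphere_measure[of "\<lambda>_. 1" u] by simp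

lemma finite_subsphere_measure:
  fixes u :: "'a :: euclidean_space usphere"
  shows "finite_measure (subsphere_measure u)"
proof
  have "cylinder u \<subseteq> cball 0 2"
  proof
    fix x assume x: "x \<in> cylinder u"
    have "norm x = norm (proj_perp u x + (x \<bullet> point u) *\<^sub>R point u)" by (simp add: proj_perp_def)
    also have "\<dots> \<le> norm (proj_perp u x) + \<bar>x \<bullet> point u\<bar>"
      by (rule order_trans[OF norm_triangle_ineq]) simp
    also have "\<dots> \<le> 2" using x by (auto simp: cylinder_def)
    finally show "x \<in> cball 0 2" by simp
  qed
  then have "emeasure lborel (cylinder u) \<le> emeasure lborel (cball 0 2 :: 'a set)"
    by (rule emeasure_mono) simp
  then have fin: "emeasure lborel (cylinder u) < \<infinity>"
    using emeasure_lborel_cball_finite[of "0 :: 'a" 2] by (rule le_less_trans)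
  show "emeasure (subsphere_measure u) (space (subsphere_measure u)) \<noteq> \<infinity>"
    using fin by (simp add: emeasure_subsphere_measure_UNIV_eq_cylinder ennreal_mult_eq_top_iff)
qed

text \<open>
  The interior of the cylinder contains the point halfway between \<open>0\<close> and \<open>u + w\<close>, for a unit vector
  \<open>w\<close> orthogonal to \<open>u\<close>, which exists in dimension at least two.
\<close>

lemma emeasure_subsphere_measure_UNIV_nonzero:
  fixes u :: "'a :: euclidean_space usphere"
  assumes "2 \<le> DIM('a)"
  shows "emeasure (subsphere_measure u) UNIV \<noteq> 0"
proof -
  let ?U = "{x. 0 < x \<bullet> point u \<and> x \<bullet> point u < 1 \<and> 0 < norm (proj_perp u x) \<and> norm (proj_perp u x) < 1}"
  have op: "open ?U"
    unfolding proj_perp_def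
    by (intro open_Collect_conj open_Collect_less continuous_intros)
  have "dim {point u} \<le> 1" using dim_le_card'[of "{point u}"] by simp
  then have "dim {point u} < DIM('a)" using assms by simp
  then obtain w where w: "w \<noteq> 0" "w \<bullet> point u = 0"
    using orthogonal_to_subspace_exists[of "{point u}"] span_base[of "point u" "{point u}"]
    by (metis orthogonal_def singletonI)
  let ?x = "(1 / 2) *\<^sub>R point u + (1 / 2) *\<^sub>R sgn w"
  have uu: "point u \<bullet> point u = 1" by (simp add: norm_eq_1[symmetric])
  have wu: "sgn w \<bullet> point u = 0" using w by (simp add: sgn_div_norm)
  have xu: "?x \<bullet> point u = 1 / 2" by (simp add: inner_add_left uu wu)
  then have "proj_perp u ?x = (1 / 2) *\<^sub>R sgn w" by (simp add: proj_perp_def)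
  then have "norm (proj_perp u ?x) = 1 / 2" using w by (simp add: norm_sgn)
  with xu have "?x \<in> ?U" by (simp del: zero_less_norm_iff)
  then have "emeasure lborel ?U \<noteq> 0" using emeasure_lborel_open_nonzero[OF op] by blast
  moreover have "emeasure lborel ?U \<le> emeasure lborel (cylinder u)"
    by (rule emeasure_mono) (auto simp: cylinder_def)
  ultimately have "emeasure lborel (cylinder u) \<noteq> 0" by auto
  then show ?thesis
    unfolding emeasure_subsphere_measure_UNIV_eq_cylinder using assms by auto
qed


section \<open>Averages of continuous functions over great subspheres\<close>

text \<open>
  Every \<open>proj_perp u x\<close> is orthogonal to \<open>u\<close>, so \<open>subsphere_measure u\<close> lives on the great subsphere
  and integrals may be taken over the whole sphere.
\<close>

lemma AE_great_subsphere: "AE v in subsphere_measure u. v \<in> great_subsphere u"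
proof -
  have uu: "point u \<bullet> point u = 1" by (simp add: norm_eq_1[symmetric])
  have m [measurable]: "Measurable.pred borel (\<lambda>v. v \<in> great_subsphere u)"
    unfolding great_subsphere_def by simp
  have z: "indicator {v. v \<notin> great_subsphere u} (direction (proj_perp u x)) * indicator (cylinder u) x = (0 :: ennreal)" for x
  proof (cases "x \<in> cylinder u")
    case True
    then have "proj_perp u x \<noteq> 0" by (auto simp: cylinder_def)
    then have "direction (proj_perp u x) \<in> great_subsphere u"
      by (simp add: great_subsphere_def point_direction sgn_div_norm) (simp add: proj_perp_def inner_diff_left uu)
    then show ?thesis by (simp add: indicator_def)
  qed simp
  have "(\<integral>\<^sup>+v. indicator {v. v \<notin> great_subsphere u} v \<partial>subsphere_measure u) = 0"
    by (subst nn_integral_subsphere_measure) (simp_all add: z)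
  then have "emeasure (subsphere_measure u) {v. v \<notin> great_subsphere u} = 0" by simp
  then show ?thesis by (auto simp: eventually_ae_filter intro!: null_setsI exI[of _ "{v. v \<notin> great_subsphere u}"])
qed

lemma sets_great_subsphere [measurable]: "great_subsphere u \<in> sets borel"
  unfolding great_subsphere_def by measurable

lemma funk_eq_integral:
  assumes [measurable]: "f \<in> borel_measurable borel"
  shows "funk f u = (\<integral>v. f v \<partial>subsphere_measure u) / measure (subsphere_measure u) UNIV"
proof -
  interpret finite_measure "subsphere_measure u" by (rule finite_subsphere_measure)
  have "(LINT v:great_subsphere u|subsphere_measure u. f v) = (\<integral>v. f v \<partial>subsphere_measure u)"
    unfolding set_lebesgue_integral_def
    using AE_great_subsphere[of u] by (intro integral_cong_AE) (auto elim!: eventually_mono)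
  moreover have "measure (subsphere_measure u) (great_subsphere u) = measure (subsphere_measure u) UNIV"
    using AE_great_subsphere[of u] by (intro finite_measure_eq_AE) auto
  ultimately show ?thesis by (simp add: funk_def)
qed

lemma measure_subsphere_measure_UNIV_pos:
  fixes u :: "'a :: euclidean_space usphere"
  assumes "2 \<le> DIM('a)"
  shows "0 < measure (subsphere_measure u) UNIV"
proof -
  interpret finite_measure "subsphere_measure u" by (rule finite_subsphere_measure)
  show ?thesis
    using emeasure_subsphere_measure_UNIV_nonzero[OF assms, of u]
    by (simp add: emeasure_eq_measure zero_less_measure_iff)
qed

lemma funk_rot:
  assumes T: "orthogonal_transformation T" and [measurable]: "f \<in> borel_measurable borel"
  shows "funk f (rot T u) = funk (\<lambda>v. f (rot T v)) u"
proof -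
  have [measurable]: "rot T \<in> borel_measurable borel" by (rule borel_measurable_rot[OF T])
  have "(\<integral>v. f v \<partial>subsphere_measure (rot T u)) = (\<integral>v. f (rot T v) \<partial>subsphere_measure u)"
    unfolding distr_subsphere_measure_rot[OF T, symmetric] by (rule integral_distr) simp_all
  moreover have "measure (subsphere_measure (rot T u)) UNIV = measure (subsphere_measure u) UNIV"
    by (simp only: measure_def emeasure_subsphere_measure_UNIV_eq[of "rot T u" u])
  ultimately show ?thesis by (simp add: funk_eq_integral)
qed

lemma compact_UNIV_usphere: "compact (UNIV :: 'a :: euclidean_space usphere set)"
proof -
  have "continuous_on (sphere 0 1) (direction :: 'a \<Rightarrow> _)"
    unfolding direction_def by (rule continuous_on_subset[OF continuous_on_sgn_sphere]) auto
  then have "compact (direction ` sphere (0 :: 'a) 1)"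
    by (rule compact_continuous_image) simp
  moreover have "direction ` sphere (0 :: 'a) 1 = UNIV"
    using point by (auto intro!: image_eqI[of _ direction "point v" for v])
  ultimately show ?thesis by simp
qed

lemma integrable_subsphere_measure_continuous:
  fixes f :: "'a :: euclidean_space usphere \<Rightarrow> real"
  assumes f: "continuous_on UNIV f"
  shows "integrable (subsphere_measure u) f"
proof -
  interpret finite_measure "subsphere_measure u" by (rule finite_subsphere_measure)
  have "bounded (range f)"
    using compact_continuous_image[OF f compact_UNIV_usphere] by (rule compact_imp_bounded)
  then obtain B where "\<And>v. \<bar>f v\<bar> \<le> B" by (auto simp: bounded_iff)
  then show ?thesis
    using borel_measurable_continuous_onI[OF f] by (intro integrable_const_bound[of _ B]) auto
qed

lemma funk_add:
  assumes f: "continuous_on UNIV f" and g: "continuous_on UNIV g"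
  shows "funk (\<lambda>v. f v + g v) u = funk f u + funk g u"
  using f g borel_measurable_continuous_onI[OF f] borel_measurable_continuous_onI[OF g]
  by (simp add: funk_eq_integral integrable_subsphere_measure_continuous add_divide_distrib)

lemma funk_cmult:
  assumes "f \<in> borel_measurable borel"
  shows "funk (\<lambda>v. c * f v) u = c * funk f u"
  using assms by (simp add: funk_eq_integral)

lemma funk_diff:
  assumes f: "continuous_on UNIV f" and g: "continuous_on UNIV g"
  shows "funk (\<lambda>v. f v - g v) u = funk f u - funk g u"
  using funk_add[OF f, of "\<lambda>v. -1 * g v" u] funk_cmult[of g "-1" u] borel_measurable_continuous_onI[OF g] g
  by (simp add: continuous_on_minus)

lemma funk_const:
  fixes u :: "'a :: euclidean_space usphere"
  assumes "2 \<le> DIM('a)"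
  shows "funk (\<lambda>_. c) u = c"
  using measure_subsphere_measure_UNIV_pos[OF assms, of u] by (simp add: funk_eq_integral)

lemma funk_cong:
  assumes "\<And>v. v \<in> great_subsphere u \<Longrightarrow> f v = g v"
  shows "funk f u = funk g u"
  unfolding funk_def by (subst set_lebesgue_integral_cong[of _ _ f g]) (auto simp: assms)

lemma abs_funk_le:
  fixes u :: "'a :: euclidean_space usphere"
  assumes n: "2 \<le> DIM('a)" and f: "continuous_on UNIV f"
    and b: "\<And>v. v \<in> great_subsphere u \<Longrightarrow> \<bar>f v\<bar> \<le> B"
  shows "\<bar>funk f u\<bar> \<le> B"
proof -
  interpret finite_measure "subsphere_measure u" by (rule finite_subsphere_measure)
  let ?m = "measure (subsphere_measure u) UNIV"
  have "\<bar>\<integral>v. f v \<partial>subsphere_measure u\<bar> \<le> (\<integral>v. \<bar>f v\<bar> \<partial>subsphere_measure u)"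
    by (rule integral_abs_bound)
  also have "\<dots> \<le> (\<integral>v. B \<partial>subsphere_measure u)"
    using AE_great_subsphere[of u] b
    by (intro integral_mono_AE integrable_abs integrable_subsphere_measure_continuous f) (auto elim!: eventually_mono)
  also have "\<dots> = B * ?m" by simp
  finally show ?thesis
    using measure_subsphere_measure_UNIV_pos[OF n, of u] borel_measurable_continuous_onI[OF f]
    by (simp add: funk_eq_integral abs_divide divide_le_eq)
qed

lemma reflect_uminus: "reflect (- w) = reflect w"
  by (simp add: reflect_def fun_eq_iff)

text \<open>
  Reflect in \<open>u\<close>, then in \<open>w = u + u'\<close>: the first reflection maps \<open>u\<close> to \<open>-u\<close> and fixes its orthogonal
  complement, the second maps \<open>-u\<close> to \<open>u'\<close>.  On the complement only the second acts, by a
  multiple of \<open>v \<bullet> w = v \<bullet> (u' - u)\<close>, and \<open>w\<close> has norm at least one.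
\<close>

lemma rot_near_identity:
  fixes u u' :: "'a :: euclidean_space usphere"
  assumes "dist u u' \<le> 1"
  obtains T where "orthogonal_transformation T" "rot T u = u'"
    "\<And>v. v \<in> great_subsphere u \<Longrightarrow> dist (rot T v) v \<le> 2 * dist u u'"
proof
  let ?w = "point u + point u'"
  let ?T = "reflect ?w \<circ> reflect (point u)"
  have uu: "point u \<bullet> point u = 1" "point u' \<bullet> point u' = 1" by (simp_all add: norm_eq_1[symmetric])
  have d: "norm (point u - point u') \<le> 1" using assms by (simp add: dist_usphere.rep_eq dist_norm)
  have "2 = norm (2 *\<^sub>R point u)" by simp
  also have "\<dots> = norm (?w + (point u - point u'))" by (simp add: scaleR_2)
  also have "\<dots> \<le> norm ?w + norm (point u - point u')" by (rule norm_triangle_ineq)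
  finally have w: "1 \<le> norm ?w" using d by simp
  show T: "orthogonal_transformation ?T"
    by (intro orthogonal_transformation_compose orthogonal_transformation_reflect)
  have "reflect (point u) (point u) = - point u" by (simp add: reflect_def uu algebra_simps scaleR_2)
  moreover have "reflect ?w (- point u) = point u'"
    using reflect_swap[of "- point u" "point u'"] reflect_uminus[of ?w] by simp
  ultimately show "rot ?T u = u'"
    unfolding point_inject[symmetric] by (simp add: point_rot[OF T])
  fix v assume v: "v \<in> great_subsphere u"
  then have "reflect (point u) (point v) = point v" by (simp add: reflect_def great_subsphere_def)
  then have "point (rot ?T v) - point v = - ((2 * (point v \<bullet> ?w) / (?w \<bullet> ?w)) *\<^sub>R ?w)"
    by (simp add: point_rot[OF T]) (simp add: reflect_def)
  then have "dist (rot ?T v) v = \<bar>2 * (point v \<bullet> ?w) / (?w \<bullet> ?w)\<bar> * norm ?w"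
    by (simp add: dist_usphere.rep_eq dist_norm)
  also have "\<dots> = 2 * \<bar>point v \<bullet> ?w\<bar> / norm ?w"
    using w by (simp add: abs_divide abs_mult dot_square_norm power2_eq_square)
  also have "\<dots> \<le> 2 * \<bar>point v \<bullet> ?w\<bar> / 1"
    using w by (intro divide_left_mono) auto
  also have "point v \<bullet> ?w = point v \<bullet> (point u' - point u)"
    using v by (simp add: great_subsphere_def inner_add_right inner_diff_right)
  also have "2 * \<bar>point v \<bullet> (point u' - point u)\<bar> / 1 \<le> 2 * dist u u'"
    using Cauchy_Schwarz_ineq2[of "point v" "point u' - point u"]
    by (simp add: dist_usphere.rep_eq dist_norm norm_minus_commute)
  finally show "dist (rot ?T v) v \<le> 2 * dist u u'" .
qed

lemma continuous_on_rot:
  assumes T: "orthogonal_transformation T"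
  shows "continuous_on S (rot T)"
  by (auto simp: continuous_on_iff dist_usphere.rep_eq point_rot[OF T] dist_norm
      linear_diff[OF orthogonal_transformation_linear[OF T], symmetric] orthogonal_transformation_norm[OF T])

text \<open>
  Rotating \<open>u\<close> to a nearby \<open>u'\<close> displaces the points of the great subsphere only a little, and \<open>f\<close> is
  uniformly continuous by compactness.
\<close>

lemma continuous_on_funk:
  fixes f :: "'a :: euclidean_space usphere \<Rightarrow> real"
  assumes n: "2 \<le> DIM('a)" and f: "continuous_on UNIV f"
  shows "continuous_on UNIV (funk f)"
  unfolding continuous_on_iff
proof (intro ballI allI impI)
  fix u :: "'a usphere" and e :: real assume "e > 0"
  have "uniformly_continuous_on UNIV f"
    using f compact_UNIV_usphere by (rule compact_uniformly_continuous)
  then obtain d where d: "d > 0" "\<And>v v'. dist v' v < d \<Longrightarrow> dist (f v') (f v) < e / 2"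
    using \<open>e > 0\<close> unfolding uniformly_continuous_on_def by (meson UNIV_I half_gt_zero)
  show "\<exists>d>0. \<forall>u'\<in>UNIV. dist u' u < d \<longrightarrow> dist (funk f u') (funk f u) < e"
  proof (intro exI[of _ "min 1 (d / 2)"] conjI ballI impI)
    fix u' assume u': "dist u' u < min 1 (d / 2)"
    then obtain T where T: "orthogonal_transformation T" "rot T u = u'"
      "\<And>v. v \<in> great_subsphere u \<Longrightarrow> dist (rot T v) v \<le> 2 * dist u u'"
      using rot_near_identity[of u u'] by (auto simp: dist_commute)
    have fT: "continuous_on UNIV (\<lambda>v. f (rot T v))"
      by (rule continuous_on_compose2[OF f continuous_on_rot[OF T(1)]]) simp
    have "funk f u' - funk f u = funk (\<lambda>v. f (rot T v)) u - funk f u"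
      using funk_rot[OF T(1) borel_measurable_continuous_onI[OF f], of u] T(2) by simp
    also have "\<dots> = funk (\<lambda>v. f (rot T v) - f v) u"
      using funk_diff[OF fT f] by simp
    finally have "dist (funk f u') (funk f u) = \<bar>funk (\<lambda>v. f (rot T v) - f v) u\<bar>"
      by (simp add: dist_real_def)
    also have "\<dots> \<le> e / 2"
    proof (rule abs_funk_le[OF n continuous_on_diff[OF fT f]])
      fix v assume "v \<in> great_subsphere u"
      then have "dist (rot T v) v < d" using T(3)[of v] u' by (simp add: dist_commute)
      from d(2)[OF this] show "\<bar>f (rot T v) - f v\<bar> \<le> e / 2" by (simp add: dist_real_def)
    qed
    finally show "dist (funk f u') (funk f u) < e" using \<open>e > 0\<close> by simp
  qed (use d in auto)
qed

definition funk_continuous :: "('a :: euclidean_space usphere \<Rightarrow>\<^sub>C real) \<Rightarrow> ('a usphere \<Rightarrow>\<^sub>C real)" where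
  "funk_continuous \<psi> = Bcontfun (funk (apply_bcontfun \<psi>))"

lemma Bcontfun_inverse_compact:
  fixes f :: "'a :: euclidean_space usphere \<Rightarrow> real"
  assumes "continuous_on UNIV f"
  shows "apply_bcontfun (Bcontfun f) = f"
  using assms compact_imp_bounded[OF compact_continuous_image[OF assms compact_UNIV_usphere]]
  by (intro Bcontfun_inverse) (simp add: bcontfun_def)

lemma apply_funk_continuous:
  fixes \<psi> :: "'a :: euclidean_space usphere \<Rightarrow>\<^sub>C real"
  assumes "2 \<le> DIM('a)"
  shows "apply_bcontfun (funk_continuous \<psi>) = funk (apply_bcontfun \<psi>)"
  unfolding funk_continuous_def using assms
  by (intro Bcontfun_inverse_compact continuous_on_funk) auto

lemma bounded_linear_funk_continuous:
  assumes n: "2 \<le> DIM('a :: euclidean_space)"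
  shows "bounded_linear (funk_continuous :: ('a usphere \<Rightarrow>\<^sub>C real) \<Rightarrow> _)"
proof (rule bounded_linear_intro[where K = 1])
  fix f g :: "'a usphere \<Rightarrow>\<^sub>C real" and c :: real
  have m: "apply_bcontfun f \<in> borel_measurable borel" by (rule borel_measurable_continuous_onI) simp
  show "funk_continuous (f + g) = funk_continuous f + funk_continuous g"
    by (rule bcontfun_eqI) (simp add: apply_funk_continuous[OF n] funk_add)
  show "funk_continuous (c *\<^sub>R f) = c *\<^sub>R funk_continuous f"
    by (rule bcontfun_eqI) (simp add: apply_funk_continuous[OF n] funk_cmult m)
  show "norm (funk_continuous f) \<le> norm f * 1"
    using norm_bounded[of f]
    by (intro norm_bound) (simp add: apply_funk_continuous[OF n] abs_funk_le[OF n])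
qed


section \<open>The derivative of the shape map\<close>

lemma power_one_plus_remainder:
  "\<exists>C\<ge>0. \<forall>x::real. \<bar>x\<bar> \<le> 1 \<longrightarrow> \<bar>(1 + x) ^ k - 1 - real k * x\<bar> \<le> C * x\<^sup>2"
proof (induction k)
  case (Suc k)
  then obtain C where C: "C \<ge> 0" "\<And>x::real. \<bar>x\<bar> \<le> 1 \<Longrightarrow> \<bar>(1 + x) ^ k - 1 - real k * x\<bar> \<le> C * x\<^sup>2" by blast
  have "\<bar>(1 + x) ^ Suc k - 1 - real (Suc k) * x\<bar> \<le> (2 * C + real k) * x\<^sup>2" if x: "\<bar>x\<bar> \<le> 1" for x :: real
  proof -
    have "(1 + x) ^ Suc k - 1 - real (Suc k) * x = (1 + x) * ((1 + x) ^ k - 1 - real k * x) + real k * x\<^sup>2"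
      by (simp add: algebra_simps power2_eq_square)
    also have "\<bar>\<dots>\<bar> \<le> \<bar>1 + x\<bar> * \<bar>(1 + x) ^ k - 1 - real k * x\<bar> + real k * x\<^sup>2"
      by (rule order_trans[OF abs_triangle_ineq]) (simp add: abs_mult)
    also have "\<dots> \<le> 2 * (C * x\<^sup>2) + real k * x\<^sup>2"
      using C(2)[OF x] x by (intro add_right_mono mult_mono) auto
    finally show ?thesis by (simp add: algebra_simps)
  qed
  then show ?case using C(1) by (intro exI[of _ "2 * C + real k"]) auto
qed (auto intro: exI[of _ 0])

definition power_bcontfun :: "nat \<Rightarrow> ('a :: euclidean_space usphere \<Rightarrow>\<^sub>C real) \<Rightarrow> ('a usphere \<Rightarrow>\<^sub>C real)" where
  "power_bcontfun k \<rho> = Bcontfun (\<lambda>v. apply_bcontfun \<rho> v ^ k)"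

lemma apply_power_bcontfun [simp]:
  "apply_bcontfun (power_bcontfun k \<rho>) = (\<lambda>v. apply_bcontfun \<rho> v ^ k)"
  unfolding power_bcontfun_def
  by (subst Bcontfun_inverse_compact) (auto intro!: continuous_intros)

text \<open>
  The remainder of the pointwise power is quadratic with one constant for all points, so it is
  quadratic in the sup norm.
\<close>

lemma has_derivative_power_bcontfun:
  "(power_bcontfun k has_derivative (\<lambda>\<psi>. real k *\<^sub>R \<psi>)) (at (const_bcontfun 1))"
proof -
  obtain C where C: "C \<ge> 0" "\<And>x::real. \<bar>x\<bar> \<le> 1 \<Longrightarrow> \<bar>(1 + x) ^ k - 1 - real k * x\<bar> \<le> C * x\<^sup>2"
    using power_one_plus_remainder[of k] by blast
  let ?one = "const_bcontfun 1 :: 'a usphere \<Rightarrow>\<^sub>C real"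
  show ?thesis
  proof (rule has_derivativeI_sandwich[where e = 1 and H = "\<lambda>\<rho>. C * norm (\<rho> - ?one)"])
    show "bounded_linear (\<lambda>\<psi>. real k *\<^sub>R \<psi> :: 'a usphere \<Rightarrow>\<^sub>C real)" by (rule bounded_linear_scaleR_right)
    show "((\<lambda>\<rho>. C * norm (\<rho> - ?one)) \<longlongrightarrow> 0) (at ?one)"
      by (intro tendsto_eq_intros | simp)+
    fix \<rho> assume \<rho>: "\<rho> \<noteq> ?one" "dist \<rho> ?one < 1"
    let ?N = "norm (\<rho> - ?one)"
    have "norm (power_bcontfun k \<rho> - power_bcontfun k ?one - real k *\<^sub>R (\<rho> - ?one)) \<le> C * ?N\<^sup>2"
    proof (rule norm_bound)
      fix v
      define x where "x = apply_bcontfun \<rho> v - 1"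
      have x: "\<bar>x\<bar> \<le> ?N" using norm_bounded[of "\<rho> - ?one" v] by (simp add: x_def)
      have r: "apply_bcontfun \<rho> v = 1 + x" by (simp add: x_def)
      have "\<bar>(1 + x) ^ k - 1 - real k * x\<bar> \<le> C * x\<^sup>2"
        using x \<rho> by (intro C(2)) (simp add: dist_norm)
      also have "\<dots> \<le> C * ?N\<^sup>2"
        using x C(1) power_mono[OF x, of 2] by (intro mult_left_mono) auto
      finally show "norm (apply_bcontfun (power_bcontfun k \<rho> - power_bcontfun k ?one - real k *\<^sub>R (\<rho> - ?one)) v) \<le> C * ?N\<^sup>2"
        by (simp add: r)
    qed
    then show "norm (power_bcontfun k \<rho> - power_bcontfun k ?one - real k *\<^sub>R (\<rho> - ?one)) / ?N \<le> C * ?N"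
      using \<rho> by (simp add: divide_le_eq power2_eq_square mult.assoc)
  qed simp_all
qed

lemma shape_map_eq: "shape_map \<rho> = funk_continuous (power_bcontfun (DIM('a) - 1) \<rho>)"
  for \<rho> :: "'a :: euclidean_space usphere \<Rightarrow>\<^sub>C real"
  by (simp add: shape_map_def funk_continuous_def)

lemma shape_map_const_1:
  assumes n: "2 \<le> DIM('a :: euclidean_space)"
  shows "shape_map (const_bcontfun 1) = (const_bcontfun 1 :: 'a usphere \<Rightarrow>\<^sub>C real)"
  by (rule bcontfun_eqI) (simp add: shape_map_eq apply_funk_continuous[OF n] funk_const[OF n])

lemma has_derivative_shape_map:
  assumes n: "2 \<le> DIM('a :: euclidean_space)"
  shows "((shape_map :: ('a usphere \<Rightarrow>\<^sub>C real) \<Rightarrow> _) has_derivative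
    (\<lambda>\<psi>. (real DIM('a) - 1) *\<^sub>R funk_continuous \<psi>)) (at (const_bcontfun 1))"
proof -
  interpret F: bounded_linear "funk_continuous :: ('a usphere \<Rightarrow>\<^sub>C real) \<Rightarrow> _"
    by (rule bounded_linear_funk_continuous[OF n])
  have "((\<lambda>\<rho>. funk_continuous (power_bcontfun (DIM('a) - 1) \<rho>)) has_derivative
      (\<lambda>\<psi> :: 'a usphere \<Rightarrow>\<^sub>C real. funk_continuous (real (DIM('a) - 1) *\<^sub>R \<psi>))) (at (const_bcontfun 1))"
    by (rule F.has_derivative[OF has_derivative_power_bcontfun])
  moreover have "real (DIM('a) - 1) = real DIM('a) - 1" using n by simp
  ultimately show ?thesis
    by (simp add: shape_map_eq[abs_def] F.scaleR)
qed

lemma has_derivative_shape_map_twice: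
  assumes n: "2 \<le> DIM('a :: euclidean_space)"
  shows "((shape_map \<circ> shape_map :: ('a usphere \<Rightarrow>\<^sub>C real) \<Rightarrow> _) has_derivative
    (\<lambda>\<psi>. (real DIM('a) - 1) *\<^sub>R funk_continuous ((real DIM('a) - 1) *\<^sub>R funk_continuous \<psi>)))
    (at (const_bcontfun 1))"
  using diff_chain_at[OF has_derivative_shape_map[OF n], of shape_map] has_derivative_shape_map[OF n]
  by (simp add: shape_map_const_1[OF n] o_def)


section \<open>Uniformly distributed measures\<close>

text \<open>
  The Borel sets of the product of the sphere with itself must contain the sets defined by distances,
  which needs a countable base.
\<close>

instance usphere :: (euclidean_space) second_countable_topology
proof
  obtain B :: "'a set set" where B: "countable B" "topological_basis B"
    using ex_countable_basis by blast
  let ?C = "(\<lambda>W. point -` W) ` B"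
  have "topological_basis ?C"
  proof (rule topological_basisI)
    fix W assume "W \<in> ?C"
    then show "open W"
      using topological_basis_open[OF B(2)] continuous_on_point[of UNIV]
      by (auto intro!: open_vimage)
  next
    fix U and v :: "'a usphere" assume "open U" "v \<in> U"
    then obtain e where e: "e > 0" "ball v e \<subseteq> U" by (rule openE)
    obtain W where W: "W \<in> B" "point v \<in> W" "W \<subseteq> ball (point v) e"
      using topological_basisE[OF B(2), of "ball (point v) e" "point v"] e(1) by auto
    have "point -` W \<subseteq> U"
      using W(3) e(2) by (auto simp: dist_usphere.rep_eq subset_iff)
    then show "\<exists>W'\<in>?C. v \<in> W' \<and> W' \<subseteq> U" using W by blast
  qed
  then show "\<exists>C :: 'a usphere set set. countable C \<and> open = generate_topology C"
    using B(1) topological_basis_imp_subbasis by blast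
qed

text \<open>
  Countably many balls of radius \<open>r\<close> cover the space, and all have the same mass.
\<close>

lemma uniformly_distributed_ball_nonzero:
  fixes N :: "'b :: {metric_space, second_countable_topology} measure"
  assumes sN: "sets N = sets borel" and pos: "emeasure N UNIV \<noteq> 0"
    and unif: "\<And>x y r. emeasure N (ball x r) = emeasure N (ball y r)" and "r > 0"
  shows "emeasure N (ball x r) \<noteq> 0"
proof
  assume "emeasure N (ball x r) = 0"
  then have z: "ball y r \<in> null_sets N" for y
    using unif[of x r y] by (simp add: null_sets_def sN)
  obtain D :: "'b set" where D: "countable D" "\<And>X. open X \<Longrightarrow> X \<noteq> {} \<Longrightarrow> \<exists>d\<in>D. d \<in> X"
    by (erule countable_dense_setE)
  have "(\<Union>d\<in>D. ball d r) = UNIV"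
  proof (intro equalityI subsetI UNIV_I)
    fix y
    obtain d where "d \<in> D" "d \<in> ball y r" using D(2)[of "ball y r"] \<open>r > 0\<close> by auto
    then show "y \<in> (\<Union>d\<in>D. ball d r)" by (auto simp: dist_commute)
  qed
  then have "UNIV \<in> null_sets N" using null_sets_UN'[OF D(1), of "\<lambda>d. ball d r" N] z by simp
  then show False using pos by auto
qed

text \<open>
  Christensen's argument.  Let \<open>g r\<close> and \<open>h r\<close> be the masses of balls of radius \<open>r\<close> under \<open>M\<close> and \<open>N\<close>.
  Integrating \<open>N (A \<inter> ball x r)\<close> over \<open>x\<close> gives \<open>g r * N A\<close> by Fubini and the symmetry of the distance.
  The case \<open>A = UNIV\<close> identifies the ratio of \<open>g r\<close> and \<open>h r\<close>; the case \<open>A = U\<close> then bounds the \<open>M\<close>-mass of the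
  points whose \<open>r\<close>-ball lies in \<open>U\<close>, since there the integrand is \<open>h r\<close>.  Letting \<open>r\<close> tend to \<open>0\<close>
  exhausts \<open>U\<close>.
\<close>

lemma uniformly_distributed_open_le:
  fixes M N :: "'b :: {metric_space, second_countable_topology} measure"
  assumes sM: "sets M = sets borel" and sN: "sets N = sets borel"
    and fM: "finite_measure M" and fN: "finite_measure N"
    and uM: "\<And>x y r. emeasure M (ball x r) = emeasure M (ball y r)"
    and uN: "\<And>x y r. emeasure N (ball x r) = emeasure N (ball y r)"
    and pos: "emeasure N UNIV \<noteq> 0" and U: "open U"
  shows "emeasure M U * emeasure N UNIV \<le> emeasure M UNIV * emeasure N U"
proof -
  interpret M: finite_measure M by fact
  interpret N: finite_measure N by fact
  interpret pair_sigma_finite M N ..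
  note [measurable_cong] = sM sN
  have [simp]: "space M = UNIV" "space N = UNIV" using sM sN by (auto dest: sets_eq_imp_space_eq)
  define g h where "g r = emeasure M (ball undefined r)" and "h r = emeasure N (ball undefined r)" for r
  have g: "emeasure M (ball x r) = g r" and h: "emeasure N (ball x r) = h r" for x r
    unfolding g_def h_def by (rule uM uN)+
  have fub: "(\<integral>\<^sup>+x. emeasure N (A \<inter> ball x r) \<partial>M) = g r * emeasure N A" if A [measurable]: "A \<in> sets borel" for A r
  proof -
    have "(\<integral>\<^sup>+x. emeasure N (A \<inter> ball x r) \<partial>M) =
        (\<integral>\<^sup>+x. (\<integral>\<^sup>+y. indicator A y * (if dist x y < r then 1 else 0) \<partial>N) \<partial>M)"
    proof (rule nn_integral_cong)
      fix x
      have "emeasure N (A \<inter> ball x r) = (\<integral>\<^sup>+y. indicator (A \<inter> ball x r) y \<partial>N)"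
        by (simp add: sN)
      also have "\<dots> = (\<integral>\<^sup>+y. indicator A y * (if dist x y < r then 1 else 0) \<partial>N)"
        by (intro nn_integral_cong) (simp add: indicator_def)
      finally show "emeasure N (A \<inter> ball x r) = (\<integral>\<^sup>+y. indicator A y * (if dist x y < r then 1 else 0) \<partial>N)" .
    qed
    also have "\<dots> = (\<integral>\<^sup>+y. (\<integral>\<^sup>+x. indicator A y * (if dist x y < r then 1 else 0) \<partial>M) \<partial>N)"
      by (rule Fubini'[symmetric]) measurable
    also have "\<dots> = (\<integral>\<^sup>+y. indicator A y * g r \<partial>N)"
    proof (rule nn_integral_cong)
      fix y
      have "(\<integral>\<^sup>+x. (if dist x y < r then 1 else 0) \<partial>M) = (\<integral>\<^sup>+x. indicator (ball y r) x \<partial>M)"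
        by (intro nn_integral_cong) (simp add: indicator_def dist_commute)
      also have "\<dots> = g r" using g[of y r] by (simp add: sM)
      finally show "(\<integral>\<^sup>+x. indicator A y * (if dist x y < r then 1 else 0) \<partial>M) = indicator A y * g r"
        by (subst nn_integral_cmult) simp_all
    qed
    also have "\<dots> = g r * emeasure N A"
      by (subst mult.commute, subst nn_integral_cmult_indicator) (simp_all add: sN)
    finally show ?thesis .
  qed
  \<comment> \<open>the points of \<open>U\<close> at distance at least \<open>1 / (k + 1)\<close> from the complement\<close>
  define V where "V k = {x. ball x (1 / real (Suc k)) \<subseteq> U}" for k
  have "closed (V k)" for k
  proof -
    have "- V k = (\<Union>y\<in>- U. ball y (1 / real (Suc k)))"
      by (auto simp: V_def dist_commute subset_iff)
    then show ?thesis unfolding closed_def by auto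
  qed
  then have V: "V k \<in> sets borel" for k by simp
  have step: "emeasure M (V k) * emeasure N UNIV \<le> emeasure M UNIV * emeasure N U" for k
  proof -
    define r where "r = 1 / real (Suc k)"
    have h0: "h r \<noteq> 0" unfolding h_def r_def
      by (rule uniformly_distributed_ball_nonzero[OF sN pos uN]) simp
    have hfin: "h r \<noteq> top" unfolding h_def by (simp add: N.emeasure_eq_measure)
    have "h r * emeasure M (V k) = (\<integral>\<^sup>+x. h r * indicator (V k) x \<partial>M)"
      using V by (simp add: nn_integral_cmult_indicator sM)
    also have "\<dots> \<le> (\<integral>\<^sup>+x. emeasure N (U \<inter> ball x r) \<partial>M)"
    proof (rule nn_integral_mono)
      fix x show "h r * indicator (V k) x \<le> emeasure N (U \<inter> ball x r)"
      proof (cases "x \<in> V k")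
        case True
        then have "U \<inter> ball x r = ball x r" by (auto simp: V_def r_def)
        then show ?thesis using h[of x r] True by simp
      qed simp
    qed
    also have "\<dots> = g r * emeasure N U" using U by (intro fub) simp
    finally have "(h r * emeasure M (V k)) * emeasure N UNIV \<le> (g r * emeasure N U) * emeasure N UNIV"
      by (rule mult_right_mono) simp
    also have "\<dots> = (h r * emeasure M UNIV) * emeasure N U"
      using fub[of UNIV r] h by (simp add: ac_simps)
    finally have "h r * (emeasure M (V k) * emeasure N UNIV) \<le> h r * (emeasure M UNIV * emeasure N U)"
      by (simp add: mult.assoc)
    then show ?thesis using h0 hfin by (simp add: ennreal_mult_le_mult_iff)
  qed
  have "(\<Union>k. V k) = U"
  proof (intro equalityI subsetI)
    fix x assume "x \<in> (\<Union>k. V k)"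
    then obtain k where "ball x (1 / real (Suc k)) \<subseteq> U" by (auto simp: V_def)
    moreover have "x \<in> ball x (1 / real (Suc k))" by simp
    ultimately show "x \<in> U" by blast
  next
    fix x assume "x \<in> U"
    then obtain e where e: "e > 0" "ball x e \<subseteq> U" using U by (meson openE)
    obtain k where "1 / real (Suc k) < e"
      using reals_Archimedean[OF e(1)] by (auto simp: inverse_eq_divide)
    then have "ball x (1 / real (Suc k)) \<subseteq> ball x e" by (intro subset_ball) simp
    then have "x \<in> V k" using e(2) by (auto simp: V_def)
    then show "x \<in> (\<Union>k. V k)" by blast
  qed
  moreover have "incseq V"
  proof (rule incseq_SucI, rule subsetI)
    fix k x assume "x \<in> V k"
    moreover have "ball x (1 / real (Suc (Suc k))) \<subseteq> ball x (1 / real (Suc k))"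
      by (intro subset_ball) (simp add: field_simps)
    ultimately show "x \<in> V (Suc k)" by (auto simp: V_def)
  qed
  moreover have "range V \<subseteq> sets M" using V sM by auto
  ultimately have "emeasure M U = (SUP k. emeasure M (V k))"
    using SUP_emeasure_incseq[of V M] by simp
  then have "emeasure M U * emeasure N UNIV = (SUP k. emeasure M (V k) * emeasure N UNIV)"
    by (simp add: SUP_mult_right_ennreal)
  also have "\<dots> \<le> emeasure M UNIV * emeasure N U" by (rule SUP_least) (rule step)
  finally show ?thesis .
qed

text \<open>
  The inequality on open sets holds in both directions, and the open sets are a generator of the Borel
  sets that is closed under intersection.
\<close>

lemma uniformly_distributed_proportional:
  fixes M N :: "'b :: {metric_space, second_countable_topology} measure"
  assumes sM: "sets M = sets borel" and sN: "sets N = sets borel"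
    and fM: "finite_measure M" and fN: "finite_measure N"
    and uM: "\<And>x y r. emeasure M (ball x r) = emeasure M (ball y r)"
    and uN: "\<And>x y r. emeasure N (ball x r) = emeasure N (ball y r)"
    and pM: "emeasure M UNIV \<noteq> 0" and pN: "emeasure N UNIV \<noteq> 0"
  shows "scale_measure (emeasure N UNIV) M = scale_measure (emeasure M UNIV) N"
proof (rule measure_eqI_generator_eq[where E = "{S. open S}" and \<Omega> = UNIV and A = "\<lambda>_. UNIV"])
  interpret M: finite_measure M by fact
  interpret N: finite_measure N by fact
  show "Int_stable {S :: 'b set. open S}" by (auto simp: Int_stable_def)
  show "emeasure (scale_measure (emeasure N UNIV) M) U = emeasure (scale_measure (emeasure M UNIV) N) U"
    if "U \<in> {S. open S}" for U
    using uniformly_distributed_open_le[OF sM sN fM fN uM uN pN, of U]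
      uniformly_distributed_open_le[OF sN sM fN fM uN uM pM, of U] that
    by (simp add: antisym mult.commute)
  show "sets (scale_measure (emeasure N UNIV) M) = sigma_sets UNIV {S. open S}"
    "sets (scale_measure (emeasure M UNIV) N) = sigma_sets UNIV {S. open S}"
    by (simp_all add: sM sN sets_borel)
  show "emeasure (scale_measure (emeasure N UNIV) M) UNIV \<noteq> \<infinity>" for i :: nat
    by (simp add: M.emeasure_eq_measure N.emeasure_eq_measure ennreal_mult[symmetric])
qed auto


section \<open>Integrating great subsphere averages over all poles\<close>

lemma emeasure_sphere_measure_UNIV_nonzero:
  "emeasure (sphere_measure :: 'a :: euclidean_space usphere measure) UNIV \<noteq> 0"
proof -
  have "emeasure (sphere_measure :: 'a usphere measure) UNIV =
      of_nat DIM('a) * emeasure lborel (cball 0 1 - {0} :: 'a set)"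
    using nn_integral_sphere_measure[of "\<lambda>_ :: 'a usphere. 1"] by simp
  moreover
  obtain b :: 'a where b: "b \<in> Basis" using nonempty_Basis by blast
  have "emeasure lborel (ball 0 1 - {0} :: 'a set) \<noteq> 0"
    using b by (intro emeasure_lborel_open_nonzero[of _ "(1 / 2) *\<^sub>R b"]) (auto simp: open_Diff)
  moreover have "emeasure lborel (ball 0 1 - {0} :: 'a set) \<le> emeasure lborel (cball 0 1 - {0} :: 'a set)"
    by (intro emeasure_mono) auto
  ultimately show ?thesis by auto
qed

text \<open>
  Orthogonal maps act transitively on the sphere by isometries.
\<close>

lemma emeasure_ball_eq_of_rot_invariant:
  fixes M :: "'a :: euclidean_space usphere measure"
  assumes sM: "sets M = sets borel"
    and inv: "\<And>T. orthogonal_transformation T \<Longrightarrow> distr M borel (rot T) = M"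
  shows "emeasure M (ball x r) = emeasure M (ball y r)"
proof -
  let ?T = "reflect (point x - point y)"
  have T: "orthogonal_transformation ?T" by (rule orthogonal_transformation_reflect)
  have m: "rot ?T \<in> measurable M borel"
    using borel_measurable_rot[OF T] sM by (simp cong: measurable_cong_sets)
  have sp: "space M = UNIV" using sM by (auto dest: sets_eq_imp_space_eq)
  have iso: "dist (rot ?T v) (rot ?T w) = dist v w" for v w
    by (simp add: dist_usphere.rep_eq point_rot[OF T] dist_norm
        linear_diff[OF orthogonal_transformation_linear[OF T], symmetric] orthogonal_transformation_norm[OF T])
  have "emeasure M (ball y r) = emeasure (distr M borel (rot ?T)) (ball (rot ?T x) r)"
    by (simp add: inv[OF T] rot_reflect_swap)
  also have "\<dots> = emeasure M (rot ?T -` ball (rot ?T x) r)" using m by (simp add: emeasure_distr sp)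
  also have "rot ?T -` ball (rot ?T x) r = ball x r" by (auto simp: iso)
  finally show ?thesis ..
qed

text \<open>
  The integral of the great subsphere measures over all poles, written as the image of a product
  measure so that Fubini's theorem gives its integrals.
\<close>

definition mixed_measure :: "'a :: euclidean_space usphere measure" where
  "mixed_measure = scale_measure (of_nat (DIM('a) - 1))
     (distr (density (sphere_measure \<Otimes>\<^sub>M lborel) (\<lambda>z. indicator (cylinder (fst z)) (snd z))) borel
       (\<lambda>z. direction (proj_perp (fst z) (snd z))))"

lemma borel_measurable_nn_integral_subsphere [measurable]:
  assumes [measurable]: "f \<in> borel_measurable borel"
  shows "(\<lambda>u. \<integral>\<^sup>+v. f v \<partial>subsphere_measure u) \<in> borel_measurable borel"
proof -
  have "(\<lambda>u. \<integral>\<^sup>+x. f (direction (proj_perp u x)) * indicator (cylinder u) x \<partial>lborel) \<in> borel_measurable borel"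
    unfolding cylinder_def proj_perp_def by measurable
  then show ?thesis by (simp add: nn_integral_subsphere_measure)
qed

lemma nn_integral_mixed_measure:
  fixes f :: "'a :: euclidean_space usphere \<Rightarrow> ennreal"
  assumes [measurable]: "f \<in> borel_measurable borel"
  shows "(\<integral>\<^sup>+v. f v \<partial>mixed_measure) = (\<integral>\<^sup>+u. (\<integral>\<^sup>+v. f v \<partial>subsphere_measure u) \<partial>sphere_measure)"
proof -
  interpret S: finite_measure "sphere_measure :: 'a usphere measure" by (rule finite_sphere_measure)
  interpret pair_sigma_finite "sphere_measure :: 'a usphere measure" "lborel :: 'a measure" ..
  have [measurable]: "(\<lambda>z. indicator (cylinder (fst z)) (snd z)) \<in> borel_measurable (sphere_measure \<Otimes>\<^sub>M (lborel :: 'a measure))"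
    unfolding cylinder_def proj_perp_def by measurable
  have [measurable]: "(\<lambda>z. direction (proj_perp (fst z) (snd z))) \<in> measurable (sphere_measure \<Otimes>\<^sub>M (lborel :: 'a measure)) borel"
    unfolding proj_perp_def by measurable
  have "(\<integral>\<^sup>+v. f v \<partial>mixed_measure) = of_nat (DIM('a) - 1) *
      (\<integral>\<^sup>+v. f v \<partial>(distr (density (sphere_measure \<Otimes>\<^sub>M lborel) (\<lambda>z. indicator (cylinder (fst z)) (snd z))) borel
       (\<lambda>z. direction (proj_perp (fst z) (snd z)))))"
    unfolding mixed_measure_def by (rule nn_integral_scale_measure) simp
  also have "\<dots> = of_nat (DIM('a) - 1) * (\<integral>\<^sup>+z. indicator (cylinder (fst z)) (snd z) *
       f (direction (proj_perp (fst z) (snd z))) \<partial>(sphere_measure \<Otimes>\<^sub>M lborel))"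
    by (simp add: nn_integral_distr nn_integral_density)
  also have "\<dots> = of_nat (DIM('a) - 1) * (\<integral>\<^sup>+u. (\<integral>\<^sup>+x. indicator (cylinder u) x * f (direction (proj_perp u x)) \<partial>lborel) \<partial>sphere_measure)"
    by (subst lborel.nn_integral_fst[symmetric]) simp_all
  also have "\<dots> = (\<integral>\<^sup>+u. of_nat (DIM('a) - 1) * (\<integral>\<^sup>+x. f (direction (proj_perp u x)) * indicator (cylinder u) x \<partial>lborel) \<partial>sphere_measure)"
    unfolding cylinder_def proj_perp_def by (subst nn_integral_cmult) (simp_all add: mult.commute)
  also have "\<dots> = (\<integral>\<^sup>+u. (\<integral>\<^sup>+v. f v \<partial>subsphere_measure u) \<partial>sphere_measure)"
    by (simp add: nn_integral_subsphere_measure)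
  finally show ?thesis .
qed

lemma space_mixed_measure [simp]: "space mixed_measure = UNIV"
  and sets_mixed_measure [measurable_cong, simp]: "sets mixed_measure = sets borel"
  by (simp_all add: mixed_measure_def space_scale_measure)

lemma distr_mixed_measure_rot:
  assumes T: "orthogonal_transformation T"
  shows "distr mixed_measure borel (rot T) = mixed_measure"
proof (rule distr_eqI_nn_integral)
  have [measurable]: "rot T \<in> borel_measurable borel" by (rule borel_measurable_rot[OF T])
  show "rot T \<in> measurable mixed_measure borel" by simp
  fix A :: "'a usphere set" assume A [measurable]: "A \<in> sets borel"
  let ?G = "\<lambda>u. \<integral>\<^sup>+v. indicator A v \<partial>subsphere_measure u"
  have G: "(\<integral>\<^sup>+v. indicator A (rot T v) \<partial>subsphere_measure u) = ?G (rot T u)" for u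
    unfolding distr_subsphere_measure_rot[OF T, symmetric] by (subst nn_integral_distr) simp_all
  have mG: "?G \<in> borel_measurable borel" by (rule borel_measurable_nn_integral_subsphere) simp
  have "(\<integral>\<^sup>+v. indicator A (rot T v) \<partial>mixed_measure) = (\<integral>\<^sup>+u. ?G (rot T u) \<partial>sphere_measure)"
    by (subst nn_integral_mixed_measure) (simp_all only: G, measurable)
  also have "\<dots> = (\<integral>\<^sup>+u. ?G u \<partial>(distr sphere_measure borel (rot T)))"
    using mG by (subst nn_integral_distr) simp_all
  also have "\<dots> = (\<integral>\<^sup>+v. indicator A v \<partial>mixed_measure)"
    unfolding distr_sphere_measure_rot[OF T] by (rule nn_integral_mixed_measure[symmetric]) simp
  finally show "(\<integral>\<^sup>+v. indicator A (rot T v) \<partial>mixed_measure) = (\<integral>\<^sup>+v. indicator A v \<partial>mixed_measure)" .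
qed simp

text \<open>
  The mixed measure and the surface measure are both rotation invariant, hence uniformly distributed
  and proportional; total masses give the constant.
\<close>

lemma nn_integral_funk:
  fixes f :: "'a :: euclidean_space usphere \<Rightarrow> ennreal" and w :: "'a usphere"
  assumes n: "2 \<le> DIM('a)" and f: "f \<in> borel_measurable borel"
  shows "(\<integral>\<^sup>+u. (\<integral>\<^sup>+v. f v \<partial>subsphere_measure u) \<partial>sphere_measure) =
    emeasure (subsphere_measure w) UNIV * (\<integral>\<^sup>+v. f v \<partial>sphere_measure)"
proof -
  let ?S = "sphere_measure :: 'a usphere measure" and ?M = "mixed_measure :: 'a usphere measure"
  let ?m = "emeasure (subsphere_measure w) UNIV"
  interpret S: finite_measure ?S by (rule finite_sphere_measure)
  interpret W: finite_measure "subsphere_measure w" by (rule finite_subsphere_measure)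
  have "(\<integral>\<^sup>+u. emeasure (subsphere_measure u) UNIV \<partial>?S) = (\<integral>\<^sup>+u. ?m \<partial>?S)"
    by (intro nn_integral_cong emeasure_subsphere_measure_UNIV_eq)
  then have tot: "emeasure ?M UNIV = ?m * emeasure ?S UNIV"
    using nn_integral_mixed_measure[of "\<lambda>_ :: 'a usphere. 1"] by simp
  have S0: "emeasure ?S UNIV \<noteq> 0" by (rule emeasure_sphere_measure_UNIV_nonzero)
  have Sfin: "emeasure ?S UNIV \<noteq> top" by (simp add: S.emeasure_eq_measure)
  have "finite_measure ?M"
    by standard (simp add: tot S.emeasure_eq_measure W.emeasure_eq_measure ennreal_mult[symmetric])
  then have "scale_measure (emeasure ?S UNIV) ?M = scale_measure (emeasure ?M UNIV) ?S"
    using S0 emeasure_subsphere_measure_UNIV_nonzero[OF n, of w]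
    by (intro uniformly_distributed_proportional finite_sphere_measure
        emeasure_ball_eq_of_rot_invariant distr_mixed_measure_rot distr_sphere_measure_rot)
       (simp_all add: tot)
  then have "(\<integral>\<^sup>+v. f v \<partial>(scale_measure (emeasure ?S UNIV) ?M)) = (\<integral>\<^sup>+v. f v \<partial>(scale_measure (emeasure ?M UNIV) ?S))"
    by simp
  then have "emeasure ?S UNIV * (\<integral>\<^sup>+v. f v \<partial>?M) = emeasure ?S UNIV * (?m * (\<integral>\<^sup>+v. f v \<partial>?S))"
    using f by (simp add: nn_integral_scale_measure tot ac_simps)
  then have "(\<integral>\<^sup>+v. f v \<partial>?M) = ?m * (\<integral>\<^sup>+v. f v \<partial>?S)"
    using S0 Sfin by (simp add: ennreal_mult_cancel_left)
  then show ?thesis using nn_integral_mixed_measure[OF f] by simp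
qed


section \<open>Great subsphere averages of square-integrable functions\<close>

text \<open>
  The integral is written through nonnegative integrals, whose measurability in the pole is known
  from Fubini; where \<open>f\<close> is not integrable the integral is \<open>0\<close>.
\<close>

lemma borel_measurable_funk [measurable]:
  fixes f :: "'a :: euclidean_space usphere \<Rightarrow> real"
  assumes f [measurable]: "f \<in> borel_measurable borel"
  shows "funk f \<in> borel_measurable borel"
proof -
  fix w :: "'a usphere"
  have A: "(\<integral>v. f v \<partial>subsphere_measure u) =
      (if (\<integral>\<^sup>+v. ennreal \<bar>f v\<bar> \<partial>subsphere_measure u) < \<infinity>
       then enn2real (\<integral>\<^sup>+v. ennreal (f v) \<partial>subsphere_measure u) -
         enn2real (\<integral>\<^sup>+v. ennreal (- f v) \<partial>subsphere_measure u) else 0)" for u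
    using real_lebesgue_integral_def[of "subsphere_measure u" f] not_integrable_integral_eq[of "subsphere_measure u" f]
    by (auto simp: integrable_iff_bounded)
  have M: "measure (subsphere_measure u) UNIV = measure (subsphere_measure w) UNIV" for u :: "'a usphere"
    by (simp only: measure_def emeasure_subsphere_measure_UNIV_eq[of u w])
  have "funk f = (\<lambda>u. (if (\<integral>\<^sup>+v. ennreal \<bar>f v\<bar> \<partial>subsphere_measure u) < \<infinity>
       then enn2real (\<integral>\<^sup>+v. ennreal (f v) \<partial>subsphere_measure u) -
         enn2real (\<integral>\<^sup>+v. ennreal (- f v) \<partial>subsphere_measure u) else 0) / measure (subsphere_measure w) UNIV)"
    by (intro ext) (unfold funk_eq_integral[OF f] A, subst M, rule refl)
  moreover have "\<dots> \<in> borel_measurable borel" by measurable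
  ultimately show ?thesis by simp
qed

lemma square_integrable_iff:
  "square_integrable f \<longleftrightarrow>
    f \<in> borel_measurable borel \<and> (\<integral>\<^sup>+v. ennreal ((f v)\<^sup>2) \<partial>sphere_measure) < \<infinity>"
  by (auto simp: square_integrable_def integrable_iff_bounded cong: measurable_cong_sets)

text \<open>
  The variance of \<open>f\<close> over the great subsphere is nonnegative.  Where \<open>f\<close> is not square-integrable
  the right-hand side is infinite.
\<close>

lemma funk_square_le:
  fixes f :: "'a :: euclidean_space usphere \<Rightarrow> real"
  assumes n: "2 \<le> DIM('a)" and f [measurable]: "f \<in> borel_measurable borel"
  shows "emeasure (subsphere_measure u) UNIV * ennreal ((funk f u)\<^sup>2) \<le> (\<integral>\<^sup>+v. ennreal ((f v)\<^sup>2) \<partial>subsphere_measure u)"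
proof (cases "integrable (subsphere_measure u) (\<lambda>v. (f v)\<^sup>2)")
  case False
  then have "(\<integral>\<^sup>+v. ennreal ((f v)\<^sup>2) \<partial>subsphere_measure u) = top"
    by (simp add: integrable_iff_bounded flip: less_top)
  then show ?thesis by simp
next
  case sq: True
  interpret finite_measure "subsphere_measure u" by (rule finite_subsphere_measure)
  define m where "m = measure (subsphere_measure u) UNIV"
  have m: "m > 0" unfolding m_def by (rule measure_subsphere_measure_UNIV_pos[OF n])
  have int: "integrable (subsphere_measure u) f"
    by (rule square_integrable_imp_integrable[OF _ sq]) simp
  define a where "a = funk f u"
  have a: "(\<integral>v. f v \<partial>subsphere_measure u) = a * m"
    using m by (simp add: a_def funk_eq_integral m_def)
  have "0 \<le> (\<integral>v. (f v - a)\<^sup>2 \<partial>subsphere_measure u)" by simp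
  also have "\<dots> = (\<integral>v. (f v)\<^sup>2 + a\<^sup>2 - 2 * a * f v \<partial>subsphere_measure u)"
    by (simp add: power2_diff mult_ac)
  also have "\<dots> = (\<integral>v. (f v)\<^sup>2 \<partial>subsphere_measure u) - m * a\<^sup>2"
    using sq int by (simp add: a m_def[symmetric] power2_eq_square algebra_simps)
  finally have "ennreal (m * a\<^sup>2) \<le> ennreal (\<integral>v. (f v)\<^sup>2 \<partial>subsphere_measure u)"
    by (intro ennreal_leI) simp
  also have "\<dots> = (\<integral>\<^sup>+v. ennreal ((f v)\<^sup>2) \<partial>subsphere_measure u)"
    using sq by (subst nn_integral_eq_integral) auto
  finally show ?thesis
    using m by (simp add: emeasure_eq_measure m_def[symmetric] a_def[symmetric] ennreal_mult)
qed

lemma nn_integral_funk_square_le: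
  fixes f :: "'a :: euclidean_space usphere \<Rightarrow> real"
  assumes n: "2 \<le> DIM('a)" and f [measurable]: "f \<in> borel_measurable borel"
  shows "(\<integral>\<^sup>+u. ennreal ((funk f u)\<^sup>2) \<partial>sphere_measure) \<le> (\<integral>\<^sup>+v. ennreal ((f v)\<^sup>2) \<partial>sphere_measure)"
proof -
  fix w :: "'a usphere"
  let ?m = "emeasure (subsphere_measure w) UNIV"
  interpret W: finite_measure "subsphere_measure w" by (rule finite_subsphere_measure)
  have "?m * (\<integral>\<^sup>+u. ennreal ((funk f u)\<^sup>2) \<partial>sphere_measure) = (\<integral>\<^sup>+u. ?m * ennreal ((funk f u)\<^sup>2) \<partial>sphere_measure)"
    by (rule nn_integral_cmult[symmetric]) simp
  also have "\<dots> \<le> (\<integral>\<^sup>+u. (\<integral>\<^sup>+v. ennreal ((f v)\<^sup>2) \<partial>subsphere_measure u) \<partial>sphere_measure)"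
  proof (rule nn_integral_mono)
    fix u show "?m * ennreal ((funk f u)\<^sup>2) \<le> (\<integral>\<^sup>+v. ennreal ((f v)\<^sup>2) \<partial>subsphere_measure u)"
      unfolding emeasure_subsphere_measure_UNIV_eq[of w u] by (rule funk_square_le[OF n f])
  qed
  also have "\<dots> = ?m * (\<integral>\<^sup>+v. ennreal ((f v)\<^sup>2) \<partial>sphere_measure)"
    by (rule nn_integral_funk[OF n]) simp
  finally show ?thesis
    using emeasure_subsphere_measure_UNIV_nonzero[OF n, of w]
    by (simp add: ennreal_mult_le_mult_iff W.emeasure_eq_measure)
qed

lemma square_integrable_funk:
  fixes f :: "'a :: euclidean_space usphere \<Rightarrow> real"
  assumes n: "2 \<le> DIM('a)" and f: "square_integrable f"
  shows "square_integrable (funk f)"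
  using f nn_integral_funk_square_le[OF n, of f] by (auto simp: square_integrable_iff)

text \<open>
  Additivity of averages needs integrability on the great subsphere, which can fail for exceptional
  poles.
\<close>

lemma AE_integrable_subsphere_measure:
  fixes f :: "'a :: euclidean_space usphere \<Rightarrow> real"
  assumes n: "2 \<le> DIM('a)" and f: "square_integrable f"
  shows "AE u in sphere_measure. integrable (subsphere_measure u) f"
proof -
  fix w :: "'a usphere"
  interpret S: finite_measure "sphere_measure :: 'a usphere measure" by (rule finite_sphere_measure)
  interpret W: finite_measure "subsphere_measure w" by (rule finite_subsphere_measure)
  have m [measurable]: "f \<in> borel_measurable borel" using f by (simp add: square_integrable_iff)
  have "integrable sphere_measure f"
    by (rule S.square_integrable_imp_integrable) (use f in \<open>simp_all add: square_integrable_def\<close>)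
  then have "(\<integral>\<^sup>+v. ennreal \<bar>f v\<bar> \<partial>sphere_measure) < \<infinity>" by (simp add: integrable_iff_bounded)
  then have "(\<integral>\<^sup>+u. (\<integral>\<^sup>+v. ennreal \<bar>f v\<bar> \<partial>subsphere_measure u) \<partial>sphere_measure) \<noteq> \<infinity>"
    by (subst nn_integral_funk[OF n, of _ w]) (auto simp: ennreal_mult_eq_top_iff W.emeasure_eq_measure)
  then have "AE u in sphere_measure. (\<integral>\<^sup>+v. ennreal \<bar>f v\<bar> \<partial>subsphere_measure u) \<noteq> \<infinity>"
    by (intro nn_integral_noteq_infinite) simp_all
  then show ?thesis
    by eventually_elim (simp add: integrable_iff_bounded less_top)
qed

text \<open>
  Averages over a great subsphere, itself a null set, make sense for classes of functions because a
  null set of the sphere meets almost every great subsphere in a null set.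
\<close>

lemma AE_funk_cong:
  fixes f g :: "'a :: euclidean_space usphere \<Rightarrow> real"
  assumes n: "2 \<le> DIM('a)" and [measurable]: "f \<in> borel_measurable borel" "g \<in> borel_measurable borel"
    and fg: "AE v in sphere_measure. f v = g v"
  shows "AE u in sphere_measure. funk f u = funk g u"
proof -
  fix w :: "'a usphere"
  let ?N = "{v. f v \<noteq> g v}"
  have N [measurable]: "?N \<in> sets borel" by measurable
  have "?N \<in> null_sets sphere_measure"
    using fg AE_iff_null[of sphere_measure "\<lambda>v. f v = g v"] N by simp
  then have "(\<integral>\<^sup>+u. (\<integral>\<^sup>+v. indicator ?N v \<partial>subsphere_measure u) \<partial>sphere_measure) = 0"
    by (subst nn_integral_funk[OF n, of _ w]) (auto simp: null_sets_def)
  then have "(\<integral>\<^sup>+u. emeasure (subsphere_measure u) ?N \<partial>sphere_measure) = 0" by simp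
  moreover have "(\<lambda>u. emeasure (subsphere_measure u) ?N) \<in> borel_measurable borel"
    using borel_measurable_nn_integral_subsphere[of "indicator ?N"] by simp
  ultimately have "AE u in sphere_measure. emeasure (subsphere_measure u) ?N = 0"
    by (subst (asm) nn_integral_0_iff_AE) simp_all
  then show ?thesis
  proof eventually_elim
    case (elim u)
    then have "AE v in subsphere_measure u. f v = g v"
      by (simp add: AE_iff_null null_sets_def)
    then have "(\<integral>v. f v \<partial>subsphere_measure u) = (\<integral>v. g v \<partial>subsphere_measure u)"
      by (intro integral_cong_AE) simp_all
    then show ?case by (simp add: funk_eq_integral)
  qed
qed

lemma L2_rel_funk:
  fixes f g :: "'a :: euclidean_space usphere \<Rightarrow> real"
  assumes n: "2 \<le> DIM('a)" and "L2_rel f g"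
  shows "L2_rel (funk f) (funk g)"
  using assms square_integrable_funk[OF n] AE_funk_cong[OF n, of f g]
  by (auto simp: L2_rel_def square_integrable_iff)

lemma L2_rel_refl_iff: "L2_rel f f \<longleftrightarrow> square_integrable f"
  by (simp add: L2_rel_def)

lemma abs_sphere_L2_eqI: "L2_rel f g \<Longrightarrow> abs_sphere_L2 f = abs_sphere_L2 g"
  by (rule Quotient_rel_abs[OF Quotient_sphere_L2])

lemma abs_rep_sphere_L2: "abs_sphere_L2 (rep_sphere_L2 F) = F"
  by (rule Quotient_abs_rep[OF Quotient_sphere_L2])

lemma square_integrable_rep: "square_integrable (rep_sphere_L2 F)"
  using Quotient_rep_reflp[OF Quotient_sphere_L2] by (simp add: L2_rel_refl_iff)

lemma sphere_L2_cases:
  obtains f where "F = abs_sphere_L2 f" "square_integrable f"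
  using abs_rep_sphere_L2[of F] square_integrable_rep[of F] by metis

lemma norm_abs_sphere_L2:
  assumes "square_integrable f"
  shows "norm (abs_sphere_L2 f) = sqrt (\<integral>v. (f v)\<^sup>2 \<partial>sphere_measure)"
  using assms by (simp add: norm_sphere_L2_def inner_sphere_L2.abs_eq L2_rel_refl_iff power2_eq_square)

text \<open>
  Averages do not depend on the representative almost everywhere if the dimension is at least two,
  so an arbitrary representative is taken.
\<close>

definition funk_L2 :: "'a :: euclidean_space sphere_L2 \<Rightarrow> 'a sphere_L2" where
  "funk_L2 F = abs_sphere_L2 (funk (rep_sphere_L2 F))"

lemma funk_L2_abs:
  fixes f :: "'a :: euclidean_space usphere \<Rightarrow> real"
  assumes n: "2 \<le> DIM('a)" and f: "square_integrable f"
  shows "funk_L2 (abs_sphere_L2 f) = abs_sphere_L2 (funk f)"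
proof -
  have "L2_rel (rep_sphere_L2 (abs_sphere_L2 f)) f"
    using f by (intro Quotient_rep_abs[OF Quotient_sphere_L2]) (simp add: L2_rel_refl_iff)
  from L2_rel_funk[OF n this] show ?thesis
    unfolding funk_L2_def by (rule abs_sphere_L2_eqI)
qed

lemma bounded_linear_funk_L2:
  assumes n: "2 \<le> DIM('a :: euclidean_space)"
  shows "bounded_linear (funk_L2 :: 'a sphere_L2 \<Rightarrow> 'a sphere_L2)"
proof (rule bounded_linear_intro[where K = 1])
  fix F G :: "'a sphere_L2" and c :: real
  obtain f where F: "F = abs_sphere_L2 f" and f: "square_integrable f" by (rule sphere_L2_cases)
  obtain g where G: "G = abs_sphere_L2 g" and g: "square_integrable g" by (rule sphere_L2_cases)
  have mf: "f \<in> borel_measurable borel" and mg: "g \<in> borel_measurable borel"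
    using f g by (simp_all add: square_integrable_iff)
  note sq = square_integrable_funk[OF n]
  have "AE u in sphere_measure. funk (\<lambda>v. f v + g v) u = funk f u + funk g u"
    using AE_integrable_subsphere_measure[OF n f] AE_integrable_subsphere_measure[OF n g]
    by eventually_elim (use mf mg in \<open>simp add: funk_eq_integral add_divide_distrib\<close>)
  then have "L2_rel (funk (\<lambda>v. f v + g v)) (\<lambda>u. funk f u + funk g u)"
    using f g by (simp add: L2_rel_def sq square_integrable_add)
  then show "funk_L2 (F + G) = funk_L2 F + funk_L2 G"
    using f g by (simp add: F G plus_sphere_L2.abs_eq L2_rel_refl_iff funk_L2_abs[OF n] square_integrable_add sq abs_sphere_L2_eqI)
  have "funk (\<lambda>v. c * f v) = (\<lambda>u. c * funk f u)"
    by (rule ext) (rule funk_cmult[OF mf])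
  then show "funk_L2 (c *\<^sub>R F) = c *\<^sub>R funk_L2 F"
    using f mf by (simp add: F scaleR_sphere_L2.abs_eq L2_rel_refl_iff funk_L2_abs[OF n] square_integrable_scale sq)
  have "ennreal (\<integral>v. (funk f v)\<^sup>2 \<partial>sphere_measure) \<le> ennreal (\<integral>v. (f v)\<^sup>2 \<partial>sphere_measure)"
    using nn_integral_funk_square_le[OF n mf] f sq[OF f]
    by (simp add: nn_integral_eq_integral square_integrable_def)
  then have "(\<integral>v. (funk f v)\<^sup>2 \<partial>sphere_measure) \<le> (\<integral>v. (f v)\<^sup>2 \<partial>sphere_measure)"
    by (simp add: ennreal_le_iff)
  then show "norm (funk_L2 F) \<le> norm F * 1"
    by (simp add: F funk_L2_abs[OF n f] norm_abs_sphere_L2 f sq)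
qed

lemma funk_L2_to_L2:
  fixes \<psi> :: "'a :: euclidean_space usphere \<Rightarrow>\<^sub>C real"
  assumes n: "2 \<le> DIM('a)"
  shows "funk_L2 (to_L2 \<psi>) = to_L2 (funk_continuous \<psi>)"
  using L2_rel_bcontfun[of \<psi>]
  by (simp add: to_L2_def funk_L2_abs[OF n] apply_funk_continuous[OF n] L2_rel_def)

lemma to_L2_scaleR: "to_L2 (c *\<^sub>R \<psi>) = c *\<^sub>R to_L2 \<psi>"
  using L2_rel_bcontfun[of \<psi>] by (simp add: to_L2_def scaleR_sphere_L2.abs_eq)


section \<open>Density of the continuous functions\<close>

lemma abs_sphere_L2_add:
  "square_integrable f \<Longrightarrow> square_integrable g \<Longrightarrow>
    abs_sphere_L2 (\<lambda>v. f v + g v) = abs_sphere_L2 f + abs_sphere_L2 g"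
  by (simp add: plus_sphere_L2.abs_eq L2_rel_refl_iff)

lemma abs_sphere_L2_cmult:
  "square_integrable f \<Longrightarrow> abs_sphere_L2 (\<lambda>v. c * f v) = c *\<^sub>R abs_sphere_L2 f"
  by (simp add: scaleR_sphere_L2.abs_eq L2_rel_refl_iff)

text \<open>
  Dominated convergence turns dominated pointwise limits into \<open>L\<^sup>2\<close>-limits, which a bounded operator
  respects.
\<close>

lemma blinfun_null_limit:
  fixes M :: "'a :: euclidean_space sphere_L2 \<Rightarrow>\<^sub>L 'a sphere_L2"
  assumes s: "\<And>i. square_integrable (s i)" "\<And>i. blinfun_apply M (abs_sphere_L2 (s i)) = 0"
    and lim: "\<And>v. (\<lambda>i. s i v) \<longlonglongrightarrow> f v"
    and w: "square_integrable w" "\<And>i v. \<bar>s i v\<bar> \<le> w v"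
  shows "square_integrable f \<and> blinfun_apply M (abs_sphere_L2 f) = 0"
proof -
  have ms [measurable]: "s i \<in> borel_measurable borel" and mw [measurable]: "w \<in> borel_measurable borel" for i
    using s(1) w(1) by (simp_all add: square_integrable_iff)
  have mf [measurable]: "f \<in> borel_measurable borel"
    by (rule borel_measurable_LIMSEQ_real[OF lim ms])
  have fw: "\<bar>f v\<bar> \<le> w v" for v
    by (rule LIMSEQ_le_const2[OF tendsto_rabs[OF lim]]) (use w(2) in auto)
  have iw: "integrable sphere_measure (\<lambda>v. (2 * w v)\<^sup>2)"
    using w(1) by (simp add: square_integrable_def power_mult_distrib)
  have "(f v)\<^sup>2 \<le> (w v)\<^sup>2" for v 
    using fw[of v] by (simp add: abs_le_square_iff[symmetric])
  then have "(\<integral>\<^sup>+v. ennreal ((f v)\<^sup>2) \<partial>sphere_measure) \<le> (\<integral>\<^sup>+v. ennreal ((w v)\<^sup>2) \<partial>sphere_measure)"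
    by (intro nn_integral_mono ennreal_leI)
  then have f: "square_integrable f"
    using w(1) by (auto simp: square_integrable_iff)
  have d: "square_integrable (\<lambda>v. s i v + -1 * f v)" for i
    by (intro square_integrable_add square_integrable_scale s(1) f)
  have diff: "abs_sphere_L2 (s i) - abs_sphere_L2 f = abs_sphere_L2 (\<lambda>v. s i v + -1 * f v)" for i
  proof -
    have "abs_sphere_L2 (\<lambda>v. s i v + -1 * f v) = abs_sphere_L2 (s i) + (-1) *\<^sub>R abs_sphere_L2 f"
      by (simp only: abs_sphere_L2_add[OF s(1) square_integrable_scale[OF f]] abs_sphere_L2_cmult[OF f])
    then show ?thesis by simp
  qed
  have "(\<lambda>i. \<integral>v. (s i v + -1 * f v)\<^sup>2 \<partial>sphere_measure) \<longlonglongrightarrow> (\<integral>v. 0 \<partial>(sphere_measure :: 'a usphere measure))"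
  proof (rule integral_dominated_convergence[where w = "\<lambda>v. (2 * w v)\<^sup>2"])
    show "AE v in sphere_measure. (\<lambda>i. (s i v + -1 * f v)\<^sup>2) \<longlonglongrightarrow> 0"
    proof (rule AE_I2)
      fix v
      have "(\<lambda>i. (s i v + -1 * f v)\<^sup>2) \<longlonglongrightarrow> (f v + -1 * f v)\<^sup>2" by (intro tendsto_intros lim)
      then show "(\<lambda>i. (s i v + -1 * f v)\<^sup>2) \<longlonglongrightarrow> 0" by simp
    qed
    show "AE v in sphere_measure. norm ((s i v + -1 * f v)\<^sup>2) \<le> (2 * w v)\<^sup>2" for i
    proof (rule AE_I2)
      fix v
      have "\<bar>s i v + -1 * f v\<bar> \<le> 2 * w v" using w(2)[of i v] fw[of v] by linarith
      then have "\<bar>s i v + -1 * f v\<bar>\<^sup>2 \<le> (2 * w v)\<^sup>2" by (rule power_mono) simp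
      then show "norm ((s i v + -1 * f v)\<^sup>2) \<le> (2 * w v)\<^sup>2" by simp
    qed
  qed (use iw in simp_all)
  then have "(\<lambda>i. sqrt (\<integral>v. (s i v + -1 * f v)\<^sup>2 \<partial>sphere_measure)) \<longlonglongrightarrow> sqrt 0"
    by (intro tendsto_real_sqrt) simp
  then have "(\<lambda>i. norm (abs_sphere_L2 (s i) - abs_sphere_L2 f)) \<longlonglongrightarrow> 0"
    using d by (simp add: diff norm_abs_sphere_L2)
  then have "(\<lambda>i. abs_sphere_L2 (s i)) \<longlonglongrightarrow> abs_sphere_L2 f"
    by (simp add: LIM_zero_cancel tendsto_norm_zero_iff)
  then have "(\<lambda>i. blinfun_apply M (abs_sphere_L2 (s i))) \<longlonglongrightarrow> blinfun_apply M (abs_sphere_L2 f)"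
    by (intro tendsto_intros)
  then have "blinfun_apply M (abs_sphere_L2 f) = 0" by (simp add: s(2) LIMSEQ_const_iff)
  then show ?thesis using f by simp
qed

lemma square_integrable_bounded:
  assumes [measurable]: "f \<in> borel_measurable borel" and b: "\<And>v. \<bar>f v\<bar> \<le> B"
  shows "square_integrable f"
proof -
  interpret finite_measure "sphere_measure :: 'a usphere measure" by (rule finite_sphere_measure)
  have "(f v)\<^sup>2 \<le> B\<^sup>2" for v using power_mono[OF b, of v 2] by simp
  then have "integrable sphere_measure (\<lambda>v. (f v)\<^sup>2)"
    by (intro integrable_const_bound[of _ "B\<^sup>2"]) auto
  then show ?thesis by (simp add: square_integrable_def)
qed

text \<open>
  The distance to the complement, scaled up and cut off at one.  The whole space is treated
  separately because \<open>infdist\<close> to the empty set is \<open>0\<close>.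
\<close>

lemma indicator_open_limit_continuous:
  fixes U :: "'a :: metric_space set"
  assumes "open U"
  obtains s :: "nat \<Rightarrow> 'a \<Rightarrow> real"
  where "\<And>i. continuous_on UNIV (s i)" "\<And>i v. \<bar>s i v\<bar> \<le> 1" "\<And>v. (\<lambda>i. s i v) \<longlonglongrightarrow> indicator U v"
proof (cases "U = UNIV")
  case True
  show ?thesis by (rule that[of "\<lambda>_ _. 1"]) (auto simp: True)
next
  case False
  let ?s = "\<lambda>i v. min 1 (real i * infdist v (- U))"
  show ?thesis
  proof (rule that[of ?s])
    show "continuous_on UNIV (?s i)" for i by (intro continuous_intros)
    show "\<bar>?s i v\<bar> \<le> 1" for i v
      using mult_nonneg_nonneg[OF of_nat_0_le_iff[of i] infdist_nonneg[of v "- U"]] by (simp add: abs_le_iff min_le_iff_disj)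
    fix v
    show "(\<lambda>i. ?s i v) \<longlonglongrightarrow> indicator U v"
    proof (cases "v \<in> U")
      case True
      then have pos: "infdist v (- U) > 0"
        using False assms by (intro infdist_pos_not_in_closed) (auto simp: closed_def)
      obtain k where k: "1 < real k * infdist v (- U)" using reals_Archimedean3[OF pos] by blast
      have "eventually (\<lambda>i. ?s i v = 1) sequentially"
        using eventually_ge_at_top[of k]
      proof eventually_elim
        case (elim i)
        then have "real k * infdist v (- U) \<le> real i * infdist v (- U)"
          by (intro mult_right_mono) (auto simp: infdist_nonneg)
        then show ?case using k by simp
      qed
      then show ?thesis using True by (simp add: tendsto_eventually)
    next
      case False
      then show ?thesis by simp
    qed
  qed
qed

text \<open>
  The continuous functions are dense in \<open>L\<^sup>2\<close>.  The functions on which \<open>M1\<close> and \<open>M2\<close> agree form a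
  vector space closed under dominated limits; it contains the continuous functions, hence the
  indicators of open sets, hence by Dynkin's theorem those of Borel sets, hence simple functions
  and their dominated limits.
\<close>

lemma blinfun_eqI_on_continuous:
  fixes M1 M2 :: "'a :: euclidean_space sphere_L2 \<Rightarrow>\<^sub>L 'a sphere_L2"
  assumes eq: "\<And>\<psi>. blinfun_apply M1 (to_L2 \<psi>) = blinfun_apply M2 (to_L2 \<psi>)"
  shows "M1 = M2"
proof -
  define M where "M = M1 - M2"
  define P where "P f \<longleftrightarrow> square_integrable f \<and> blinfun_apply M (abs_sphere_L2 f) = 0" for f
  have lim: "P f" if "\<And>i. P (s i)" "\<And>v. (\<lambda>i. s i v) \<longlonglongrightarrow> f v" "square_integrable w" "\<And>i v. \<bar>s i v\<bar> \<le> w v" for s f w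
    using blinfun_null_limit[of s M f w] that unfolding P_def by blast
  have add: "P (\<lambda>v. f v + g v)" if "P f" "P g" for f g
  proof -
    have "abs_sphere_L2 (\<lambda>v. f v + g v) = abs_sphere_L2 f + abs_sphere_L2 g"
      using that by (simp add: P_def abs_sphere_L2_add)
    then show ?thesis using that by (simp add: P_def square_integrable_add blinfun.add_right)
  qed
  have scale: "P (\<lambda>v. c * f v)" if "P f" for f c
  proof -
    have "abs_sphere_L2 (\<lambda>v. c * f v) = c *\<^sub>R abs_sphere_L2 f"
      using that by (simp add: P_def abs_sphere_L2_cmult)
    then show ?thesis using that by (simp add: P_def square_integrable_scale blinfun.scaleR_right)
  qed
  have cont: "P f" if "continuous_on UNIV f" for f
  proof -
    have "apply_bcontfun (Bcontfun f) = f" by (rule Bcontfun_inverse_compact[OF that])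
    then have "to_L2 (Bcontfun f) = abs_sphere_L2 f" "L2_rel f f"
      using L2_rel_bcontfun[of "Bcontfun f"] by (simp_all add: to_L2_def)
    then show ?thesis using eq[of "Bcontfun f"] by (simp add: P_def L2_rel_refl_iff M_def blinfun.diff_left)
  qed
  have sum: "P (\<lambda>v. \<Sum>i\<in>I. c i * f i v)" if "finite I" "\<And>i. i \<in> I \<Longrightarrow> P (f i)" for I :: "'i set" and c f
    using that
  proof (induction I rule: finite_induct)
    case (insert i I)
    then show ?case using add[OF scale[of "f i" "c i"], of "\<lambda>v. \<Sum>i\<in>I. c i * f i v"] by simp
  qed (simp add: cont)
  have one: "square_integrable (\<lambda>_ :: 'a usphere. 1 :: real)" by (rule square_integrable_bounded[of _ 1]) auto
  have ind: "P (indicator A)" if "A \<in> sets borel" for A :: "'a usphere set"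
  proof -
    have "Int_stable {S :: 'a usphere set. open S}" "{S. open S} \<subseteq> Pow (UNIV :: 'a usphere set)"
      "A \<in> sigma_sets UNIV {S. open S}" using that by (auto simp: sets_borel Int_stable_def)
    then show ?thesis
    proof (induction A rule: sigma_sets_induct_disjoint)
      case (basic U)
      then have "open U" by simp
      then obtain s :: "nat \<Rightarrow> 'a usphere \<Rightarrow> real" where
        s: "\<And>i. continuous_on UNIV (s i)" "\<And>i v. \<bar>s i v\<bar> \<le> 1" "\<And>v. (\<lambda>i. s i v) \<longlonglongrightarrow> indicator U v"
        by (rule indicator_open_limit_continuous) blast
      show ?case by (rule lim[OF cont[OF s(1)] s(3) one s(2)])
    next
      case empty
      have "indicator {} = (\<lambda>_ :: 'a usphere. 0 :: real)" by auto
      then show ?case using cont[of "\<lambda>_. 0"] by simp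
    next
      case (compl A)
      have "indicator (UNIV - A) = (\<lambda>v. 1 + -1 * indicator A v :: real)" by (auto simp: indicator_def)
      then show ?case using add[OF cont scale[OF compl(2)], of "\<lambda>_. 1" "-1"] by simp
    next
      case (union A)
      have dis: "disjoint_family A" by fact
      let ?s = "\<lambda>n v. \<Sum>i<n. 1 * indicator (A i) v :: real"
      have s: "?s n v = indicator (\<Union>i<n. A i) v" for n v
        using dis by (subst indicator_UN_disjoint) (auto intro: disjoint_family_on_mono)
      show ?case
      proof (rule lim[OF _ _ one, of ?s])
        show "P (?s n)" for n by (rule sum) (simp_all add: union)
        show "\<bar>?s n v\<bar> \<le> 1" for n v unfolding s by (simp add: indicator_def)
        fix v
        show "(\<lambda>n. ?s n v) \<longlonglongrightarrow> indicator (\<Union>i. A i) v"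
          unfolding s by (rule LIMSEQ_indicator_UN)
      qed
    qed
  qed
  have all: "P f" if f: "square_integrable f" for f
  proof -
    have "f \<in> borel_measurable (borel :: 'a usphere measure)" using f by (simp add: square_integrable_iff)
    from borel_measurable_implies_sequence_metric[OF this, of 0] obtain s where
      s: "\<And>i. simple_function borel (s i)" "\<And>v. (\<lambda>i. s i v) \<longlonglongrightarrow> f v" "\<And>i v. \<bar>s i v\<bar> \<le> 2 * \<bar>f v\<bar>"
      by auto
    show ?thesis
    proof (rule lim[OF _ s(2)])
      show "square_integrable (\<lambda>v. 2 * \<bar>f v\<bar>)"
        using f by (auto simp: square_integrable_iff power_mult_distrib ennreal_mult nn_integral_cmult ennreal_mult_less_top)
      show "\<bar>s i v\<bar> \<le> 2 * \<bar>f v\<bar>" for i v by (rule s(3))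
      fix i
      have "s i v = (\<Sum>y\<in>range (s i). indicator (s i -` {y}) v *\<^sub>R y)" for v
        using simple_function_indicator_representation_banach[OF s(1)[of i], of v]
        by (simp only: space_borel UNIV_I Int_UNIV_right simp_thms)
      then have "s i = (\<lambda>v. \<Sum>y\<in>range (s i). y * indicator (s i -` {y}) v)"
        by (intro ext) (simp only: real_scaleR_def mult.commute)
      moreover have "P (\<lambda>v. \<Sum>y\<in>range (s i). y * indicator (s i -` {y}) v)"
        using simple_functionD[OF s(1)[of i]] by (intro sum ind) auto
      ultimately show "P (s i)" by simp
    qed
  qed
  have "blinfun_apply M F = 0" for F
    using all unfolding P_def by (metis sphere_L2_cases)
  then show ?thesis by (intro blinfun_eqI) (simp add: M_def blinfun.diff_left)
qed


section \<open>Directional derivatives of polynomials\<close>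

text \<open>
  For polynomials this is the Frechet derivative applied to \<open>h\<close>; the definition by \<open>deriv\<close> agrees with
  the second derivatives that make up \<open>laplacian\<close>.
\<close>

definition dir_deriv :: "'a :: real_normed_vector \<Rightarrow> ('a \<Rightarrow> real) \<Rightarrow> 'a \<Rightarrow> real" where
  "dir_deriv h p x = deriv (\<lambda>t. p (x + t *\<^sub>R h)) 0"

lemma dir_deriv_eqI:
  assumes "(p has_derivative D) (at x)"
  shows "dir_deriv h p x = D h"
proof -
  have "((\<lambda>t. x + t *\<^sub>R h) has_derivative (\<lambda>s. s *\<^sub>R h)) (at 0)"
    by (auto intro!: derivative_eq_intros)
  moreover have "(p has_derivative D) (at (x + 0 *\<^sub>R h))" using assms by simp
  ultimately have "((\<lambda>t. p (x + t *\<^sub>R h)) has_derivative (\<lambda>s. D (s *\<^sub>R h))) (at 0)"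
    by (rule has_derivative_compose)
  moreover have "D (s *\<^sub>R h) = s * D h" for s
    using has_derivative_linear[OF assms] by (simp add: linear_scale)
  ultimately have "((\<lambda>t. p (x + t *\<^sub>R h)) has_real_derivative D h) (at 0)"
    by (simp add: has_field_derivative_def mult_commute_abs)
  then show ?thesis unfolding dir_deriv_def by (rule DERIV_imp_deriv)
qed

lemma has_derivative_dir_deriv:
  fixes p :: "'a :: euclidean_space \<Rightarrow> real"
  assumes "real_polynomial_function p"
  shows "(p has_derivative (\<lambda>h. dir_deriv h p x)) (at x)"
proof -
  obtain D where D: "(p has_derivative D) (at x)"
    using differentiable_at_real_polynomial_function[OF assms] by (auto simp: differentiable_def)
  then have "D = (\<lambda>h. dir_deriv h p x)" using dir_deriv_eqI[OF D] by auto
  with D show ?thesis by simp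
qed

context
  fixes p q :: "'a :: euclidean_space \<Rightarrow> real"
  assumes p: "real_polynomial_function p" and q: "real_polynomial_function q"
begin

lemma dir_deriv_add: "dir_deriv h (\<lambda>x. p x + q x) = (\<lambda>x. dir_deriv h p x + dir_deriv h q x)"
  by (rule ext, rule dir_deriv_eqI) (intro has_derivative_add has_derivative_dir_deriv p q)

lemma dir_deriv_mult: "dir_deriv h (\<lambda>x. p x * q x) = (\<lambda>x. p x * dir_deriv h q x + dir_deriv h p x * q x)"
  by (rule ext, rule dir_deriv_eqI) (intro has_derivative_mult has_derivative_dir_deriv p q)

end

lemma dir_deriv_const [simp]: "dir_deriv h (\<lambda>x. c) = (\<lambda>x. 0)"
  by (rule ext) (simp add: dir_deriv_def)

lemma dir_deriv_bounded_linear: "bounded_linear f \<Longrightarrow> dir_deriv h f = (\<lambda>x. f h)"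
  by (rule ext, rule dir_deriv_eqI) (rule bounded_linear_imp_has_derivative)

lemma dir_deriv_inner: "dir_deriv h (\<lambda>x. x \<bullet> b) = (\<lambda>x. h \<bullet> b)"
  by (rule dir_deriv_bounded_linear) (rule bounded_linear_inner_left)

lemma real_polynomial_function_dir_deriv:
  fixes p :: "'a :: euclidean_space \<Rightarrow> real"
  assumes "real_polynomial_function p"
  shows "real_polynomial_function (dir_deriv h p)"
  using assms
proof induction
  case (linear f)
  then show ?case by (simp add: dir_deriv_bounded_linear real_polynomial_function.intros(2))
next
  case (const c)
  then show ?case by (simp add: real_polynomial_function.intros(2))
next
  case (add f g)
  then show ?case by (simp add: dir_deriv_add real_polynomial_function.intros(3))
next
  case (mult f g)
  then show ?case by (simp add: dir_deriv_mult real_polynomial_function.intros(3) real_polynomial_function.intros(4))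
qed

lemma dir_deriv_sum:
  fixes p :: "'i \<Rightarrow> 'a :: euclidean_space \<Rightarrow> real"
  assumes "finite I" "\<And>i. i \<in> I \<Longrightarrow> real_polynomial_function (p i)"
  shows "dir_deriv h (\<lambda>x. \<Sum>i\<in>I. p i x) = (\<lambda>x. \<Sum>i\<in>I. dir_deriv h (p i) x)"
  using assms
proof (induction I rule: finite_induct)
  case (insert i I)
  then have "real_polynomial_function (\<lambda>x. \<Sum>i\<in>I. p i x)"
    by (intro real_polynomial_function_sum) auto
  with insert show ?case by (simp add: dir_deriv_add)
qed simp

lemma dir_deriv_commute:
  fixes p :: "'a :: euclidean_space \<Rightarrow> real"
  assumes "real_polynomial_function p"
  shows "dir_deriv b (dir_deriv c p) = dir_deriv c (dir_deriv b p)"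
  using assms
proof induction
  case (linear f)
  then show ?case by (simp add: dir_deriv_bounded_linear)
next
  case (add f g)
  then show ?case by (simp add: dir_deriv_add real_polynomial_function_dir_deriv)
next
  case (mult f g)
  then show ?case
    by (simp add: dir_deriv_mult dir_deriv_add real_polynomial_function_dir_deriv real_polynomial_function.intros(4) algebra_simps)
qed simp

lemma dir_deriv_scaleR:
  fixes p :: "'a :: euclidean_space \<Rightarrow> real"
  assumes "real_polynomial_function p"
  shows "dir_deriv (c *\<^sub>R h) p x = c * dir_deriv h p x"
  using linear_scale[OF has_derivative_linear[OF has_derivative_dir_deriv[OF assms, of x]], of c h] by simp

lemma dir_deriv_sum_direction:
  fixes p :: "'a :: euclidean_space \<Rightarrow> real"
  assumes "real_polynomial_function p"
  shows "dir_deriv (\<Sum>b\<in>B. a b *\<^sub>R b) p x = (\<Sum>b\<in>B. a b * dir_deriv b p x)"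
  using linear_sum[OF has_derivative_linear[OF has_derivative_dir_deriv[OF assms, of x]], of "\<lambda>b. a b *\<^sub>R b" B]
  by (simp add: dir_deriv_scaleR[OF assms])

lemma laplacian_eq_dir_deriv:
  fixes p :: "'a :: euclidean_space \<Rightarrow> real"
  assumes "real_polynomial_function p"
  shows "laplacian p x = (\<Sum>b\<in>Basis. dir_deriv b (dir_deriv b p) x)"
proof -
  have "deriv (\<lambda>t. p (x + t *\<^sub>R b)) = (\<lambda>t. dir_deriv b p (x + t *\<^sub>R b))" for b
  proof
    fix s
    have "((\<lambda>t. x + t *\<^sub>R b) has_derivative (\<lambda>r. r *\<^sub>R b)) (at s)"
      by (auto intro!: derivative_eq_intros)
    from has_derivative_compose[OF this has_derivative_dir_deriv[OF assms]]
    have "((\<lambda>t. p (x + t *\<^sub>R b)) has_real_derivative dir_deriv b p (x + s *\<^sub>R b)) (at s)"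
      by (simp add: has_field_derivative_def dir_deriv_scaleR[OF assms] mult_commute_abs)
    then show "deriv (\<lambda>t. p (x + t *\<^sub>R b)) s = dir_deriv b p (x + s *\<^sub>R b)"
      by (rule DERIV_imp_deriv)
  qed
  then show ?thesis
    by (simp add: laplacian_def numeral_2_eq_2 dir_deriv_def[of _ "dir_deriv _ p"])
qed

text \<open>
  Both sides are the trace of the Hessian: expand each \<open>b\<close> in the standard basis and use Parseval's
  identity.
\<close>

lemma laplacian_orthonormal_basis:
  fixes p :: "'a :: euclidean_space \<Rightarrow> real"
  assumes p: "real_polynomial_function p"
    and B: "finite B" "pairwise orthogonal B" "\<And>b. b \<in> B \<Longrightarrow> norm b = 1" "span B = UNIV"
  shows "laplacian p x = (\<Sum>b\<in>B. dir_deriv b (dir_deriv b p) x)"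
proof -
  let ?H = "\<lambda>e e'. dir_deriv e (dir_deriv e' p) x"
  note pp = real_polynomial_function_dir_deriv[OF p]
  have "dir_deriv b (dir_deriv b p) x = (\<Sum>e\<in>Basis. \<Sum>e'\<in>Basis. (b \<bullet> e) * (b \<bullet> e') * ?H e' e)" for b
  proof -
    have "dir_deriv b (dir_deriv b p) x = dir_deriv (\<Sum>e\<in>Basis. (b \<bullet> e) *\<^sub>R e) (dir_deriv b p) x"
      by (simp add: euclidean_representation)
    also have "\<dots> = (\<Sum>e\<in>Basis. (b \<bullet> e) * dir_deriv e (dir_deriv b p) x)"
      by (rule dir_deriv_sum_direction[OF pp])
    also have "\<dots> = (\<Sum>e\<in>Basis. (b \<bullet> e) * dir_deriv (\<Sum>e'\<in>Basis. (b \<bullet> e') *\<^sub>R e') (dir_deriv e p) x)"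
      by (simp add: euclidean_representation dir_deriv_commute[OF p, of _ b])
    also have "\<dots> = (\<Sum>e\<in>Basis. (b \<bullet> e) * (\<Sum>e'\<in>Basis. (b \<bullet> e') * ?H e' e))"
      by (simp only: dir_deriv_sum_direction[OF pp])
    finally show ?thesis by (simp add: sum_distrib_left mult.assoc)
  qed
  then have "(\<Sum>b\<in>B. dir_deriv b (dir_deriv b p) x) =
      (\<Sum>b\<in>B. \<Sum>e\<in>Basis. \<Sum>e'\<in>Basis. (b \<bullet> e) * (b \<bullet> e') * ?H e' e)"
    by simp
  also have "\<dots> = (\<Sum>e\<in>Basis. \<Sum>b\<in>B. \<Sum>e'\<in>Basis. (b \<bullet> e) * (b \<bullet> e') * ?H e' e)"
    by (rule sum.swap)
  also have "\<dots> = (\<Sum>e\<in>Basis. \<Sum>e'\<in>Basis. \<Sum>b\<in>B. (b \<bullet> e) * (b \<bullet> e') * ?H e' e)"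
    by (intro sum.cong refl sum.swap)
  also have "\<dots> = (\<Sum>e\<in>Basis. \<Sum>e'\<in>Basis. (e \<bullet> e') * ?H e' e)"
  proof (intro sum.cong refl)
    fix e e' :: 'a
    have "e \<bullet> e' = (\<Sum>b\<in>B. (e \<bullet> b) *\<^sub>R b) \<bullet> e'"
      using orthonormal_basis_expand[OF B(2,3) _ B(1), of e] B(4) by simp
    also have "\<dots> = (\<Sum>b\<in>B. (b \<bullet> e) * (b \<bullet> e'))"
      by (simp add: inner_sum_left) (simp add: inner_commute)
    finally show "(\<Sum>b\<in>B. (b \<bullet> e) * (b \<bullet> e') * ?H e' e) = (e \<bullet> e') * ?H e' e"
      by (simp add: sum_distrib_right)
  qed
  also have "\<dots> = (\<Sum>e\<in>Basis. \<Sum>e'\<in>Basis. if e = e' then ?H e' e else 0)"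
    by (intro sum.cong refl) (simp add: inner_Basis)
  also have "\<dots> = laplacian p x"
    by (simp add: laplacian_eq_dir_deriv[OF p])
  finally show ?thesis ..
qed

text \<open>
  Homogeneity for a single scalar \<open>c\<close>, with \<open>a\<close> in place of \<open>c ^ k\<close>, so that differentiating twice does
  not run into negative exponents.
\<close>

lemma dir_deriv_homogeneous:
  fixes p :: "'a :: euclidean_space \<Rightarrow> real"
  assumes p: "real_polynomial_function p" and c: "c \<noteq> 0" and hom: "\<And>x. p (c *\<^sub>R x) = a * p x"
  shows "dir_deriv h p (c *\<^sub>R x) = a / c * dir_deriv h p x"
proof -
  have "((\<lambda>x. c *\<^sub>R x) has_derivative (\<lambda>h. c *\<^sub>R h)) (at x)"
    by (auto intro!: derivative_eq_intros)
  from has_derivative_compose[OF this has_derivative_dir_deriv[OF p]]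
  have "((\<lambda>x. a * p x) has_derivative (\<lambda>h. dir_deriv (c *\<^sub>R h) p (c *\<^sub>R x))) (at x)"
    by (simp add: hom)
  moreover have "((\<lambda>x. a * p x) has_derivative (\<lambda>h. a * dir_deriv h p x)) (at x)"
    by (intro has_derivative_mult_right has_derivative_dir_deriv p)
  ultimately have "dir_deriv (c *\<^sub>R h) p (c *\<^sub>R x) = a * dir_deriv h p x"
    by (rule fun_cong[OF has_derivative_unique])
  then show ?thesis using c by (simp add: dir_deriv_scaleR[OF p] field_simps)
qed

lemma euler_homogeneous:
  fixes p :: "'a :: euclidean_space \<Rightarrow> real"
  assumes hom: "\<And>c x. c \<noteq> 0 \<Longrightarrow> p (c *\<^sub>R x) = c ^ k * p x"
  shows "dir_deriv x p x = real k * p x"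
proof -
  have "((\<lambda>t. (1 + t) ^ k * p x) has_real_derivative real k * p x) (at 0)"
    by (auto intro!: derivative_eq_intros)
  moreover have ev: "eventually (\<lambda>t. (1 + t) ^ k * p x = p (x + t *\<^sub>R x)) (nhds 0)"
  proof -
    have "eventually (\<lambda>t. t \<in> {-1 :: real<..}) (nhds 0)" by (intro eventually_nhds_in_open) auto
    then show ?thesis
    proof eventually_elim
      case (elim t)
      then show ?case using hom[of "1 + t" x] by (simp add: algebra_simps)
    qed
  qed
  ultimately have "((\<lambda>t. p (x + t *\<^sub>R x)) has_real_derivative real k * p x) (at 0)"
    using DERIV_cong_ev[OF refl ev refl] by blast
  then show ?thesis unfolding dir_deriv_def by (rule DERIV_imp_deriv)
qed

lemma euler_homogeneous_second:
  fixes p :: "'a :: euclidean_space \<Rightarrow> real"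
  assumes p: "real_polynomial_function p" and hom: "\<And>c x. c \<noteq> 0 \<Longrightarrow> p (c *\<^sub>R x) = c ^ k * p x"
  shows "dir_deriv x (dir_deriv x p) x = real k * (real k - 1) * p x"
proof -
  have "((\<lambda>t. (1 + t) ^ k / (1 + t) * (real k * p x)) has_real_derivative real k * (real k - 1) * p x) (at 0)"
    by (auto intro!: derivative_eq_intros simp: field_simps)
  moreover have ev: "eventually (\<lambda>t. (1 + t) ^ k / (1 + t) * (real k * p x) = dir_deriv x p (x + t *\<^sub>R x)) (nhds 0)"
  proof -
    have "eventually (\<lambda>t. t \<in> {-1 :: real<..}) (nhds 0)" by (intro eventually_nhds_in_open) auto
    then show ?thesis
    proof eventually_elim
      case (elim t)
      then have t: "1 + t \<noteq> 0" by auto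
      show ?case
        using dir_deriv_homogeneous[OF p t hom[OF t], of x x] euler_homogeneous[of p k x, OF hom]
        by (simp add: algebra_simps)
    qed
  qed
  ultimately have "((\<lambda>t. dir_deriv x p (x + t *\<^sub>R x)) has_real_derivative real k * (real k - 1) * p x) (at 0)"
    using DERIV_cong_ev[OF refl ev refl] by blast
  then show ?thesis unfolding dir_deriv_def[of x "dir_deriv x p"] by (rule DERIV_imp_deriv)
qed


section \<open>Infinitesimal rotations\<close>

text \<open>
  The rotation by \<open>2 arctan t\<close> in the oriented plane of \<open>b\<close> and \<open>c\<close>, in its rational
  parametrization: the coefficients are \<open>sin\<close> and \<open>1 - cos\<close> of this angle.
\<close>

definition plane_rotation :: "'a :: euclidean_space \<Rightarrow> 'a \<Rightarrow> real \<Rightarrow> 'a \<Rightarrow> 'a" where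
  "plane_rotation b c t x = x
     + (2 * t / (1 + t\<^sup>2)) *\<^sub>R ((x \<bullet> b) *\<^sub>R c - (x \<bullet> c) *\<^sub>R b)
     - (2 * t\<^sup>2 / (1 + t\<^sup>2)) *\<^sub>R ((x \<bullet> b) *\<^sub>R b + (x \<bullet> c) *\<^sub>R c)"

lemma orthogonal_transformation_plane_rotation:
  assumes b: "norm b = 1" and c: "norm c = 1" and bc: "b \<bullet> c = 0"
  shows "orthogonal_transformation (plane_rotation b c t)"
  unfolding orthogonal_transformation_def
proof (intro conjI allI)
  show "linear (plane_rotation b c t)"
    by (rule linearI) (simp_all add: plane_rotation_def inner_add_left algebra_simps)
  fix x y
  have bb: "b \<bullet> b = 1" "c \<bullet> c = 1" "c \<bullet> b = 0" using b c bc by (simp_all add: norm_eq_1 inner_commute)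
  define s r where "s = 2 * t / (1 + t\<^sup>2)" and "r = 2 * t\<^sup>2 / (1 + t\<^sup>2)"
  have "1 + t\<^sup>2 > 0" by (simp add: add_pos_nonneg)
  \<comment> \<open>\<open>sin\<^sup>2 + (1 - cos)\<^sup>2 = 2 (1 - cos)\<close>\<close>
  then have sr: "s\<^sup>2 + r\<^sup>2 = 2 * r"
    by (simp add: s_def r_def power2_eq_square divide_simps) (simp add: algebra_simps)
  have "plane_rotation b c t x \<bullet> plane_rotation b c t y =
      x \<bullet> y + (s\<^sup>2 + r\<^sup>2 - 2 * r) * ((x \<bullet> b) * (y \<bullet> b) + (x \<bullet> c) * (y \<bullet> c))"
    unfolding plane_rotation_def s_def[symmetric] r_def[symmetric]
    by (simp add: inner_add_left inner_add_right inner_diff_left inner_diff_right bb bc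
        inner_commute[of b y] inner_commute[of c y] power2_eq_square) (simp add: algebra_simps)
  then show "plane_rotation b c t x \<bullet> plane_rotation b c t y = x \<bullet> y" using sr by simp
qed

lemma plane_rotation_fixes: "u \<bullet> b = 0 \<Longrightarrow> u \<bullet> c = 0 \<Longrightarrow> plane_rotation b c t u = u"
  by (simp add: plane_rotation_def)

lemma norm_plane_rotation_minus_le:
  assumes b: "norm b = 1" and c: "norm c = 1" and x: "norm x \<le> 1" and t: "\<bar>t\<bar> \<le> 1"
  shows "norm (plane_rotation b c t x - x) \<le> 8 * \<bar>t\<bar>"
proof -
  have xb: "\<bar>x \<bullet> b\<bar> \<le> 1" and xc: "\<bar>x \<bullet> c\<bar> \<le> 1"
    using Cauchy_Schwarz_ineq2[of x b] Cauchy_Schwarz_ineq2[of x c] b c x by simp_all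
  have 1: "norm ((x \<bullet> b) *\<^sub>R c - (x \<bullet> c) *\<^sub>R b) \<le> 2"
    using norm_triangle_ineq4[of "(x \<bullet> b) *\<^sub>R c" "(x \<bullet> c) *\<^sub>R b"] xb xc b c by simp
  have 2: "norm ((x \<bullet> b) *\<^sub>R b + (x \<bullet> c) *\<^sub>R c) \<le> 2"
    using norm_triangle_ineq[of "(x \<bullet> b) *\<^sub>R b" "(x \<bullet> c) *\<^sub>R c"] xb xc b c by simp
  have den: "1 + t\<^sup>2 \<ge> 1" by simp
  then have den0: "0 < 1 + t\<^sup>2" by linarith
  have 3: "\<bar>2 * t / (1 + t\<^sup>2)\<bar> \<le> 2 * \<bar>t\<bar>"
    using den mult_left_mono[OF den, of "2 * \<bar>t\<bar>"] by (simp add: abs_divide pos_divide_le_eq[OF den0] abs_mult)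
  have "t\<^sup>2 \<le> \<bar>t\<bar>" using t mult_left_mono[OF t, of "\<bar>t\<bar>"] by (simp add: power2_eq_square abs_mult[symmetric])
  then have 4: "\<bar>2 * t\<^sup>2 / (1 + t\<^sup>2)\<bar> \<le> 2 * \<bar>t\<bar>"
    using den mult_left_mono[OF den, of "2 * \<bar>t\<bar>"] by (simp add: abs_divide pos_divide_le_eq[OF den0])
  have "norm (plane_rotation b c t x - x) \<le>
      \<bar>2 * t / (1 + t\<^sup>2)\<bar> * norm ((x \<bullet> b) *\<^sub>R c - (x \<bullet> c) *\<^sub>R b)
      + \<bar>2 * t\<^sup>2 / (1 + t\<^sup>2)\<bar> * norm ((x \<bullet> b) *\<^sub>R b + (x \<bullet> c) *\<^sub>R c)"
    unfolding plane_rotation_def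
    using norm_triangle_ineq4[of "(2 * t / (1 + t\<^sup>2)) *\<^sub>R ((x \<bullet> b) *\<^sub>R c - (x \<bullet> c) *\<^sub>R b)"
        "(2 * t\<^sup>2 / (1 + t\<^sup>2)) *\<^sub>R ((x \<bullet> b) *\<^sub>R b + (x \<bullet> c) *\<^sub>R c)"]
    unfolding norm_scaleR by (simp only: add_diff_cancel_left' add_diff_eq[symmetric])
  also have "\<dots> \<le> (2 * \<bar>t\<bar>) * 2 + (2 * \<bar>t\<bar>) * 2"
    by (intro add_mono mult_mono 1 2 3 4) auto
  finally show ?thesis by simp
qed

lemma has_derivative_plane_rotation:
  fixes p :: "'a :: euclidean_space \<Rightarrow> real"
  assumes p: "real_polynomial_function p"
  shows "((\<lambda>t. p (plane_rotation b c t x)) has_real_derivative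
    2 * ((x \<bullet> b) * dir_deriv c p x - (x \<bullet> c) * dir_deriv b p x)) (at 0)"
proof -
  define z where "z = (x \<bullet> b) *\<^sub>R c - (x \<bullet> c) *\<^sub>R b"
  define y where "y = (x \<bullet> b) *\<^sub>R b + (x \<bullet> c) *\<^sub>R c"
  have d1: "((\<lambda>t. 2 * t / (1 + t\<^sup>2)) has_real_derivative 2) (at 0)"
    and d2: "((\<lambda>t. 2 * t\<^sup>2 / (1 + t\<^sup>2)) has_real_derivative 0) (at 0)"
    by (auto intro!: derivative_eq_intros)
  have "((\<lambda>t. x + (2 * t / (1 + t\<^sup>2)) *\<^sub>R z - (2 * t\<^sup>2 / (1 + t\<^sup>2)) *\<^sub>R y) has_derivative
      (\<lambda>s. 0 + (2 * s) *\<^sub>R z - (0 * s) *\<^sub>R y)) (at (0 :: real))"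
    using d1 d2 unfolding has_field_derivative_def
    by (intro has_derivative_diff has_derivative_add has_derivative_const has_derivative_scaleR_left)
  then have "((\<lambda>t. plane_rotation b c t x) has_derivative (\<lambda>s. s *\<^sub>R (2 *\<^sub>R z))) (at 0)"
    by (simp add: plane_rotation_def z_def y_def mult.commute)
  moreover have "plane_rotation b c 0 x = x" by (simp add: plane_rotation_def)
  ultimately have "((\<lambda>t. p (plane_rotation b c t x)) has_derivative (\<lambda>s. dir_deriv (s *\<^sub>R (2 *\<^sub>R z)) p x)) (at 0)"
    using has_derivative_compose[of "\<lambda>t. plane_rotation b c t x" _ 0 UNIV p] has_derivative_dir_deriv[OF p, of x] by auto
  then have "((\<lambda>t. p (plane_rotation b c t x)) has_real_derivative dir_deriv (2 *\<^sub>R z) p x) (at 0)"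
    by (simp add: has_field_derivative_def dir_deriv_scaleR[OF p] mult_commute_abs del: scaleR_scaleR)
  moreover have "dir_deriv z p x = (x \<bullet> b) * dir_deriv c p x - (x \<bullet> c) * dir_deriv b p x"
    using linear_diff[OF has_derivative_linear[OF has_derivative_dir_deriv[OF p, of x]], of "(x \<bullet> b) *\<^sub>R c" "(x \<bullet> c) *\<^sub>R b"]
    by (simp add: z_def dir_deriv_scaleR[OF p])
  ultimately show ?thesis by (simp add: dir_deriv_scaleR[OF p])
qed

text \<open>
  The bound on \<open>p\<close> itself is carried along because products need it.
\<close>

lemma real_polynomial_function_Lipschitz:
  fixes p :: "'a :: euclidean_space \<Rightarrow> real"
  assumes "real_polynomial_function p"
  shows "\<exists>K. \<forall>x y. norm x \<le> 1 \<longrightarrow> norm y \<le> 1 \<longrightarrow> \<bar>p x\<bar> \<le> K \<and> \<bar>p x - p y\<bar> \<le> K * norm (x - y)"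
  using assms
proof induction
  case (linear f)
  then obtain K where K: "K > 0" "\<And>x. \<bar>f x\<bar> \<le> norm x * K" using bounded_linear.pos_bounded[OF linear] by auto
  have "\<bar>f x\<bar> \<le> K \<and> \<bar>f x - f y\<bar> \<le> K * norm (x - y)" if "norm x \<le> 1" "norm y \<le> 1" for x y
  proof
    have "norm x * K \<le> 1 * K" using that K(1) by (intro mult_right_mono) auto
    then show "\<bar>f x\<bar> \<le> K" using K(2)[of x] by simp
    show "\<bar>f x - f y\<bar> \<le> K * norm (x - y)"
      using K(2)[of "x - y"] linear by (simp add: linear_simps mult.commute)
  qed
  then show ?case by blast
next
  case (const c)
  then show ?case by (intro exI[of _ "\<bar>c\<bar>"]) simp
next
  case (add f g)
  then obtain K L where
    K: "\<And>x y. norm x \<le> 1 \<Longrightarrow> norm y \<le> 1 \<Longrightarrow> \<bar>f x\<bar> \<le> K \<and> \<bar>f x - f y\<bar> \<le> K * norm (x - y)" and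
    L: "\<And>x y. norm x \<le> 1 \<Longrightarrow> norm y \<le> 1 \<Longrightarrow> \<bar>g x\<bar> \<le> L \<and> \<bar>g x - g y\<bar> \<le> L * norm (x - y)" by blast
  have "\<bar>f x + g x\<bar> \<le> K + L \<and> \<bar>f x + g x - (f y + g y)\<bar> \<le> (K + L) * norm (x - y)"
    if "norm x \<le> 1" "norm y \<le> 1" for x y
    unfolding distrib_right using K[OF that] L[OF that] by linarith
  then show ?case by blast
next
  case (mult f g)
  then obtain K L where
    K: "\<And>x y. norm x \<le> 1 \<Longrightarrow> norm y \<le> 1 \<Longrightarrow> \<bar>f x\<bar> \<le> K \<and> \<bar>f x - f y\<bar> \<le> K * norm (x - y)" and
    L: "\<And>x y. norm x \<le> 1 \<Longrightarrow> norm y \<le> 1 \<Longrightarrow> \<bar>g x\<bar> \<le> L \<and> \<bar>g x - g y\<bar> \<le> L * norm (x - y)" by blast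
  have K0: "K \<ge> 0" and L0: "L \<ge> 0" using K[of 0 0] L[of 0 0] by auto
  have "\<bar>f x * g x\<bar> \<le> 2 * (K * L) \<and> \<bar>f x * g x - f y * g y\<bar> \<le> 2 * (K * L) * norm (x - y)"
    if xy: "norm x \<le> 1" "norm y \<le> 1" for x y
  proof
    have "\<bar>f x * g x\<bar> \<le> K * L" unfolding abs_mult using K[OF xy] L[OF xy] K0 by (intro mult_mono) auto
    then show "\<bar>f x * g x\<bar> \<le> 2 * (K * L)" using mult_nonneg_nonneg[OF K0 L0] by linarith
    have "f x * g x - f y * g y = f x * (g x - g y) + (f x - f y) * g y" by (simp add: algebra_simps)
    also have "\<bar>\<dots>\<bar> \<le> \<bar>f x\<bar> * \<bar>g x - g y\<bar> + \<bar>f x - f y\<bar> * \<bar>g y\<bar>"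
      by (rule order_trans[OF abs_triangle_ineq]) (simp add: abs_mult)
    also have "\<dots> \<le> K * (L * norm (x - y)) + (K * norm (x - y)) * L"
      using K[OF xy] L[OF xy] L[OF xy(2,1)] K0 L0 by (intro add_mono mult_mono) auto
    finally show "\<bar>f x * g x - f y * g y\<bar> \<le> 2 * (K * L) * norm (x - y)" by (simp add: algebra_simps)
  qed
  then show ?case by blast
qed

lemma continuous_on_polynomial_point:
  fixes p :: "'a :: euclidean_space \<Rightarrow> real"
  assumes "real_polynomial_function p"
  shows "continuous_on UNIV (\<lambda>v. p (point v))"
proof -
  have "continuous_on UNIV p"
    using assms by (simp add: continuous_on_polymonial_function real_polynomial_function_eq)
  then show ?thesis by (rule continuous_on_compose2[OF _ continuous_on_point]) simp
qed

text \<open>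
  Rotations in the plane of \<open>b\<close> and \<open>c\<close> fix the pole and therefore do not change the average of \<open>p\<close>.
  The derivative of the rotated polynomial at angle \<open>0\<close> thus has average \<open>0\<close>; the Lipschitz bound
  justifies differentiating under the integral.
\<close>

lemma funk_infinitesimal_rotation:
  fixes p :: "'a :: euclidean_space \<Rightarrow> real"
  assumes p: "real_polynomial_function p"
    and b: "norm b = 1" "b \<bullet> point u = 0" and c: "norm c = 1" "c \<bullet> point u = 0" and bc: "b \<bullet> c = 0"
  shows "funk (\<lambda>v. (point v \<bullet> b) * dir_deriv c p (point v) - (point v \<bullet> c) * dir_deriv b p (point v)) u = 0"
proof -
  interpret finite_measure "subsphere_measure u" by (rule finite_subsphere_measure)
  define T where "T k = plane_rotation b c (1 / real (Suc k))" for k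
  have T: "orthogonal_transformation (T k)" for k
    unfolding T_def by (rule orthogonal_transformation_plane_rotation[OF b(1) c(1) bc])
  have fix_u: "rot (T k) u = u" for k
    unfolding point_inject[symmetric] point_rot[OF T]
    using b c by (simp add: T_def plane_rotation_fixes inner_commute)
  define g where "g v = 2 * ((point v \<bullet> b) * dir_deriv c p (point v) - (point v \<bullet> c) * dir_deriv b p (point v))" for v
  \<comment> \<open>difference quotients at \<open>t = 1 / (k + 1)\<close>, and twice the desired integrand as their limit\<close>
  define s where "s k v = real (Suc k) * (p (point (rot (T k) v)) - p (point v))" for k v
  obtain K where K: "\<And>x y. norm x \<le> 1 \<Longrightarrow> norm y \<le> 1 \<Longrightarrow> \<bar>p x - p y\<bar> \<le> K * norm (x - y)"
    using real_polynomial_function_Lipschitz[OF p] by blast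
  have cp: "continuous_on UNIV (\<lambda>v. p (point v))" by (rule continuous_on_polynomial_point[OF p])
  have mp [measurable]: "(\<lambda>v. p (point v)) \<in> borel_measurable borel" by (rule borel_measurable_continuous_onI[OF cp])
  have mT [measurable]: "rot (T k) \<in> borel_measurable borel" for k by (rule borel_measurable_rot[OF T])
  have mpT [measurable]: "(\<lambda>v. p (point (rot (T k) v))) \<in> borel_measurable borel" for k
    by (rule measurable_compose[OF mT mp])
  have ip: "integrable (subsphere_measure u) (\<lambda>v. p (point v))"
    by (rule integrable_subsphere_measure_continuous[OF cp])
  have ipT: "integrable (subsphere_measure u) (\<lambda>v. p (point (rot (T k) v)))" for k
    by (rule integrable_subsphere_measure_continuous)
       (rule continuous_on_compose2[OF cp continuous_on_rot[OF T]], simp)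
  have s0: "(\<integral>v. s k v \<partial>subsphere_measure u) = 0" for k
  proof -
    have "(\<integral>v. p (point v) \<partial>subsphere_measure u) = (\<integral>v. p (point v) \<partial>(distr (subsphere_measure u) borel (rot (T k))))"
      unfolding distr_subsphere_measure_rot[OF T] fix_u ..
    also have "\<dots> = (\<integral>v. p (point (rot (T k) v)) \<partial>subsphere_measure u)"
      by (rule integral_distr) simp_all
    finally show ?thesis unfolding s_def using ip ipT by simp
  qed
  have lim: "(\<lambda>k. s k v) \<longlonglongrightarrow> g v" for v
  proof -
    have "((\<lambda>t. p (plane_rotation b c t (point v))) has_real_derivative g v) (at 0)"
      unfolding g_def by (rule has_derivative_plane_rotation[OF p])
    then have "((\<lambda>t. (p (plane_rotation b c t (point v)) - p (plane_rotation b c 0 (point v))) / t) \<longlongrightarrow> g v) (at 0)"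
      by (simp add: DERIV_def)
    moreover have "filterlim (\<lambda>k. 1 / real (Suc k)) (at 0) sequentially"
      unfolding filterlim_at using LIMSEQ_inverse_real_of_nat by (simp add: inverse_eq_divide)
    ultimately have "(\<lambda>k. (p (plane_rotation b c (1 / real (Suc k)) (point v)) - p (plane_rotation b c 0 (point v))) / (1 / real (Suc k))) \<longlonglongrightarrow> g v"
      by (rule filterlim_compose)
    moreover have "plane_rotation b c 0 (point v) = point v" by (simp add: plane_rotation_def)
    ultimately show ?thesis unfolding s_def point_rot[OF T] unfolding T_def by (simp add: mult.commute)
  qed
  have bound: "\<bar>s k v\<bar> \<le> \<bar>K\<bar> * 8" for k v
  proof -
    let ?t = "1 / real (Suc k)"
    have "\<bar>p (T k (point v)) - p (point v)\<bar> \<le> K * norm (T k (point v) - point v)"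
      by (rule K) (simp_all add: orthogonal_transformation_norm[OF T])
    also have "\<dots> \<le> \<bar>K\<bar> * norm (T k (point v) - point v)" by (intro mult_right_mono) auto
    also have "\<dots> \<le> \<bar>K\<bar> * (8 * \<bar>?t\<bar>)"
      unfolding T_def by (intro mult_left_mono norm_plane_rotation_minus_le b c) (simp_all add: divide_le_eq)
    finally have "real (Suc k) * \<bar>p (T k (point v)) - p (point v)\<bar> \<le> real (Suc k) * (\<bar>K\<bar> * (8 * \<bar>?t\<bar>))"
      by (rule mult_left_mono) simp
    also have "\<dots> = \<bar>K\<bar> * 8" by simp
    finally show ?thesis by (simp add: s_def abs_mult point_rot[OF T])
  qed
  have ms: "s k \<in> borel_measurable borel" for k unfolding s_def by measurable
  have mg: "g \<in> borel_measurable borel"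
    by (rule borel_measurable_LIMSEQ_real[OF lim ms])
  have "(\<lambda>k. \<integral>v. s k v \<partial>subsphere_measure u) \<longlonglongrightarrow> (\<integral>v. g v \<partial>subsphere_measure u)"
    by (rule integral_dominated_convergence[where w = "\<lambda>_. \<bar>K\<bar> * 8"]) (use ms mg lim bound in auto)
  then have "(\<integral>v. g v \<partial>subsphere_measure u) = 0" by (simp add: s0 LIMSEQ_const_iff)
  then have "funk g u = 0" by (simp add: funk_eq_integral[OF mg])
  moreover have "funk g u = 2 * funk (\<lambda>v. g v / 2) u"
    using funk_cmult[of "\<lambda>v. g v / 2" 2 u] mg by simp
  moreover have "(\<lambda>v. g v / 2) = (\<lambda>v. (point v \<bullet> b) * dir_deriv c p (point v) - (point v \<bullet> c) * dir_deriv b p (point v))"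
    by (rule ext) (simp add: g_def diff_divide_distrib)
  ultimately show ?thesis by simp
qed


section \<open>Great subsphere averages of harmonic polynomials\<close>

lemma funk_sum:
  assumes "finite I" "\<And>i. i \<in> I \<Longrightarrow> continuous_on UNIV (f i)"
  shows "funk (\<lambda>v. \<Sum>i\<in>I. f i v) u = (\<Sum>i\<in>I. funk (f i) u)"
  using assms
proof (induction I rule: finite_induct)
  case (insert i I)
  then have "continuous_on UNIV (\<lambda>v. \<Sum>i\<in>I. f i v)" by (intro continuous_on_sum) auto
  with insert show ?case by (simp add: funk_add)
qed (simp add: funk_def)

lemma real_polynomial_function_inner: "real_polynomial_function (\<lambda>x. x \<bullet> b)"
  by (rule real_polynomial_function.intros(1)) (rule bounded_linear_inner_left)

text \<open>
  With \<open>\<Lambda>\<close> the infinitesimal rotation in the plane of \<open>b\<close> and \<open>c\<close> applied to \<open>x\<^sub>b \<partial>\<^sub>c p\<close>, the product rule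
  gives \<open>(b \<bullet> c) x\<^sub>b \<partial>\<^sub>c p + x\<^sub>b\<^sup>2 \<partial>\<^sub>c\<^sup>2 p - x\<^sub>c \<partial>\<^sub>c p - x\<^sub>b x\<^sub>c \<partial>\<^sub>b \<partial>\<^sub>c p\<close>.  Summed over an orthonormal
  basis \<open>H\<close> of the \<open>n - 1\<close> dimensional hyperplane at a unit vector, the four parts become \<open>k p\<close>, the Laplacian
  in the hyperplane, \<open>(n - 1) k p\<close> and \<open>k (k - 1) p\<close> by Euler's relations.  The left-hand sum has
  average \<open>0\<close>, also for \<open>b = c\<close>, when \<open>\<Lambda>\<close> vanishes.
\<close>

lemma funk_second_derivative_along_pole:
  fixes p :: "'a :: euclidean_space \<Rightarrow> real"
  assumes n: "2 \<le> DIM('a)" and p: "real_polynomial_function p"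
    and hom: "\<And>c x. c \<noteq> 0 \<Longrightarrow> p (c *\<^sub>R x) = c ^ k * p x"
    and harm: "\<And>x. laplacian p x = 0"
  shows "funk (\<lambda>v. dir_deriv (point u) (dir_deriv (point u) p) (point v)) u
    = - (real k * (real k + real DIM('a) - 3)) * funk (\<lambda>v. p (point v)) u"
proof -
  let ?u = "point u"
  obtain B where uB: "?u \<in> B" and B: "pairwise orthogonal B" "\<And>x. x \<in> B \<Longrightarrow> norm x = 1"
    and iB: "independent B" and cB: "card B = DIM('a)" and sB: "span B = UNIV"
    using vector_in_orthonormal_basis[of ?u] by auto
  have fB: "finite B" using cB by (metis DIM_positive card.infinite less_irrefl)
  define H where "H = B - {?u}"
  have fH: "finite H" using fB by (simp add: H_def)
  have cH: "real (card H) = real DIM('a) - 1"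
    using uB cB fB n by (simp add: H_def card_Diff_singleton)
  have Hb: "norm b = 1" "b \<bullet> ?u = 0" if "b \<in> H" for b
    using that B uB by (auto simp: H_def pairwise_def orthogonal_def)
  have bc: "b \<bullet> c = (if b = c then 1 else 0)" if "b \<in> H" "c \<in> H" for b c
    using that B by (auto simp: H_def pairwise_def orthogonal_def norm_eq_1)
  note dp = real_polynomial_function_dir_deriv[OF p]
  note ddp = real_polynomial_function_dir_deriv[OF dp]
  define \<Lambda> where "\<Lambda> b c x = (x \<bullet> b) * dir_deriv c (\<lambda>y. (y \<bullet> b) * dir_deriv c p y) x
     - (x \<bullet> c) * dir_deriv b (\<lambda>y. (y \<bullet> b) * dir_deriv c p y) x" for b c x
  have pol: "real_polynomial_function (\<lambda>y. (y \<bullet> b) * dir_deriv c p y)" for b c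
    by (intro real_polynomial_function.intros(4) real_polynomial_function_inner dp)
  have pol\<Lambda>: "real_polynomial_function (\<Lambda> b c)" for b c
    unfolding \<Lambda>_def
    by (intro real_polynomial_function_diff real_polynomial_function.intros(4)
        real_polynomial_function_inner real_polynomial_function_dir_deriv pol)
  have zero: "funk (\<lambda>v. \<Lambda> b c (point v)) u = 0" if "b \<in> H" "c \<in> H" for b c
  proof (cases "b = c")
    case True
    then show ?thesis by (simp add: \<Lambda>_def funk_def)
  next
    case False
    then show ?thesis
      unfolding \<Lambda>_def using that bc[OF that]
      by (intro funk_infinitesimal_rotation pol Hb) simp_all
  qed
  have \<Lambda>: "\<Lambda> b c x = (x \<bullet> b) * ((b \<bullet> c) * dir_deriv c p x) + (x \<bullet> b) * (x \<bullet> b) * dir_deriv c (dir_deriv c p) x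
      - (x \<bullet> c) * dir_deriv c p x - (x \<bullet> c) * ((x \<bullet> b) * dir_deriv b (dir_deriv c p) x)"
    if "b \<in> H" "c \<in> H" for b c x
    unfolding \<Lambda>_def using bc[OF that(1,1)]
    by (simp add: dir_deriv_mult[OF real_polynomial_function_inner dp] dir_deriv_inner inner_commute[of c b] algebra_simps)
  define D where "D x = dir_deriv ?u (dir_deriv ?u p) x" for x
  have sum: "(\<Sum>b\<in>H. \<Sum>c\<in>H. \<Lambda> b c (point v)) = - D (point v) + - (real k * (real k + real DIM('a) - 3)) * p (point v)"
    if v: "v \<in> great_subsphere u" for v
  proof -
    let ?x = "point v"
    have ex: "(\<Sum>b\<in>H. (?x \<bullet> b) *\<^sub>R b) = ?x"
    proof -
      have "?x = (\<Sum>b\<in>B. (?x \<bullet> b) *\<^sub>R b)"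
        using orthonormal_basis_expand[OF B(1,2) _ fB, of ?x] sB by simp
      also have "\<dots> = (?x \<bullet> ?u) *\<^sub>R ?u + (\<Sum>b\<in>H. (?x \<bullet> b) *\<^sub>R b)"
        unfolding H_def by (rule sum.remove[OF fB uB])
      finally show ?thesis using v by (simp add: great_subsphere_def)
    qed
    have E1: "(\<Sum>c\<in>H. (?x \<bullet> c) * dir_deriv c p ?x) = real k * p ?x"
      using dir_deriv_sum_direction[OF p, of "\<lambda>c. ?x \<bullet> c" H ?x] euler_homogeneous[of p k ?x, OF hom]
      by (simp add: ex)
    have E2: "(\<Sum>b\<in>H. \<Sum>c\<in>H. (?x \<bullet> c) * ((?x \<bullet> b) * dir_deriv b (dir_deriv c p) ?x)) = real k * (real k - 1) * p ?x"
    proof -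
      have "real k * (real k - 1) * p ?x = dir_deriv (\<Sum>b\<in>H. (?x \<bullet> b) *\<^sub>R b) (dir_deriv ?x p) ?x"
        using euler_homogeneous_second[OF p hom, of ?x] by (simp add: ex)
      also have "\<dots> = (\<Sum>b\<in>H. (?x \<bullet> b) * dir_deriv b (dir_deriv ?x p) ?x)"
        by (rule dir_deriv_sum_direction[OF dp])
      also have "\<dots> = (\<Sum>b\<in>H. (?x \<bullet> b) * dir_deriv (\<Sum>c\<in>H. (?x \<bullet> c) *\<^sub>R c) (dir_deriv b p) ?x)"
        by (simp only: ex dir_deriv_commute[OF p, of _ ?x])
      also have "\<dots> = (\<Sum>b\<in>H. (?x \<bullet> b) * (\<Sum>c\<in>H. (?x \<bullet> c) * dir_deriv c (dir_deriv b p) ?x))"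
        by (simp only: dir_deriv_sum_direction[OF dp])
      also have "\<dots> = (\<Sum>b\<in>H. \<Sum>c\<in>H. (?x \<bullet> c) * ((?x \<bullet> b) * dir_deriv b (dir_deriv c p) ?x))"
        by (simp add: sum_distrib_left dir_deriv_commute[OF p] mult_ac)
      finally show ?thesis ..
    qed
    have sq: "(\<Sum>b\<in>H. (?x \<bullet> b) * (?x \<bullet> b)) = 1"
    proof -
      have "1 = ?x \<bullet> (\<Sum>b\<in>H. (?x \<bullet> b) *\<^sub>R b)" by (simp add: ex norm_eq_1[symmetric])
      then show ?thesis by (simp add: inner_sum_right)
    qed
    have lap: "(\<Sum>c\<in>H. dir_deriv c (dir_deriv c p) ?x) = - D ?x"
      using laplacian_orthonormal_basis[OF p fB B sB, of ?x] harm[of ?x] sum.remove[OF fB uB, of "\<lambda>c. dir_deriv c (dir_deriv c p) ?x"]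
      by (simp add: H_def D_def)
    have "(\<Sum>b\<in>H. \<Sum>c\<in>H. \<Lambda> b c ?x) =
        (\<Sum>b\<in>H. \<Sum>c\<in>H. (?x \<bullet> b) * ((b \<bullet> c) * dir_deriv c p ?x))
        + (\<Sum>b\<in>H. \<Sum>c\<in>H. (?x \<bullet> b) * (?x \<bullet> b) * dir_deriv c (dir_deriv c p) ?x)
        - (\<Sum>b\<in>H. \<Sum>c\<in>H. (?x \<bullet> c) * dir_deriv c p ?x)
        - (\<Sum>b\<in>H. \<Sum>c\<in>H. (?x \<bullet> c) * ((?x \<bullet> b) * dir_deriv b (dir_deriv c p) ?x))"
      by (simp add: \<Lambda> sum.distrib sum_subtractf cong: sum.cong)
    also have "(\<Sum>b\<in>H. \<Sum>c\<in>H. (?x \<bullet> b) * ((b \<bullet> c) * dir_deriv c p ?x)) = (\<Sum>b\<in>H. (?x \<bullet> b) * dir_deriv b p ?x)"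
    proof (rule sum.cong[OF refl])
      fix b assume b: "b \<in> H"
      have "(\<Sum>c\<in>H. (?x \<bullet> b) * ((b \<bullet> c) * dir_deriv c p ?x)) = (\<Sum>c\<in>H. if b = c then (?x \<bullet> b) * dir_deriv c p ?x else 0)"
        using b by (intro sum.cong refl) (simp add: bc)
      then show "(\<Sum>c\<in>H. (?x \<bullet> b) * ((b \<bullet> c) * dir_deriv c p ?x)) = (?x \<bullet> b) * dir_deriv b p ?x"
        using b fH by simp
    qed
    also have "(\<Sum>b\<in>H. \<Sum>c\<in>H. (?x \<bullet> b) * (?x \<bullet> b) * dir_deriv c (dir_deriv c p) ?x) = - D ?x"
      by (simp only: sum_product[symmetric] sq lap mult_1)
    also have "(\<Sum>b\<in>H. \<Sum>c\<in>H. (?x \<bullet> c) * dir_deriv c p ?x) = (real DIM('a) - 1) * (real k * p ?x)"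
      by (simp add: E1 cH)
    finally show ?thesis unfolding E1 E2 by (simp add: algebra_simps)
  qed
  have cD: "continuous_on UNIV (\<lambda>v. D (point v))" and cp: "continuous_on UNIV (\<lambda>v. p (point v))"
    unfolding D_def by (intro continuous_on_polynomial_point ddp p)+
  have c\<Lambda>: "continuous_on UNIV (\<lambda>v. \<Lambda> b c (point v))" for b c
    by (rule continuous_on_polynomial_point[OF pol\<Lambda>])
  have "0 = (\<Sum>b\<in>H. \<Sum>c\<in>H. funk (\<lambda>v. \<Lambda> b c (point v)) u)" by (simp add: zero)
  also have "\<dots> = funk (\<lambda>v. \<Sum>b\<in>H. \<Sum>c\<in>H. \<Lambda> b c (point v)) u"
    by (simp add: funk_sum fH c\<Lambda> continuous_on_sum)
  also have "\<dots> = funk (\<lambda>v. - 1 * D (point v) + - (real k * (real k + real DIM('a) - 3)) * p (point v)) u"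
    by (rule funk_cong) (simp add: sum)
  also have "\<dots> = - 1 * funk (\<lambda>v. D (point v)) u + - (real k * (real k + real DIM('a) - 3)) * funk (\<lambda>v. p (point v)) u"
    using funk_add[OF continuous_on_mult_left[OF cD] continuous_on_mult_left[OF cp]]
    by (simp only: funk_cmult[OF borel_measurable_continuous_onI[OF cD]] funk_cmult[OF borel_measurable_continuous_onI[OF cp]])
  finally show ?thesis by (simp add: D_def)
qed

text \<open>
  Minus the reflection in the pole fixes the pole and acts as \<open>-1\<close> on its great subsphere.
\<close>

lemma funk_odd:
  fixes f :: "'a :: euclidean_space usphere \<Rightarrow> real"
  assumes f: "f \<in> borel_measurable borel"
    and odd: "\<And>v w. point w = - point v \<Longrightarrow> f w = - f v"
  shows "funk f u = 0"
proof -
  let ?T = "\<lambda>x. - reflect (point u) x"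
  have T: "orthogonal_transformation ?T"
    by (simp add: orthogonal_transformation_neg orthogonal_transformation_reflect)
  have "point u \<bullet> point u = 1" by (simp add: norm_eq_1[symmetric])
  then have "rot ?T u = u"
    unfolding point_inject[symmetric] point_rot[OF T] by (simp add: reflect_def algebra_simps scaleR_2)
  then have "funk f u = funk (\<lambda>v. f (rot ?T v)) u" using funk_rot[OF T f, of u] by simp
  also have "\<dots> = funk (\<lambda>v. -1 * f v) u"
  proof (rule funk_cong)
    fix v assume "v \<in> great_subsphere u"
    then have "point (rot ?T v) = - point v"
      by (simp add: point_rot[OF T]) (simp add: reflect_def great_subsphere_def)
    then show "f (rot ?T v) = -1 * f v" using odd by simp
  qed
  also have "\<dots> = -1 * funk f u" by (rule funk_cmult[OF f])
  finally show ?thesis by simp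
qed

text \<open>
  Induction in steps of two: the second derivative of \<open>p\<close> along the pole is harmonic and homogeneous of
  degree two less, and its average and its value at the pole are known multiples of those of \<open>p\<close>.
  Homogeneity is required for nonzero scalars only; this form passes to the second derivative.
\<close>

lemma funk_harmonic_polynomial:
  fixes p :: "'a :: euclidean_space \<Rightarrow> real"
  assumes n: "3 \<le> DIM('a)" and "real_polynomial_function p"
    and "\<And>c x. c \<noteq> 0 \<Longrightarrow> p (c *\<^sub>R x) = c ^ d * p x"
    and "\<And>x. laplacian p x = 0"
  shows "funk (\<lambda>v. p (point v)) u = funk_multiplier DIM('a) d * p (point u)"
  using assms(2-)
proof (induction d arbitrary: p rule: induct_nat_012)
  case 0
  \<comment> \<open>homogeneity of degree \<open>0\<close> is assumed away from the scalar \<open>0\<close>, which continuity supplies\<close>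
  have const: "p x = p 0" for x
  proof (rule tendsto_unique)
    have "isCont p 0" using 0(1) by (rule continuous_real_polymonial_function)
    then have "((\<lambda>c. p (c *\<^sub>R x)) \<longlongrightarrow> p 0) (at 0)"
      by (intro isCont_tendsto_compose[of 0 p] tendsto_eq_intros) auto
    then show "((\<lambda>c. p x) \<longlongrightarrow> p 0) (at (0 :: real))"
      by (rule Lim_transform_eventually) (use 0(2) in \<open>auto simp: eventually_at_filter\<close>)
  qed auto
  have "(\<lambda>v. p (point v)) = (\<lambda>_. p (point u))"
    by (rule ext) (rule trans[OF const const[symmetric]])
  then show ?case using n funk_const[of "p (point u)" u] by simp
next
  case 1
  \<comment> \<open>a linear form is odd\<close>
  have "funk (\<lambda>v. p (point v)) u = 0"
  proof (rule funk_odd)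
    show "(\<lambda>v. p (point v)) \<in> borel_measurable borel"
      by (intro borel_measurable_continuous_onI continuous_on_polynomial_point 1)
    show "p (point w) = - p (point v)" if "point w = - point v" for v w
      using 1(2)[of "-1" "point v"] that by simp
  qed
  then show ?case by simp
next
  case (ge2 d)
  let ?D = "dir_deriv (point u) (dir_deriv (point u) p)"
  note p = ge2(3) and hom = ge2(4) and harm = ge2(5)
  note dp = real_polynomial_function_dir_deriv[OF p]
  note ddp = real_polynomial_function_dir_deriv[OF dp]
  have homD: "?D (c *\<^sub>R x) = c ^ d * ?D x" if c: "c \<noteq> 0" for c x
  proof -
    have "dir_deriv (point u) p (c *\<^sub>R y) = (c ^ Suc (Suc d) / c) * dir_deriv (point u) p y" for y
      by (rule dir_deriv_homogeneous[OF p c hom[OF c]])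
    then have "?D (c *\<^sub>R x) = (c ^ Suc (Suc d) / c / c) * ?D x"
      by (rule dir_deriv_homogeneous[OF dp c])
    then show ?thesis using c by simp
  qed
  have comm: "dir_deriv b (dir_deriv (point u) (dir_deriv (point u) q)) = dir_deriv (point u) (dir_deriv (point u) (dir_deriv b q))"
    if q: "real_polynomial_function q" for b and q :: "'a \<Rightarrow> real"
    by (simp only: dir_deriv_commute[OF real_polynomial_function_dir_deriv[OF q], of b] dir_deriv_commute[OF q, of b])
  have "laplacian ?D x = 0" for x
  proof -
    have "laplacian ?D x = (\<Sum>b\<in>Basis. dir_deriv (point u) (dir_deriv (point u) (dir_deriv b (dir_deriv b p))) x)"
      unfolding laplacian_eq_dir_deriv[OF ddp]
      by (simp only: comm[OF p] comm[OF real_polynomial_function_dir_deriv[OF p]])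
    also have "\<dots> = dir_deriv (point u) (dir_deriv (point u) (\<lambda>x. \<Sum>b\<in>Basis. dir_deriv b (dir_deriv b p) x)) x"
      by (simp add: dir_deriv_sum real_polynomial_function_dir_deriv p)
    also have "(\<lambda>x. \<Sum>b\<in>Basis. dir_deriv b (dir_deriv b p) x) = (\<lambda>x. 0)"
      using harm laplacian_eq_dir_deriv[OF p] by simp
    finally show ?thesis by simp
  qed
  from ge2(1)[OF ddp homD this]
  have "funk (\<lambda>v. ?D (point v)) u = funk_multiplier DIM('a) d * ?D (point u)" by simp
  also have "?D (point u) = (real d + 2) * (real d + 1) * p (point u)"
    using euler_homogeneous_second[OF p hom, of "point u"] by (simp add: algebra_simps)
  finally have "- ((real d + 2) * (real d + real DIM('a) - 1)) * funk (\<lambda>v. p (point v)) u =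
      funk_multiplier DIM('a) d * ((real d + 2) * (real d + 1) * p (point u))"
    using funk_second_derivative_along_pole[OF _ p hom harm, of u] n by (simp add: algebra_simps)
  moreover have "real d + 2 > 0" "real d + real DIM('a) - 1 > 0" using n by auto
  moreover have "F = - (e / q) * m * P" if "- (r * q) * F = m * (r * e * P)" "r > 0" "q > 0" for F e q m P r :: real
  proof -
    have "r * (q * F + e * m * P) = 0" using that(1) by (simp add: algebra_simps)
    then have "q * F = - (e * m * P)" using that(2) by simp
    then show ?thesis using that(3) by (simp add: field_simps)
  qed
  ultimately show ?case
    unfolding funk_multiplier_Suc_Suc[OF n] by blast
qed


section \<open>The linearization at the ball\<close>

text \<open>
  The Frechet derivative is unique, so all linearizations agree on continuous functions, which are
  dense.
\<close>

lemma is_linearization_at_ball_unique: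
  assumes D: "(S has_derivative D) (at (const_bcontfun 1))"
    and L: "\<And>\<psi>. blinfun_apply L (to_L2 \<psi>) = to_L2 (D \<psi>)"
  shows "is_linearization_at_ball S M \<longleftrightarrow> M = L"
proof
  assume "is_linearization_at_ball S M"
  then obtain D' where "(S has_derivative D') (at (const_bcontfun 1))"
    and M: "\<And>\<psi>. blinfun_apply M (to_L2 \<psi>) = to_L2 (D' \<psi>)"
    unfolding is_linearization_at_ball_def by blast
  then have "D' = D" using D by (metis has_derivative_unique)
  then show "M = L" using M L by (intro blinfun_eqI_on_continuous) simp
qed (use D L in \<open>auto simp: is_linearization_at_ball_def\<close>)

lemma funk_continuous_spherical_harmonic:
  fixes Y :: "'a :: euclidean_space usphere \<Rightarrow>\<^sub>C real"
  assumes n: "3 \<le> DIM('a)" and Y: "Y \<in> spherical_harmonics d"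
  shows "funk_continuous Y = funk_multiplier DIM('a) d *\<^sub>R Y"
proof (rule bcontfun_eqI)
  fix u
  obtain p where "real_polynomial_function p" "\<And>c x. p (c *\<^sub>R x) = c ^ d * p x"
      "\<And>x. laplacian p x = 0" and Y: "apply_bcontfun Y = (\<lambda>v. p (point v))"
    using Y by (auto simp: spherical_harmonics_def fun_eq_iff)
  then have "funk (apply_bcontfun Y) u = funk_multiplier DIM('a) d * apply_bcontfun Y u"
    unfolding Y by (intro funk_harmonic_polynomial n) auto
  then show "apply_bcontfun (funk_continuous Y) u = apply_bcontfun (funk_multiplier DIM('a) d *\<^sub>R Y) u"
    using n by (simp add: apply_funk_continuous)
qed

definition linearized_shape_map :: "'a :: euclidean_space sphere_L2 \<Rightarrow>\<^sub>L 'a sphere_L2" where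
  "linearized_shape_map = Blinfun (\<lambda>F. (real DIM('a) - 1) *\<^sub>R funk_L2 F)"

lemma linearized_shape_map_to_L2:
  fixes \<psi> :: "'a :: euclidean_space usphere \<Rightarrow>\<^sub>C real"
  assumes n: "2 \<le> DIM('a)"
  shows "blinfun_apply linearized_shape_map (to_L2 \<psi>) = to_L2 ((real DIM('a) - 1) *\<^sub>R funk_continuous \<psi>)"
proof -
  have "bounded_linear (\<lambda>F :: 'a sphere_L2. (real DIM('a) - 1) *\<^sub>R funk_L2 F)"
    by (rule bounded_linear_const_scaleR[OF bounded_linear_funk_L2[OF n]])
  then show ?thesis
    unfolding linearized_shape_map_def
    by (simp add: bounded_linear_Blinfun_apply funk_L2_to_L2[OF n] to_L2_scaleR)
qed

theorem theorem1p2: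
  fixes n :: nat
  assumes "n = DIM('a :: euclidean_space)" and "n \<ge> 3"
  shows
    "(\<exists>L :: 'a sphere_L2 \<Rightarrow>\<^sub>L 'a sphere_L2.
        (\<forall>M. is_linearization_at_ball shape_map M \<longleftrightarrow> M = L) \<and>
        (\<forall>d. \<forall>Y\<in>spherical_harmonics d.
           blinfun_apply L (to_L2 Y) = ((real n - 1) * funk_multiplier n d) *\<^sub>R to_L2 Y) \<and>
        (\<forall>M. is_linearization_at_ball (shape_map \<circ> shape_map) M \<longleftrightarrow> M = L o\<^sub>L L) \<and>
        (\<forall>d. \<forall>Y\<in>spherical_harmonics d.
           blinfun_apply (L o\<^sub>L L) (to_L2 Y) = sigma_mult n d *\<^sub>R to_L2 Y)) \<and>
     (\<forall>d. odd d \<longrightarrow> (real n - 1) * funk_multiplier n d = 0) \<and>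
     (\<forall>m. (real n - 1) * funk_multiplier n (2 * m) =
        (-1) ^ m * (((real n - 1) * fact (2 * m) * Gamma ((real n - 2) / 2 + real m) * Gamma (real n - 2)) /
          (fact m * Gamma ((real n - 2) / 2) * Gamma (real n - 2 + 2 * real m)))) \<and>
     (real n - 1) * funk_multiplier n 0 = real n - 1 \<and>
     (real n - 1) * funk_multiplier n 2 = -1 \<and>
     (real n - 1) * funk_multiplier n 4 = 3 / (real n + 1) \<and>
     sigma_mult n 0 = (real n - 1)\<^sup>2 \<and> (real n - 1)\<^sup>2 > 1 \<and>
     sigma_mult n 2 = 1 \<and>
     (\<forall>d\<ge>4. 0 \<le> sigma_mult n d \<and> sigma_mult n d < 1) \<and>
     strict_antimono_on {d. even d \<and> d \<ge> 4} (sigma_mult n) \<and>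
     (\<forall>d\<ge>4. sigma_mult n d \<le> sigma_mult n 4) \<and>
     gap n = 1 - 9 / (real n + 1)\<^sup>2 \<and>
     gap n = (real n - 2) * (real n + 4) / (real n + 1)\<^sup>2"
proof -
  let ?L = "linearized_shape_map :: 'a sphere_L2 \<Rightarrow>\<^sub>L 'a sphere_L2"
  have n2: "2 \<le> DIM('a)" and n3: "3 \<le> DIM('a)" using assms by simp_all
  note L = linearized_shape_map_to_L2[OF n2]
  have unique: "is_linearization_at_ball shape_map M \<longleftrightarrow> M = ?L" for M
    by (rule is_linearization_at_ball_unique[OF has_derivative_shape_map[OF n2] L])
  have unique2: "is_linearization_at_ball (shape_map \<circ> shape_map) M \<longleftrightarrow> M = ?L o\<^sub>L ?L" for M
    by (rule is_linearization_at_ball_unique[OF has_derivative_shape_map_twice[OF n2]]) (simp add: L)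
  have eigen: "blinfun_apply ?L (to_L2 Y) = ((real n - 1) * funk_multiplier n d) *\<^sub>R to_L2 Y"
    if "Y \<in> spherical_harmonics d" for d Y
    using assms(1) by (simp add: L funk_continuous_spherical_harmonic[OF n3 that] to_L2_scaleR)
  have eigen2: "blinfun_apply (?L o\<^sub>L ?L) (to_L2 Y) = sigma_mult n d *\<^sub>R to_L2 Y"
    if "Y \<in> spherical_harmonics d" for d Y
    by (simp add: eigen[OF that] blinfun.scaleR_right sigma_mult_def power2_eq_square)
  have "(real n - 1)\<^sup>2 > 1"
    using power_strict_mono[of 1 "real n - 1" 2] assms(2) by simp
  moreover have "strict_antimono_on {d. even d \<and> d \<ge> 4} (sigma_mult n)"
    by (rule monotone_on_subset[OF sigma_mult_strict_antimono[OF assms(2)]]) auto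
  moreover have "\<forall>d\<ge>4. 0 \<le> sigma_mult n d \<and> sigma_mult n d < 1"
    using sigma_mult_le_4[OF assms(2)] sigma_mult_4_less_1[OF assms(2)]
    by (auto simp: sigma_mult_def intro: le_less_trans)
  moreover have "(real n - 1) * funk_multiplier n (2 * m) =
      (-1) ^ m * (((real n - 1) * fact (2 * m) * Gamma ((real n - 2) / 2 + real m) * Gamma (real n - 2)) /
        (fact m * Gamma ((real n - 2) / 2) * Gamma (real n - 2 + 2 * real m)))" for m
    unfolding funk_multiplier_even_Gamma[OF assms(2)] by simp
  moreover have "sigma_mult n 0 = (real n - 1)\<^sup>2" "sigma_mult n 2 = 1"
    using funk_multiplier_2[OF assms(2)] by (simp_all add: sigma_mult_def)
  ultimately show ?thesis
    using unique unique2 eigen eigen2 funk_multiplier_odd[OF assms(2)] funk_multiplier_2[OF assms(2)]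
      funk_multiplier_4[OF assms(2)] sigma_mult_le_4[OF assms(2)] gap_eq[OF assms(2)]
      gap_eq_product[OF assms(2)]
    by (intro conjI exI[of _ ?L]) simp_all
qed

end
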